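(* Let $N^{n+1}\subset S^{n+2}$ be a minimal isoparametric hypersurface of the unit sphere with positive Ricci curvature and with $g=4$ distinct principal curvatures of multiplicities $m_1,m_2$. Then the pointwise ACS inequality $$\Delta(X,\nu)>0\quad\text{for every } p\in N \text{ and every pair of orthogonal unit vectors } X,\nu\in T_pN$$ holds if and only if $\min\{m_1,m_2\}\ge 4$.
   Context: Isoparametric hypersurfaces: a hypersurface $N^{n+1}\subset S^{n+2}$ is called isoparametric if there are a nonconstant smooth function $f$ on $S^{n+2}$ and smooth functions $a,b$ with $N=f^{-1}(c)$ for a regular value $c$ of $f$, $|\nabla f|^2=b(f)$ and $\Delta f=a(f)$; equivalently, all its principal curvatures are constant. For $g=4$ distinct principal curvatures $\lambda_1>\lambda_2>\lambda_3>\lambda_4$, the multiplicities satisfy $m_3=m_1$, $m_4=m_2$, so $n+1=2(m_1+m_2)$. "Minimal" means the trace of the shape operator of $N\subset S^{n+2}$ vanishes. Definition of $\Delta$: for $p\in N$, a unit vector $\nu\in T_pN$, and $X\in T_pN$ orthogonal to $\nu$, let $\{e_1,\dots,e_n\}$ be any orthonormal basis of the orthogonal complement of $\nu$ in $T_pN$ and set $$\Delta(X,\nu):=\sum_{k=1}^n R^N(e_k,X,e_k,X)+\operatorname{Ric}_N(\nu,\nu)|X|^2-\sum_{k=1}^n |\Pi(e_k,X)|^2-\sum_{k=1}^n |\Pi(e_k,\nu)|^2|X|^2,$$ where $R^N$ is the curvature tensor of $N$ (sign convention: $R^N(u,v,u,v)$ is the sectional curvature of the plane spanned by orthonormal $u,v$),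 $\operatorname{Ric}_N$ is its Ricci curvature, and $\Pi$ is the second fundamental form (vector-valued) of the embedding $N\subset S^{n+2}\subset\mathbb{R}^{n+3}$. *)

theory Defs
  imports "HOL-Analysis.Analysis"
begin

section \<open>Smooth maps\<close>

primrec Ck_on :: "nat \<Rightarrow> 'a::euclidean_space set \<Rightarrow> ('a \<Rightarrow> 'b::euclidean_space) \<Rightarrow> bool" where
  "Ck_on 0 U F \<longleftrightarrow> continuous_on U F"
| "Ck_on (Suc k) U F \<longleftrightarrow>
     (\<forall>x\<in>U. F differentiable (at x)) \<and> (\<forall>v. Ck_on k U (\<lambda>x. frechet_derivative F (at x) v))"

text \<open>Smoothness on an arbitrary subset of a Euclidean space: local existence of smooth extensions
  to open sets.  On an embedded submanifold this is smoothness in the sense of manifolds.\<close>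

definition smooth_map_on :: "'a::euclidean_space set \<Rightarrow> ('a \<Rightarrow> 'b::euclidean_space) \<Rightarrow> bool" where
  "smooth_map_on S f \<longleftrightarrow>
     (\<forall>x\<in>S. \<exists>U F. open U \<and> x \<in> U \<and> (\<forall>k. Ck_on k U F) \<and> (\<forall>y\<in>S \<inter> U. F y = f y))"


section \<open>Linear algebra on subspaces\<close>

text \<open>An orthonormal basis of the subspace \<open>V\<close>; it is only used in expressions
  that do not depend on the choice.\<close>

definition onb_of :: "'a::euclidean_space set \<Rightarrow> 'a set" where
  "onb_of V = (SOME B. pairwise orthogonal B \<and> (\<forall>b\<in>B. norm b = 1) \<and> span B = V)"

definition trace_on :: "'a::euclidean_space set \<Rightarrow> ('a \<Rightarrow> 'a) \<Rightarrow> real" where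
  "trace_on V L = (\<Sum>e\<in>onb_of V. L e \<bullet> e)"

definition oproj :: "'a::euclidean_space set \<Rightarrow> 'a \<Rightarrow> 'a" where
  "oproj V x = (THE y. y \<in> V \<and> (\<forall>v\<in>V. (x - y) \<bullet> v = 0))"


section \<open>Calculus on a submanifold of a Euclidean space\<close>

text \<open>Tangent vectors are velocities of curves running in \<open>N\<close>.  Only the behaviour of the curve
  near \<open>0\<close> matters, so that curves may be taken to be defined on all of the real line; on an
  embedded submanifold, differentiability at \<open>0\<close> gives the same vectors as smooth curves.\<close>

definition tangent_space :: "'a::euclidean_space set \<Rightarrow> 'a \<Rightarrow> 'a set" where
  "tangent_space N p =
     {v. \<exists>\<gamma>. (\<forall>t::real. \<gamma> t \<in> N) \<and> \<gamma> 0 = p \<and> (\<gamma> has_vector_derivative v) (at 0)}"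

text \<open>The derivative of a map given along \<open>N\<close>.  The Frechet derivative within \<open>N\<close> is not unique
  as a linear map on the ambient space, but its values on tangent vectors of \<open>N\<close> are; it is only
  applied to those.\<close>

definition tderiv :: "'a::euclidean_space set \<Rightarrow> ('a \<Rightarrow> 'b::euclidean_space) \<Rightarrow> 'a \<Rightarrow> 'a \<Rightarrow> 'b" where
  "tderiv N Y p v = frechet_derivative Y (at p within N) v"

definition tgrad :: "'a::euclidean_space set \<Rightarrow> ('a \<Rightarrow> real) \<Rightarrow> 'a \<Rightarrow> 'a" where
  "tgrad N f p =
     (THE g. g \<in> tangent_space N p \<and> (\<forall>v\<in>tangent_space N p. g \<bullet> v = tderiv N f p v))"

text \<open>The Levi-Civita connection of the metric induced on \<open>N\<close>.\<close>

definition cov_deriv :: "'a::euclidean_space set \<Rightarrow> ('a \<Rightarrow> 'a) \<Rightarrow> ('a \<Rightarrow> 'a) \<Rightarrow> 'a \<Rightarrow> 'a" where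
  "cov_deriv N X Y p = oproj (tangent_space N p) (tderiv N Y p (X p))"

definition lie_bracket :: "'a::euclidean_space set \<Rightarrow> ('a \<Rightarrow> 'a) \<Rightarrow> ('a \<Rightarrow> 'a) \<Rightarrow> 'a \<Rightarrow> 'a" where
  "lie_bracket N X Y p = tderiv N Y p (X p) - tderiv N X p (Y p)"

text \<open>The divergence of the gradient.\<close>

definition laplacian :: "'a::euclidean_space set \<Rightarrow> ('a \<Rightarrow> real) \<Rightarrow> 'a \<Rightarrow> real" where
  "laplacian N f p =
     trace_on (tangent_space N p) (\<lambda>v. cov_deriv N (\<lambda>_. v) (tgrad N f) p)"

text \<open>An extension of \<open>u \<in> T\<^sub>pN\<close> to a tangent vector field on \<open>N\<close>; the tensors below do not depend
  on the choice of the extension.\<close>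

definition tangent_ext :: "'a::euclidean_space set \<Rightarrow> 'a \<Rightarrow> 'a \<Rightarrow> 'a" where
  "tangent_ext N u q = oproj (tangent_space N q) u"

definition curv_op ::
  "'a::euclidean_space set \<Rightarrow> ('a \<Rightarrow> 'a) \<Rightarrow> ('a \<Rightarrow> 'a) \<Rightarrow> ('a \<Rightarrow> 'a) \<Rightarrow> 'a \<Rightarrow> 'a" where
  "curv_op N X Y Z p =
     cov_deriv N X (cov_deriv N Y Z) p - cov_deriv N Y (cov_deriv N X Z) p
       - cov_deriv N (lie_bracket N X Y) Z p"

text \<open>\<open>R(u,v,w,z) = \<langle>R(u,v)z, w\<rangle>\<close>, so that \<open>R(u,v,u,v)\<close> is the sectional curvature of the plane
  spanned by orthonormal \<open>u\<close>, \<open>v\<close>.\<close>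

definition curvature :: "'a::euclidean_space set \<Rightarrow> 'a \<Rightarrow> 'a \<Rightarrow> 'a \<Rightarrow> 'a \<Rightarrow> 'a \<Rightarrow> real" where
  "curvature N p u v w z =
     curv_op N (tangent_ext N u) (tangent_ext N v) (tangent_ext N z) p \<bullet> w"

definition ricci :: "'a::euclidean_space set \<Rightarrow> 'a \<Rightarrow> 'a \<Rightarrow> 'a \<Rightarrow> real" where
  "ricci N p u v = (\<Sum>e\<in>onb_of (tangent_space N p). curvature N p e u e v)"

definition positive_ricci :: "'a::euclidean_space set \<Rightarrow> bool" where
  "positive_ricci N \<longleftrightarrow> (\<forall>p\<in>N. \<forall>u\<in>tangent_space N p. u \<noteq> 0 \<longrightarrow> ricci N p u u > 0)"

text \<open>The vector-valued second fundamental form of \<open>N\<close> in the ambient Euclidean space.\<close>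

definition second_ff :: "'a::euclidean_space set \<Rightarrow> 'a \<Rightarrow> 'a \<Rightarrow> 'a \<Rightarrow> 'a" where
  "second_ff N p u v =
     tderiv N (tangent_ext N v) p u
       - oproj (tangent_space N p) (tderiv N (tangent_ext N v) p u)"

definition ACS_Delta :: "'a::euclidean_space set \<Rightarrow> 'a \<Rightarrow> 'a \<Rightarrow> 'a \<Rightarrow> real" where
  "ACS_Delta N p X \<nu> =
     (let B = onb_of {u \<in> tangent_space N p. u \<bullet> \<nu> = 0} in
        (\<Sum>e\<in>B. curvature N p e X e X) + ricci N p \<nu> \<nu> * (norm X)\<^sup>2
        - (\<Sum>e\<in>B. (norm (second_ff N p e X))\<^sup>2)
        - (\<Sum>e\<in>B. (norm (second_ff N p e \<nu>))\<^sup>2 * (norm X)\<^sup>2))"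


section \<open>Hypersurfaces of the unit sphere\<close>

definition isoparametric_hypersurface :: "'a::euclidean_space set \<Rightarrow> bool" where
  "isoparametric_hypersurface N \<longleftrightarrow> N \<noteq> {} \<and>
     (\<exists>(f :: 'a \<Rightarrow> real) (a :: real \<Rightarrow> real) (b :: real \<Rightarrow> real) c.
        smooth_map_on (sphere 0 1) f \<and> \<not> f constant_on sphere 0 1 \<and>
        smooth_map_on (f ` sphere 0 1) a \<and> smooth_map_on (f ` sphere 0 1) b \<and>
        (\<forall>p\<in>sphere 0 1. (norm (tgrad (sphere 0 1) f p))\<^sup>2 = b (f p)) \<and>
        (\<forall>p\<in>sphere 0 1. laplacian (sphere 0 1) f p = a (f p)) \<and>
        (\<forall>p\<in>sphere 0 1. f p = c \<longrightarrow> tgrad (sphere 0 1) f p \<noteq> 0) \<and>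
        N = {p \<in> sphere 0 1. f p = c})"

definition unit_normal_field :: "'a::euclidean_space set \<Rightarrow> ('a \<Rightarrow> 'a) \<Rightarrow> bool" where
  "unit_normal_field N \<xi> \<longleftrightarrow> smooth_map_on N \<xi> \<and>
     (\<forall>p\<in>N. norm (\<xi> p) = 1 \<and> \<xi> p \<in> tangent_space (sphere 0 1) p \<and>
            (\<forall>v\<in>tangent_space N p. \<xi> p \<bullet> v = 0))"

text \<open>The covariant derivative of \<open>\<xi>\<close> in the sphere in a direction \<open>v \<in> T\<^sub>pN\<close> is automatically
  tangent to \<open>N\<close>, because \<open>\<xi>\<close> is a unit field.\<close>

definition shape_operator :: "'a::euclidean_space set \<Rightarrow> ('a \<Rightarrow> 'a) \<Rightarrow> 'a \<Rightarrow> 'a \<Rightarrow> 'a" where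
  "shape_operator N \<xi> p v = - oproj (tangent_space (sphere 0 1) p) (tderiv N \<xi> p v)"

definition minimal_hypersurface :: "'a::euclidean_space set \<Rightarrow> ('a \<Rightarrow> 'a) \<Rightarrow> bool" where
  "minimal_hypersurface N \<xi> \<longleftrightarrow>
     (\<forall>p\<in>N. trace_on (tangent_space N p) (shape_operator N \<xi> p) = 0)"

definition curvature_space :: "'a::euclidean_space set \<Rightarrow> ('a \<Rightarrow> 'a) \<Rightarrow> 'a \<Rightarrow> real \<Rightarrow> 'a set" where
  "curvature_space N \<xi> p \<kappa> = {v \<in> tangent_space N p. shape_operator N \<xi> p v = \<kappa> *\<^sub>R v}"

definition principal_curvatures :: "'a::euclidean_space set \<Rightarrow> ('a \<Rightarrow> 'a) \<Rightarrow> 'a \<Rightarrow> real set" where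
  "principal_curvatures N \<xi> p = {\<kappa>. \<exists>v\<in>curvature_space N \<xi> p \<kappa>. v \<noteq> 0}"

text \<open>Four distinct principal curvatures, constant along \<open>N\<close>, with multiplicities
  \<open>(m\<^sub>1, m\<^sub>2, m\<^sub>1, m\<^sub>2)\<close> in decreasing order.\<close>

definition four_principal_curvatures ::
  "'a::euclidean_space set \<Rightarrow> ('a \<Rightarrow> 'a) \<Rightarrow> nat \<Rightarrow> nat \<Rightarrow> bool" where
  "four_principal_curvatures N \<xi> m1 m2 \<longleftrightarrow>
     (\<exists>k1 k2 k3 k4. k1 > k2 \<and> k2 > k3 \<and> k3 > k4 \<and>
        (\<forall>p\<in>N. principal_curvatures N \<xi> p = {k1, k2, k3, k4} \<and>
               dim (curvature_space N \<xi> p k1) = m1 \<and> dim (curvature_space N \<xi> p k2) = m2 \<and>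
               dim (curvature_space N \<xi> p k3) = m1 \<and> dim (curvature_space N \<xi> p k4) = m2))"

end

theory Submission
  imports Defs
begin

text \<open>Let \<open>A\<close> be the shape operator. By the Gauss equation and minimality, for orthonormal \<open>X, \<nu>\<close>
  \<open>Delta(X,\<nu>) = 2n - 2 - 2|AX|\<^sup>2 - 2|A\<nu>|\<^sup>2 - \<langle>AX,X\<rangle>\<langle>A\<nu>,\<nu>\<rangle> + 2\<langle>AX,\<nu>\<rangle>\<^sup>2 + \<langle>A\<nu>,\<nu>\<rangle>\<^sup>2\<close>,
  so everything depends on the values of the principal curvatures. These are found locally: the
  Codazzi equation, the Ricci identity for the second covariant derivative of \<open>A\<close> and the second
  variation of a constant eigenvalue give Cartan's identity
  \<open>\<Sum>\<^sub>j m\<^sub>j (1 + k\<^sub>i k\<^sub>j) / (k\<^sub>i - k\<^sub>j) = 0\<close>. For multiplicities \<open>(m\<^sub>1,m\<^sub>2,m\<^sub>1,m\<^sub>2)\<close> it forces the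
  curvatures to be cotangents of angles in steps of \<open>\<pi>/4\<close>, and minimality then gives
  \<open>m\<^sub>1 (k\<^sub>1\<^sup>2 - 1)\<^sup>2 = 4 m\<^sub>2 k\<^sub>1\<^sup>2\<close>, whence \<open>1 + 4m\<^sub>2/m\<^sub>1 < k\<^sub>1\<^sup>2 < 2 + 4m\<^sub>2/m\<^sub>1\<close>, and likewise for \<open>k\<^sub>4\<close>.
  If \<open>min m\<^sub>1 m\<^sub>2 < 4\<close>, then Delta is not positive on two orthonormal principal vectors for
  \<open>k\<^sub>1\<close> or \<open>k\<^sub>4\<close>, which exist because positive Ricci curvature excludes multiplicity one.\<close>

section \<open>Smooth functions on open sets\<close>

text \<open>No charts, frames or flows are used. All data are extended from \<open>N\<close> to an
  open set of the ambient space and differentiated there in the directions of constant vectors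
  projected to the tangent space. The obstacle is that the extensions satisfy the geometric
  identities only on \<open>N\<close>, and that a constant vector tangent at one point is not
  tangent nearby. So identities are differentiated only along \<open>N\<close>, and the Codazzi
  equation is established for arbitrary ambient vectors before it is differentiated a second time.
  Cartan's identity holds because the cubic tensor given by the derivative of \<open>A\<close> is
  totally symmetric, which turns the sum into a double sum of antisymmetric terms. For positivity,
  the spectrum of \<open>A\<close> lies between \<open>k4\<close> and \<open>k1\<close>, so the
  squared norm of \<open>A X\<close> is at most an affine function of the inner product of
  \<open>A X\<close> and \<open>X\<close>. This leaves a polynomial inequality in two real
  variables. The constant 4 is tight in the method: multiplicities at least 4 leave exactly the
  slack that the estimate consumes, while 3 is excluded only by using that the other multiplicity is
  at least 3.\<close>

definition smooth_on :: "'a::euclidean_space set \<Rightarrow> ('a \<Rightarrow> 'b::euclidean_space) \<Rightarrow> bool" where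
  "smooth_on U F \<longleftrightarrow> (\<forall>k. Ck_on k U F)"

lemma Ck_on_SucD: "Ck_on (Suc k) U F \<Longrightarrow> Ck_on k U F"
proof (induction k arbitrary: F)
  case 0
  then show ?case
    by (auto intro!: continuous_at_imp_continuous_on differentiable_imp_continuous_within)
qed auto

lemma Ck_on_has_derivative:
  "Ck_on (Suc k) U F \<Longrightarrow> x \<in> U \<Longrightarrow> (F has_derivative frechet_derivative F (at x)) (at x)"
  by (auto simp: frechet_derivative_works[symmetric])

lemma Ck_on_cong:
  assumes "open U" "Ck_on k U F" "\<And>x. x \<in> U \<Longrightarrow> F x = G x"
  shows "Ck_on k U G"
  using assms(2,3)
proof (induction k arbitrary: F G)
  case 0
  then show ?case by (simp cong: continuous_on_cong)
next
  case (Suc k)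
  have d: "(G has_derivative frechet_derivative F (at x)) (at x)" if "x \<in> U" for x
    by (rule has_derivative_transform_within_open
        [OF Ck_on_has_derivative[OF Suc.prems(1) that] assms(1) that Suc.prems(2)])
  have e: "frechet_derivative G (at x) = frechet_derivative F (at x)" if "x \<in> U" for x
    by (rule frechet_derivative_at[OF d[OF that], symmetric])
  have "Ck_on k U (\<lambda>x. frechet_derivative G (at x) v)" for v
    by (rule Suc.IH[where F = "\<lambda>x. frechet_derivative F (at x) v"]) (use Suc.prems e in auto)
  with d show ?case by (auto simp: differentiable_def)
qed

lemma Ck_on_SucI:
  assumes "open U" "\<And>x. x \<in> U \<Longrightarrow> (F has_derivative F' x) (at x)" "\<And>v. Ck_on k U (\<lambda>x. F' x v)"
  shows "Ck_on (Suc k) U F"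
proof -
  have "frechet_derivative F (at x) = F' x" if "x \<in> U" for x
    by (rule frechet_derivative_at[OF assms(2)[OF that], symmetric])
  then show ?thesis
    using assms by (auto simp: differentiable_def intro: Ck_on_cong[where F = "\<lambda>x. F' x _"])
qed

lemma Ck_on_const: "open U \<Longrightarrow> Ck_on k U (\<lambda>x. c)"
  by (induction k arbitrary: c) auto

lemma Ck_on_linear:
  assumes "open U" "bounded_linear L" "Ck_on k U F"
  shows "Ck_on k U (\<lambda>x. L (F x))"
  using assms(3)
proof (induction k arbitrary: F)
  case 0
  then show ?case using bounded_linear.continuous_on[OF assms(2)] by auto
next
  case (Suc k)
  show ?case
  proof (rule Ck_on_SucI[OF assms(1)])
    show "((\<lambda>x. L (F x)) has_derivative (\<lambda>v. L (frechet_derivative F (at x) v))) (at x)"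
      if "x \<in> U" for x
      using bounded_linear.has_derivative[OF assms(2) Ck_on_has_derivative[OF Suc.prems that]] .
  qed (use Suc in auto)
qed

lemma Ck_on_add:
  assumes "open U" "Ck_on k U F" "Ck_on k U G"
  shows "Ck_on k U (\<lambda>x. F x + G x)"
  using assms(2,3)
proof (induction k arbitrary: F G)
  case 0
  then show ?case by (auto intro: continuous_intros)
next
  case (Suc k)
  show ?case
  proof (rule Ck_on_SucI[OF assms(1)])
    show "((\<lambda>x. F x + G x) has_derivative
        (\<lambda>v. frechet_derivative F (at x) v + frechet_derivative G (at x) v)) (at x)"
      if "x \<in> U" for x
      by (rule has_derivative_add[OF Ck_on_has_derivative[OF Suc.prems(1) that]
            Ck_on_has_derivative[OF Suc.prems(2) that]])
  qed (use Suc in auto)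
qed

lemma Ck_on_bilinear:
  assumes "open U" "bounded_bilinear B" "Ck_on k U F" "Ck_on k U G"
  shows "Ck_on k U (\<lambda>x. B (F x) (G x))"
  using assms(3,4)
proof (induction k arbitrary: F G)
  case 0
  then show ?case using bounded_bilinear.continuous_on[OF assms(2)] by auto
next
  case (Suc k)
  show ?case
  proof (rule Ck_on_SucI[OF assms(1)])
    show "((\<lambda>x. B (F x) (G x)) has_derivative
        (\<lambda>v. B (F x) (frechet_derivative G (at x) v) + B (frechet_derivative F (at x) v) (G x))) (at x)"
      if "x \<in> U" for x
      by (rule bounded_bilinear.FDERIV[OF assms(2) Ck_on_has_derivative[OF Suc.prems(1) that]
            Ck_on_has_derivative[OF Suc.prems(2) that]])
    show "Ck_on k U (\<lambda>x. B (F x) (frechet_derivative G (at x) v)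
        + B (frechet_derivative F (at x) v) (G x))" for v
      using Suc.prems Ck_on_SucD[OF Suc.prems(1)] Ck_on_SucD[OF Suc.prems(2)]
      by (intro Ck_on_add[OF assms(1)] Suc.IH) auto
  qed
qed

lemma smooth_on_has_derivative:
  "smooth_on U F \<Longrightarrow> x \<in> U \<Longrightarrow> (F has_derivative frechet_derivative F (at x)) (at x)"
  unfolding smooth_on_def by (blast intro: Ck_on_has_derivative[of 0])

lemma smooth_on_frechet: "smooth_on U F \<Longrightarrow> smooth_on U (\<lambda>x. frechet_derivative F (at x) v)"
  unfolding smooth_on_def by (metis Ck_on.simps(2))

lemma smooth_on_imp_continuous_on: "smooth_on U F \<Longrightarrow> continuous_on U F"
  unfolding smooth_on_def by (metis Ck_on.simps(1))

lemma smooth_on_subset: "smooth_on U F \<Longrightarrow> V \<subseteq> U \<Longrightarrow> smooth_on V F"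
  unfolding smooth_on_def
proof (intro allI)
  fix k assume "\<forall>k. Ck_on k U F" "V \<subseteq> U"
  then show "Ck_on k V F"
  proof (induction k arbitrary: F)
    case 0
    have "continuous_on U F" using 0(1)[rule_format, of 0] by simp
    then show ?case using 0(2) by (auto intro: continuous_on_subset)
  next
    case (Suc k)
    have "\<forall>k. Ck_on k U (\<lambda>x. frechet_derivative F (at x) v)" for v
      using Suc.prems(1) by (metis Ck_on.simps(2))
    moreover have "\<forall>x\<in>U. F differentiable at x"
      using Suc.prems(1)[rule_format, of "Suc 0"] by simp
    ultimately show ?case using Suc by auto
  qed
qed

lemma smooth_on_cong:
  "open U \<Longrightarrow> smooth_on U F \<Longrightarrow> (\<And>x. x \<in> U \<Longrightarrow> F x = G x) \<Longrightarrow> smooth_on U G"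
  unfolding smooth_on_def using Ck_on_cong by metis

lemma smooth_on_const: "open U \<Longrightarrow> smooth_on U (\<lambda>x. c)"
  by (simp add: smooth_on_def Ck_on_const)

lemma smooth_on_id: assumes "open U" shows "smooth_on U (\<lambda>x. x)"
  unfolding smooth_on_def
proof
  fix k show "Ck_on k U (\<lambda>x. x)"
    by (cases k) (auto intro: Ck_on_const[OF assms])
qed

lemma smooth_on_add:
  "open U \<Longrightarrow> smooth_on U F \<Longrightarrow> smooth_on U G \<Longrightarrow> smooth_on U (\<lambda>x. F x + G x)"
  by (simp add: smooth_on_def Ck_on_add)

lemma smooth_on_linear:
  "open U \<Longrightarrow> bounded_linear L \<Longrightarrow> smooth_on U F \<Longrightarrow> smooth_on U (\<lambda>x. L (F x))"
  by (simp add: smooth_on_def Ck_on_linear)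

lemma smooth_on_minus: "open U \<Longrightarrow> smooth_on U F \<Longrightarrow> smooth_on U (\<lambda>x. - F x)"
  by (rule smooth_on_linear[OF _ bounded_linear_minus[OF bounded_linear_ident]])

lemma smooth_on_diff:
  "open U \<Longrightarrow> smooth_on U F \<Longrightarrow> smooth_on U G \<Longrightarrow> smooth_on U (\<lambda>x. F x - G x)"
  using smooth_on_add[of U F "\<lambda>x. - G x"] by (simp add: smooth_on_minus)

lemma smooth_on_inner:
  "open U \<Longrightarrow> smooth_on U F \<Longrightarrow> smooth_on U G \<Longrightarrow> smooth_on U (\<lambda>x. F x \<bullet> G x)"
  by (simp add: smooth_on_def Ck_on_bilinear[OF _ bounded_bilinear_inner])

lemma smooth_on_scaleR:
  "open U \<Longrightarrow> smooth_on U F \<Longrightarrow> smooth_on U G \<Longrightarrow> smooth_on U (\<lambda>x. F x *\<^sub>R G x)"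
  by (simp add: smooth_on_def Ck_on_bilinear[OF _ bounded_bilinear_scaleR])

lemma smooth_on_sum:
  "open U \<Longrightarrow> (\<And>i. i \<in> I \<Longrightarrow> smooth_on U (F i)) \<Longrightarrow> smooth_on U (\<lambda>x. \<Sum>i\<in>I. F i x)"
  by (induction I rule: infinite_finite_induct) (auto intro: smooth_on_const smooth_on_add)

lemmas smooth_intros = smooth_on_const smooth_on_id smooth_on_add smooth_on_minus smooth_on_diff
  smooth_on_inner smooth_on_scaleR smooth_on_sum

section \<open>Smooth families of linear maps\<close>

lemma linear_basis_expansion:
  fixes L :: "'a::euclidean_space \<Rightarrow> 'b::real_vector"
  assumes "linear L"
  shows "L w = (\<Sum>i\<in>Basis. (w \<bullet> i) *\<^sub>R L i)"
proof -
  have "L w = L (\<Sum>i\<in>Basis. (w \<bullet> i) *\<^sub>R i)" by (simp add: euclidean_representation)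
  then show ?thesis by (simp add: linear_sum[OF assms] linear_scale[OF assms])
qed

lemma smooth_on_apply:
  fixes \<Phi> :: "'a::euclidean_space \<Rightarrow> 'c::euclidean_space \<Rightarrow> 'b::euclidean_space"
  assumes "open U" "\<And>x. x \<in> U \<Longrightarrow> linear (\<Phi> x)" "\<And>v. smooth_on U (\<lambda>x. \<Phi> x v)" "smooth_on U w"
  shows "smooth_on U (\<lambda>x. \<Phi> x (w x))"
proof -
  have "smooth_on U (\<lambda>x. \<Sum>i\<in>Basis. (w x \<bullet> i) *\<^sub>R \<Phi> x i)"
    using assms by (intro smooth_intros) auto
  then show ?thesis
    by (rule smooth_on_cong[OF assms(1)]) (rule linear_basis_expansion[OF assms(2), symmetric])
qed

text \<open>Smoothness of \<open>\<Phi>\<close> is known only on each fixed vector, so there is no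
  operator-valued map for the product rule. Expanding \<open>w x\<close> in \<open>Basis\<close>
  turns the pairing into a finite sum of scalar multiples, where the rule is available.\<close>

lemma frechet_apply:
  fixes \<Phi> :: "'a::euclidean_space \<Rightarrow> 'c::euclidean_space \<Rightarrow> 'b::euclidean_space"
  assumes U: "open U" "q \<in> U" and lin: "\<And>x. x \<in> U \<Longrightarrow> linear (\<Phi> x)"
    and sm: "\<And>v. smooth_on U (\<lambda>x. \<Phi> x v)" "smooth_on U w"
  shows "frechet_derivative (\<lambda>x. \<Phi> x (w x)) (at q) h
    = frechet_derivative (\<lambda>x. \<Phi> x (w q)) (at q) h + \<Phi> q (frechet_derivative w (at q) h)"
proof -
  let ?D = "\<lambda>v h. frechet_derivative (\<lambda>x. \<Phi> x v) (at q) h"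
  have D: "((\<lambda>x. \<Phi> x (v x)) has_derivative (\<lambda>h. (\<Sum>i\<in>Basis. (v q \<bullet> i) *\<^sub>R ?D i h
      + (frechet_derivative v (at q) h \<bullet> i) *\<^sub>R \<Phi> q i))) (at q)"
    if "smooth_on U v" for v :: "'a \<Rightarrow> 'c"
  proof (rule has_derivative_transform_within_open[OF _ U])
    have 1: "(v has_derivative frechet_derivative v (at q)) (at q)"
      and 2: "((\<lambda>x. \<Phi> x i) has_derivative ?D i) (at q)" for i
      using smooth_on_has_derivative sm(1) that U(2) by blast+
    show "((\<lambda>x. \<Sum>i\<in>Basis. (v x \<bullet> i) *\<^sub>R \<Phi> x i) has_derivative
       (\<lambda>h. \<Sum>i\<in>Basis. (v q \<bullet> i) *\<^sub>R ?D i h + (frechet_derivative v (at q) h \<bullet> i) *\<^sub>R \<Phi> q i)) (at q)"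
      by (rule has_derivative_eq_rhs, (rule derivative_intros 1 2)+) (simp add: fun_eq_iff)
  qed (rule linear_basis_expansion[OF lin, symmetric])
  have c: "?D (w q) h = (\<Sum>i\<in>Basis. (w q \<bullet> i) *\<^sub>R ?D i h)"
    using frechet_derivative_at[OF D[OF smooth_on_const[OF U(1), of "w q"]]] by (simp add: fun_eq_iff)
  show ?thesis
    unfolding frechet_derivative_at[OF D[OF sm(2)], symmetric] c
      linear_basis_expansion[OF lin[OF U(2)], of "frechet_derivative w (at q) h"]
    by (simp add: sum.distrib)
qed

lemma linear_frechet: "smooth_on U F \<Longrightarrow> q \<in> U \<Longrightarrow> linear (frechet_derivative F (at q))"
  using smooth_on_has_derivative has_derivative_linear by blast

lemma linear_family_frechet:
  assumes "open U" "q \<in> U" "\<And>x. x \<in> U \<Longrightarrow> linear (\<Phi> x)" "\<And>v. smooth_on U (\<lambda>x. \<Phi> x v)"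
  shows "linear (\<lambda>v. frechet_derivative (\<lambda>x. \<Phi> x v) (at q) h)"
proof
  have d: "((\<lambda>x. \<Phi> x v) has_derivative frechet_derivative (\<lambda>x. \<Phi> x v) (at q)) (at q)" for v
    using smooth_on_has_derivative assms by blast
  fix v w :: 'b and r :: real
  have "((\<lambda>x. \<Phi> x (v + w)) has_derivative (\<lambda>h. frechet_derivative (\<lambda>x. \<Phi> x v) (at q) h
      + frechet_derivative (\<lambda>x. \<Phi> x w) (at q) h)) (at q)"
    by (rule has_derivative_transform_within_open[OF has_derivative_add[OF d d] assms(1,2)])
      (simp add: assms(3) linear_add)
  then show "frechet_derivative (\<lambda>x. \<Phi> x (v + w)) (at q) h
      = frechet_derivative (\<lambda>x. \<Phi> x v) (at q) h + frechet_derivative (\<lambda>x. \<Phi> x w) (at q) h"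
    by (simp add: frechet_derivative_at[symmetric])
  have "((\<lambda>x. \<Phi> x (r *\<^sub>R v)) has_derivative (\<lambda>h. r *\<^sub>R frechet_derivative (\<lambda>x. \<Phi> x v) (at q) h)) (at q)"
    by (rule has_derivative_transform_within_open[OF has_derivative_scaleR_right[OF d] assms(1,2)])
      (simp add: assms(3) linear_scale)
  then show "frechet_derivative (\<lambda>x. \<Phi> x (r *\<^sub>R v)) (at q) h
      = r *\<^sub>R frechet_derivative (\<lambda>x. \<Phi> x v) (at q) h"
    by (simp add: frechet_derivative_at[symmetric])
qed

subsection \<open>Symmetry of second derivatives\<close>

lemma smooth_on_line_derivative:
  fixes f :: "'a::euclidean_space \<Rightarrow> real"
  assumes "smooth_on U f" "x + t *\<^sub>R v \<in> U"
  shows "((\<lambda>s. f (x + s *\<^sub>R v)) has_real_derivative frechet_derivative f (at (x + t *\<^sub>R v)) v) (at t)"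
proof -
  let ?D = "frechet_derivative f (at (x + t *\<^sub>R v))"
  have D: "(f has_derivative ?D) (at (x + t *\<^sub>R v))"
    by (rule smooth_on_has_derivative[OF assms])
  have l: "((\<lambda>s. x + s *\<^sub>R v) has_derivative (\<lambda>s. s *\<^sub>R v)) (at t)"
    by (auto intro!: derivative_eq_intros)
  have "((\<lambda>s. f (x + s *\<^sub>R v)) has_derivative (\<lambda>s. ?D (s *\<^sub>R v))) (at t)"
    using diff_chain_at[OF l D] by (simp add: o_def)
  then show ?thesis
    unfolding has_field_derivative_def
    by (rule has_derivative_eq_rhs) (simp add: fun_eq_iff linear_scale[OF has_derivative_linear[OF D]])
qed

text \<open>The mean value theorem is applied twice, along \<open>u\<close> to the increment of
  \<open>f\<close> by \<open>h *\<^sub>R v\<close> and then along \<open>v\<close> to the derivative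
  \<open>?D\<close>. The second difference is symmetric in \<open>u\<close> and \<open>v\<close>,
  which forces the mixed derivatives to agree in the limit.\<close>

lemma second_difference_mvt:
  fixes f :: "'a::euclidean_space \<Rightarrow> real"
  assumes f: "smooth_on U f" and sub: "ball q \<delta> \<subseteq> U" and h: "h > 0" "h * (norm u + norm v) < \<delta>"
  shows "\<exists>x\<in>ball q \<delta>. f (q + h *\<^sub>R u + h *\<^sub>R v) - f (q + h *\<^sub>R u) - f (q + h *\<^sub>R v) + f q
    = h * h * frechet_derivative (\<lambda>y. frechet_derivative f (at y) u) (at x) v"
proof -
  have inb: "q + s *\<^sub>R u + t *\<^sub>R v \<in> ball q \<delta>" if "0 \<le> s" "s \<le> h" "0 \<le> t" "t \<le> h" for s t
  proof -
    have "norm (s *\<^sub>R u + t *\<^sub>R v) \<le> s * norm u + t * norm v"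
      using norm_triangle_ineq[of "s *\<^sub>R u" "t *\<^sub>R v"] that by simp
    also have "\<dots> \<le> h * (norm u + norm v)"
      using that by (simp add: distrib_left add_mono mult_right_mono)
    finally show ?thesis using h(2) by (simp add: dist_norm norm_minus_commute algebra_simps)
  qed
  let ?D = "\<lambda>x. frechet_derivative f (at x) u"
  have 1: "((\<lambda>s. f (q + h *\<^sub>R v + s *\<^sub>R u) - f (q + s *\<^sub>R u)) has_real_derivative
      ?D (q + h *\<^sub>R v + s *\<^sub>R u) - ?D (q + s *\<^sub>R u)) (at s)" if "0 \<le> s" "s \<le> h" for s
  proof (intro DERIV_diff smooth_on_line_derivative[OF f])
    show "q + h *\<^sub>R v + s *\<^sub>R u \<in> U"
      using inb[OF that, of h] sub h by (auto simp: algebra_simps)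
    show "q + s *\<^sub>R u \<in> U" using inb[OF that, of 0] sub h by auto
  qed
  obtain \<xi> where \<xi>: "0 < \<xi>" "\<xi> < h" "(f (q + h *\<^sub>R v + h *\<^sub>R u) - f (q + h *\<^sub>R u))
      - (f (q + h *\<^sub>R v + 0 *\<^sub>R u) - f (q + 0 *\<^sub>R u))
    = (h - 0) * (?D (q + h *\<^sub>R v + \<xi> *\<^sub>R u) - ?D (q + \<xi> *\<^sub>R u))"
    using MVT2[OF h(1) 1] by blast
  have 2: "((\<lambda>t. ?D (q + \<xi> *\<^sub>R u + t *\<^sub>R v)) has_real_derivative
      frechet_derivative ?D (at (q + \<xi> *\<^sub>R u + t *\<^sub>R v)) v) (at t)" if "0 \<le> t" "t \<le> h" for t
    by (rule smooth_on_line_derivative[OF smooth_on_frechet[OF f]])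
      (use inb[of \<xi> t] \<xi> that sub in auto)
  obtain \<eta> where \<eta>: "0 < \<eta>" "\<eta> < h"
    "?D (q + \<xi> *\<^sub>R u + h *\<^sub>R v) - ?D (q + \<xi> *\<^sub>R u + 0 *\<^sub>R v)
    = (h - 0) * frechet_derivative ?D (at (q + \<xi> *\<^sub>R u + \<eta> *\<^sub>R v)) v"
    using MVT2[OF h(1) 2] by blast
  show ?thesis
  proof
    show "q + \<xi> *\<^sub>R u + \<eta> *\<^sub>R v \<in> ball q \<delta>" using inb \<xi> \<eta> by simp
    show "f (q + h *\<^sub>R u + h *\<^sub>R v) - f (q + h *\<^sub>R u) - f (q + h *\<^sub>R v) + f q
      = h * h * frechet_derivative ?D (at (q + \<xi> *\<^sub>R u + \<eta> *\<^sub>R v)) v"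
      using \<xi>(3) \<eta>(3) by (simp add: algebra_simps)
  qed
qed

lemma frechet_derivative_symmetric_real:
  fixes f :: "'a::euclidean_space \<Rightarrow> real"
  assumes U: "open U" "q \<in> U" and f: "smooth_on U f"
  shows "frechet_derivative (\<lambda>x. frechet_derivative f (at x) u) (at q) v
    = frechet_derivative (\<lambda>x. frechet_derivative f (at x) v) (at q) u" (is "?A u v q = ?A v u q")
proof (rule ccontr)
  assume ne: "?A u v q \<noteq> ?A v u q"
  define \<epsilon> where "\<epsilon> = \<bar>?A u v q - ?A v u q\<bar> / 2"
  have \<epsilon>: "\<epsilon> > 0" using ne by (simp add: \<epsilon>_def)
  have cont: "isCont (?A a b) q" for a b
    using smooth_on_imp_continuous_on[OF smooth_on_frechet[OF smooth_on_frechet[OF f]]] U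
    by (simp add: continuous_on_eq_continuous_at)
  obtain d1 where d1: "d1 > 0" "\<And>x. dist x q < d1 \<Longrightarrow> dist (?A u v x) (?A u v q) < \<epsilon>"
    using cont[of u v] \<epsilon> unfolding continuous_at_eps_delta by metis
  obtain d2 where d2: "d2 > 0" "\<And>x. dist x q < d2 \<Longrightarrow> dist (?A v u x) (?A v u q) < \<epsilon>"
    using cont[of v u] \<epsilon> unfolding continuous_at_eps_delta by metis
  obtain d3 where d3: "d3 > 0" "ball q d3 \<subseteq> U" using U open_contains_ball by metis
  define \<delta> where "\<delta> = min d1 (min d2 d3)"
  have \<delta>: "\<delta> > 0" "ball q \<delta> \<subseteq> U" using d1 d2 d3 by (auto simp: \<delta>_def)
  \<comment> \<open>The summand 1 keeps the denominator positive when \<open>u\<close> and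
    \<open>v\<close> both vanish.\<close>
  define h where "h = \<delta> / (2 * (norm u + norm v + 1))"
  have n: "norm u + norm v + 1 > 0" by (smt (verit) norm_ge_zero)
  have h: "h > 0" using \<delta> n by (simp add: h_def)
  have "h * (norm u + norm v) < h * (2 * (norm u + norm v + 1))"
    using h by (intro mult_strict_left_mono) (smt (verit) norm_ge_zero)+
  also have "\<dots> = \<delta>" using n by (simp add: h_def)
  finally have h2: "h * (norm u + norm v) < \<delta>" .
  obtain x where x: "x \<in> ball q \<delta>"
    "f (q + h *\<^sub>R u + h *\<^sub>R v) - f (q + h *\<^sub>R u) - f (q + h *\<^sub>R v) + f q = h * h * ?A u v x"
    using second_difference_mvt[OF f \<delta>(2) h h2] by blast
  have h2': "h * (norm v + norm u) < \<delta>" using h2 by (simp add: add.commute)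
  obtain y where y: "y \<in> ball q \<delta>"
    "f (q + h *\<^sub>R v + h *\<^sub>R u) - f (q + h *\<^sub>R v) - f (q + h *\<^sub>R u) + f q = h * h * ?A v u y"
    using second_difference_mvt[OF f \<delta>(2) h h2'] by blast
  have "h * h * ?A u v x = h * h * ?A v u y" using x(2) y(2) by (simp add: algebra_simps)
  then have "?A u v x = ?A v u y" using h by simp
  moreover have "dist (?A u v x) (?A u v q) < \<epsilon>" "dist (?A v u y) (?A v u q) < \<epsilon>"
    using d1(2)[of x] d2(2)[of y] x(1) y(1) by (simp_all add: \<delta>_def dist_commute)
  ultimately have "\<bar>?A u v q - ?A v u q\<bar> < 2 * \<epsilon>"
    unfolding dist_real_def by linarith
  then show False by (simp add: \<epsilon>_def)
qed

lemma frechet_derivative_linear_comp: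
  assumes "bounded_linear L" "f differentiable (at x)"
  shows "frechet_derivative (\<lambda>x. L (f x)) (at x) = (\<lambda>v. L (frechet_derivative f (at x) v))"
  using bounded_linear.has_derivative[OF assms(1) assms(2)[unfolded frechet_derivative_works]]
  by (rule frechet_derivative_at[symmetric])

lemma smooth_on_differentiable: "smooth_on U F \<Longrightarrow> x \<in> U \<Longrightarrow> F differentiable (at x)"
  using smooth_on_has_derivative by (blast intro: differentiableI)

lemma frechet_derivative_symmetric:
  fixes f :: "'a::euclidean_space \<Rightarrow> 'b::euclidean_space"
  assumes U: "open U" "q \<in> U" and f: "smooth_on U f"
  shows "frechet_derivative (\<lambda>x. frechet_derivative f (at x) u) (at q) v
    = frechet_derivative (\<lambda>x. frechet_derivative f (at x) v) (at q) u"
proof (rule euclidean_eqI)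
  fix b :: 'b assume "b \<in> Basis"
  have sb: "smooth_on U (\<lambda>x. f x \<bullet> b)"
    by (intro smooth_on_inner smooth_on_const U f)
  have fb: "frechet_derivative (\<lambda>x. f x \<bullet> b) (at x) w = frechet_derivative f (at x) w \<bullet> b"
    if "x \<in> U" for x w
    by (simp add: frechet_derivative_linear_comp[OF bounded_linear_inner_left
        smooth_on_differentiable[OF f that]])
  have "frechet_derivative (\<lambda>x. frechet_derivative f (at x) u) (at q) v \<bullet> b
      = frechet_derivative (\<lambda>x. frechet_derivative (\<lambda>x. f x \<bullet> b) (at x) u) (at q) v" for u v
  proof -
    have "frechet_derivative (\<lambda>x. frechet_derivative (\<lambda>x. f x \<bullet> b) (at x) u) (at q)
      = frechet_derivative (\<lambda>x. frechet_derivative f (at x) u \<bullet> b) (at q)"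
      by (rule frechet_derivative_transform_within_open
          [OF smooth_on_differentiable[OF smooth_on_frechet[OF sb] U(2)] U fb])
    then show ?thesis
      by (simp add: frechet_derivative_linear_comp[OF bounded_linear_inner_left
        smooth_on_differentiable[OF smooth_on_frechet[OF f] U(2)]])
  qed
  then show "frechet_derivative (\<lambda>x. frechet_derivative f (at x) u) (at q) v \<bullet> b
    = frechet_derivative (\<lambda>x. frechet_derivative f (at x) v) (at q) u \<bullet> b"
    using frechet_derivative_symmetric_real[OF U sb] by metis
qed

section \<open>Orthonormal bases and self-adjoint maps of subspaces\<close>

lemma oprojI:
  assumes "subspace V" "y \<in> V" "\<And>v. v \<in> V \<Longrightarrow> (x - y) \<bullet> v = 0"
  shows "oproj V x = y"
  unfolding oproj_def
proof (rule the_equality)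
  show "y \<in> V \<and> (\<forall>v\<in>V. (x - y) \<bullet> v = 0)" using assms by blast
  fix z assume z: "z \<in> V \<and> (\<forall>v\<in>V. (x - z) \<bullet> v = 0)"
  have d: "z - y \<in> V" using z assms by (simp add: subspace_diff)
  have "(z - y) \<bullet> (z - y) = (x - y) \<bullet> (z - y) - (x - z) \<bullet> (z - y)"
    by (simp add: inner_diff_left inner_diff_right)
  also have "\<dots> = 0" using assms(3) z d by simp
  finally show "z = y" by simp
qed

lemma oproj_id: "subspace V \<Longrightarrow> x \<in> V \<Longrightarrow> oproj V x = x"
  by (rule oprojI) auto

definition onb :: "'a::euclidean_space set \<Rightarrow> 'a set \<Rightarrow> bool" where
  "onb V B \<longleftrightarrow> pairwise orthogonal B \<and> (\<forall>b\<in>B. norm b = 1) \<and> span B = V"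

lemma onb_onb_of: assumes "subspace V" shows "onb V (onb_of V)"
proof -
  obtain B where "pairwise orthogonal B" "\<And>x. x \<in> B \<Longrightarrow> norm x = 1" "span B = V"
    using orthonormal_basis_subspace[OF assms] by metis
  then have "\<exists>B. pairwise orthogonal B \<and> (\<forall>b\<in>B. norm b = 1) \<and> span B = V" by blast
  then show ?thesis unfolding onb_of_def onb_def by (rule someI_ex)
qed

lemma onb_independent: assumes "onb V B" shows "independent B"
proof (rule pairwise_orthogonal_independent)
  show "0 \<notin> B" using assms unfolding onb_def by force
qed (use assms in \<open>auto simp: onb_def\<close>)

lemma onb_finite: "onb V B \<Longrightarrow> finite B"
  using onb_independent independent_imp_finite by blast

lemma onb_card: assumes "onb V B" shows "card B = dim V"
  using dim_span_eq_card_independent[OF onb_independent[OF assms]] assms unfolding onb_def by metis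

lemma onb_subset: "onb V B \<Longrightarrow> B \<subseteq> V"
  unfolding onb_def using span_superset by blast

lemma onb_inner: "onb V B \<Longrightarrow> a \<in> B \<Longrightarrow> b \<in> B \<Longrightarrow> a \<bullet> b = (if a = b then 1 else 0)"
  unfolding onb_def pairwise_def orthogonal_def by (auto simp: norm_eq_1)

lemma onb_expand:
  assumes B: "onb V B" and x: "x \<in> V"
  shows "(\<Sum>b\<in>B. (x \<bullet> b) *\<^sub>R b) = x"
proof -
  define y where "y = x - (\<Sum>b\<in>B. (x \<bullet> b) *\<^sub>R b)"
  have fin: "finite B" by (rule onb_finite[OF B])
  have span: "span B = V" using B by (simp add: onb_def)
  have "x \<in> span B" using x span by simp
  then have yV: "y \<in> span B"
    unfolding y_def by (intro span_diff span_sum span_mul) (auto intro: span_base)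
  have "orthogonal y b" if "b \<in> B" for b
  proof -
    have "(\<Sum>c\<in>B. (x \<bullet> c) *\<^sub>R c) \<bullet> b = (\<Sum>c\<in>B. if c = b then x \<bullet> c else 0)"
      unfolding inner_sum_left using that by (intro sum.cong refl) (simp add: onb_inner[OF B])
    also have "\<dots> = x \<bullet> b" using that fin by simp
    finally show ?thesis by (simp add: y_def orthogonal_def inner_diff_left)
  qed
  then have "orthogonal y y" using yV by (meson orthogonal_to_span)
  then show ?thesis by (simp add: y_def orthogonal_def)
qed

lemma onb_parseval:
  assumes B: "onb V B" and x: "x \<in> V"
  shows "(\<Sum>b\<in>B. (x \<bullet> b) * (y \<bullet> b)) = x \<bullet> y"
proof -
  have "(\<Sum>b\<in>B. (x \<bullet> b) *\<^sub>R b) \<bullet> y = (\<Sum>b\<in>B. (x \<bullet> b) * (y \<bullet> b))"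
    by (simp only: inner_sum_left inner_scaleR_left) (simp add: inner_commute)
  then show ?thesis by (simp add: onb_expand[OF assms])
qed

text \<open>Sums over the arbitrarily chosen \<open>onb_of\<close> can be moved by this to a basis
  of principal vectors.\<close>

lemma onb_trace:
  assumes B: "onb V B" and C: "onb V C" and L: "linear L"
  shows "(\<Sum>b\<in>B. L b \<bullet> b) = (\<Sum>c\<in>C. L c \<bullet> c)"
proof -
  have "L b = (\<Sum>c\<in>C. (b \<bullet> c) *\<^sub>R L c)" if "b \<in> B" for b
  proof -
    have "L b = L (\<Sum>c\<in>C. (b \<bullet> c) *\<^sub>R c)"
      using that onb_subset[OF B] by (subst onb_expand[OF C]) auto
    then show ?thesis by (simp add: linear_sum[OF L] linear_scale[OF L])
  qed
  then have "(\<Sum>b\<in>B. L b \<bullet> b) = (\<Sum>b\<in>B. \<Sum>c\<in>C. (b \<bullet> c) * (L c \<bullet> b))"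
    by (simp add: inner_sum_left)
  also have "\<dots> = (\<Sum>c\<in>C. \<Sum>b\<in>B. (c \<bullet> b) * (L c \<bullet> b))"
    by (subst sum.swap) (simp add: inner_commute)
  also have "\<dots> = (\<Sum>c\<in>C. L c \<bullet> c)"
    using onb_subset[OF C] by (intro sum.cong refl) (subst onb_parseval[OF B], auto simp: inner_commute)
  finally show ?thesis .
qed

text \<open>Delta sums over the complement of \<open>\<nu>\<close>; completing the basis turns this
  into a sum over the whole tangent space minus one term.\<close>

lemma onb_insert:
  assumes W: "onb {u \<in> V. u \<bullet> \<nu> = 0} B" and V: "subspace V" "\<nu> \<in> V" "norm \<nu> = 1"
  shows "onb V (insert \<nu> B)" "\<nu> \<notin> B"
proof -
  have BW: "u \<in> V" "u \<bullet> \<nu> = 0" if "u \<in> B" for u using onb_subset[OF W] that by auto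
  show "\<nu> \<notin> B" using BW(2) V(3) by (auto simp: norm_eq_1)
  have "V \<subseteq> span (insert \<nu> B)"
  proof
    fix x assume x: "x \<in> V"
    have "x - (x \<bullet> \<nu>) *\<^sub>R \<nu> \<in> {u \<in> V. u \<bullet> \<nu> = 0}"
      using V x by (auto simp: subspace_diff subspace_scale inner_diff_left norm_eq_1)
    then show "x \<in> span (insert \<nu> B)"
      using W unfolding onb_def span_insert by auto
  qed
  moreover have "span (insert \<nu> B) \<subseteq> V" using BW V by (intro span_minimal) auto
  ultimately show "onb V (insert \<nu> B)"
    using W V(3) BW unfolding onb_def
    by (auto simp: pairwise_insert orthogonal_def inner_commute)
qed

section \<open>Eigenvectors from maximising a quadratic form\<close>

lemma quadratic_nonpos_imp_linear_zero:
  fixes a b :: real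
  assumes "\<And>t. 2 * t * a + t\<^sup>2 * b \<le> 0" "a \<ge> 0"
  shows "a = 0"
proof (rule ccontr)
  assume "a \<noteq> 0"
  with assms(2) have a: "a > 0" by simp
  \<comment> \<open>Small enough for the linear term to dominate:
    \<open>t * \<bar>b\<bar> < a\<close>.\<close>
  define t where "t = a / (\<bar>b\<bar> + 1)"
  have t: "t > 0" using a by (simp add: t_def)
  have "t * \<bar>b\<bar> < a"
    using a by (simp add: t_def divide_simps)
  moreover have "- (t * b) \<le> t * \<bar>b\<bar>"
    using mult_left_mono[of "- b" "\<bar>b\<bar>" t] t by simp
  ultimately have "2 * a + t * b > 0" using a by linarith
  then have "t * (2 * a + t * b) > 0" using t by simp
  then show False using assms(1)[of t] by (simp add: algebra_simps power2_eq_square)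
qed

text \<open>A maximiser \<open>v\<close> of \<open>L x \<bullet> x\<close> on the unit sphere of
  \<open>T\<close> is a critical point: \<open>w\<close> is half of the gradient along the sphere,
  and moving from \<open>v\<close> along \<open>w\<close> would increase the quotient unless
  \<open>w = 0\<close>.\<close>

lemma self_adjoint_has_eigenvector:
  fixes T :: "'a::euclidean_space set"
  assumes T: "subspace T" "T \<noteq> {0}" and L: "linear L" "L ` T \<subseteq> T"
    and sym: "\<And>x y. x \<in> T \<Longrightarrow> y \<in> T \<Longrightarrow> L x \<bullet> y = x \<bullet> L y"
  shows "\<exists>v\<in>T. \<exists>\<kappa>. v \<noteq> 0 \<and> L v = \<kappa> *\<^sub>R v"
proof -
  obtain x0 where x0: "x0 \<in> T" "x0 \<noteq> 0" using T subspace_0 by blast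
  let ?S = "sphere 0 1 \<inter> T"
  have "compact ?S" by (simp add: closed_subspace[OF T(1)] compact_Int_closed)
  moreover have "x0 /\<^sub>R norm x0 \<in> ?S" using x0 T by (simp add: subspace_scale)
  moreover have "continuous_on ?S (\<lambda>x. L x \<bullet> x)"
    by (intro continuous_intros linear_continuous_on linear_linear[THEN iffD2] L(1))
  ultimately obtain v where v: "v \<in> ?S" "\<And>x. x \<in> ?S \<Longrightarrow> L x \<bullet> x \<le> L v \<bullet> v"
    using continuous_attains_sup[of ?S "\<lambda>x. L x \<bullet> x"] by blast
  define \<kappa> where "\<kappa> = L v \<bullet> v"
  have le: "L x \<bullet> x \<le> \<kappa> * (x \<bullet> x)" if "x \<in> T" for x
  proof (cases "x = 0")
    case True
    then show ?thesis by simp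
  next
    case False
    have "L (x /\<^sub>R norm x) \<bullet> (x /\<^sub>R norm x) \<le> \<kappa>"
      unfolding \<kappa>_def using False that T by (intro v) (simp add: subspace_scale)
    then have "L x \<bullet> x / (norm x * norm x) \<le> \<kappa>"
      by (simp add: linear_scale[OF L(1)] divide_inverse mult.commute mult.left_commute)
    then show ?thesis
      using False by (simp add: pos_divide_le_eq power2_norm_eq_inner[symmetric] power2_eq_square)
  qed
  have vT: "v \<in> T" "v \<bullet> v = 1" using v(1) by (auto simp: norm_eq_1)
  define w where "w = L v - \<kappa> *\<^sub>R v"
  have wT: "w \<in> T" unfolding w_def using vT L(2) T(1) by (auto simp: subspace_diff subspace_scale)
  have "w \<bullet> w = 0"
  proof (rule quadratic_nonpos_imp_linear_zero)
    fix t :: real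
    have "v + t *\<^sub>R w \<in> T" using vT wT T by (simp add: subspace_add subspace_scale)
    moreover have "L w \<bullet> v = L v \<bullet> w" using sym[OF wT vT(1)] by (simp add: inner_commute)
    ultimately have 1: "2 * t * (L v \<bullet> w) + t\<^sup>2 * (L w \<bullet> w) \<le> 2 * t * \<kappa> * (v \<bullet> w) + t\<^sup>2 * \<kappa> * (w \<bullet> w)"
      using le[of "v + t *\<^sub>R w"]
      by (simp add: linear_add[OF L(1)] linear_scale[OF L(1)] inner_add_left inner_add_right
          inner_commute[of w v] vT(2) \<kappa>_def[symmetric] algebra_simps power2_eq_square)
    have w: "w \<bullet> w = L v \<bullet> w - \<kappa> * (v \<bullet> w)"
      by (subst (1) w_def) (simp add: inner_diff_left)
    have "2 * t * (w \<bullet> w) = 2 * t * (L v \<bullet> w) - 2 * t * \<kappa> * (v \<bullet> w)"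
      by (subst w) (simp add: algebra_simps)
    with 1 show "2 * t * (w \<bullet> w) + t\<^sup>2 * (L w \<bullet> w - \<kappa> * (w \<bullet> w)) \<le> 0"
      by (simp add: algebra_simps)
  qed simp
  then have "L v = \<kappa> *\<^sub>R v" by (simp add: w_def)
  moreover have "v \<noteq> 0" using vT(2) by auto
  ultimately show ?thesis using vT(1) by blast
qed

text \<open>The orthogonal complement of all eigenvectors is invariant under \<open>L\<close>; if it
  were nonzero it would contain an eigenvector, which would be orthogonal to itself.\<close>

lemma self_adjoint_span_eigenvectors:
  fixes T :: "'a::euclidean_space set"
  assumes T: "subspace T" and L: "linear L" "L ` T \<subseteq> T"
    and sym: "\<And>x y. x \<in> T \<Longrightarrow> y \<in> T \<Longrightarrow> L x \<bullet> y = x \<bullet> L y"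
    and K: "\<And>\<kappa> v. v \<in> T \<Longrightarrow> v \<noteq> 0 \<Longrightarrow> L v = \<kappa> *\<^sub>R v \<Longrightarrow> \<kappa> \<in> K"
  shows "span (\<Union>\<kappa>\<in>K. {v \<in> T. L v = \<kappa> *\<^sub>R v}) = T"
proof
  let ?S = "\<Union>\<kappa>\<in>K. {v \<in> T. L v = \<kappa> *\<^sub>R v}"
  show sub: "span ?S \<subseteq> T" by (rule span_minimal[OF _ T]) auto
  define W where "W = {x \<in> T. \<forall>v\<in>?S. x \<bullet> v = 0}"
  have W: "subspace W"
    using T unfolding W_def subspace_def by (auto simp: inner_add_left)
  have "W = {0}"
  proof (rule ccontr)
    assume "W \<noteq> {0}"
    have LW: "L ` W \<subseteq> W"
    proof
      fix y assume "y \<in> L ` W"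
      then obtain x where x: "x \<in> W" "y = L x" by blast
      have "L x \<bullet> v = 0" if "v \<in> T" "\<kappa> \<in> K" "L v = \<kappa> *\<^sub>R v" for v \<kappa>
        using sym[of x v] x that unfolding W_def by auto
      then show "y \<in> W" using x L(2) by (auto simp: W_def)
    qed
    have symW: "L x \<bullet> y = x \<bullet> L y" if "x \<in> W" "y \<in> W" for x y
      using that sym[of x y] by (simp add: W_def)
    obtain v \<kappa> where v: "v \<in> W" "v \<noteq> 0" "L v = \<kappa> *\<^sub>R v"
      using self_adjoint_has_eigenvector[OF W \<open>W \<noteq> {0}\<close> L(1) LW symW] by blast
    then have "v \<in> T" by (simp add: W_def)
    then have "v \<in> ?S" using K[of v \<kappa>] v by blast
    then have "v \<bullet> v = 0" using v(1) unfolding W_def by blast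
    then show False using v by simp
  qed
  show "T \<subseteq> span ?S"
  proof
    fix x assume x: "x \<in> T"
    obtain y z where yz: "y \<in> span ?S" "\<And>w. w \<in> span ?S \<Longrightarrow> orthogonal z w" "x = y + z"
      using orthogonal_subspace_decomp_exists[of ?S x] by blast
    have "z = x - y" using yz by simp
    then have "z \<in> T" using yz(1) sub x T by (auto simp: subspace_diff)
    moreover have "z \<bullet> v = 0" if "v \<in> ?S" for v
      using yz(2)[OF span_base[OF that]] by (simp add: orthogonal_def)
    ultimately have "z \<in> W" unfolding W_def by blast
    then show "x \<in> span ?S" using yz \<open>W = {0}\<close> by simp
  qed
qed

lemma subspace_eigenspace: "subspace T \<Longrightarrow> linear L \<Longrightarrow> subspace {v \<in> T. L v = \<kappa> *\<^sub>R v}"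
  by (auto simp: subspace_def linear_0 linear_add linear_scale scaleR_add_right)

lemma self_adjoint_onb:
  fixes T :: "'a::euclidean_space set"
  assumes T: "subspace T" and L: "linear L" "L ` T \<subseteq> T"
    and sym: "\<And>x y. x \<in> T \<Longrightarrow> y \<in> T \<Longrightarrow> L x \<bullet> y = x \<bullet> L y"
    and K: "\<And>\<kappa> v. v \<in> T \<Longrightarrow> v \<noteq> 0 \<Longrightarrow> L v = \<kappa> *\<^sub>R v \<Longrightarrow> \<kappa> \<in> K"
  obtains B where "onb T B" "\<And>b. b \<in> B \<Longrightarrow> \<exists>\<kappa>\<in>K. L b = \<kappa> *\<^sub>R b"
    "\<And>\<kappa>. \<kappa> \<in> K \<Longrightarrow> card {b \<in> B. L b = \<kappa> *\<^sub>R b} = dim {v \<in> T. L v = \<kappa> *\<^sub>R v}"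
proof -
  define D where "D \<kappa> = {v \<in> T. L v = \<kappa> *\<^sub>R v}" for \<kappa>
  define B where "B = (\<Union>\<kappa>\<in>K. onb_of (D \<kappa>))"
  have D: "onb (D \<kappa>) (onb_of (D \<kappa>))" for \<kappa>
    unfolding D_def by (intro onb_onb_of subspace_eigenspace T L)
  have BD: "b \<in> D \<kappa>" "norm b = 1" if "b \<in> onb_of (D \<kappa>)" for b \<kappa>
    using that D onb_subset unfolding onb_def by blast+
  have orth: "x \<bullet> y = 0" if "x \<in> D \<kappa>" "y \<in> D \<mu>" "\<kappa> \<noteq> \<mu>" for x y \<kappa> \<mu>
    using that sym[of x y] unfolding D_def by auto
  have "onb T B"
    unfolding onb_def
  proof (intro conjI)
    show "pairwise orthogonal B"
      unfolding pairwise_def orthogonal_def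
    proof (intro ballI impI)
      fix x y assume "x \<in> B" "y \<in> B" and ne: "x \<noteq> y"
      then obtain \<kappa> \<mu> where "x \<in> onb_of (D \<kappa>)" "y \<in> onb_of (D \<mu>)" unfolding B_def by blast
      then show "x \<bullet> y = 0"
        using ne BD orth onb_inner[OF D] by (cases "\<kappa> = \<mu>") metis+
    qed
    show "\<forall>b\<in>B. norm b = 1" unfolding B_def using BD(2) by blast
    have "span B = span (\<Union>\<kappa>\<in>K. D \<kappa>)"
    proof
      show "span B \<subseteq> span (\<Union>\<kappa>\<in>K. D \<kappa>)" unfolding B_def using BD(1) by (intro span_mono) blast
      have "D \<kappa> \<subseteq> span B" if "\<kappa> \<in> K" for \<kappa>
      proof -
        have "span (onb_of (D \<kappa>)) \<subseteq> span B" using that by (intro span_mono) (auto simp: B_def)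
        then show ?thesis using D[of \<kappa>] by (simp add: onb_def)
      qed
      then show "span (\<Union>\<kappa>\<in>K. D \<kappa>) \<subseteq> span B" by (intro span_minimal) auto
    qed
    then show "span B = T"
      using self_adjoint_span_eigenvectors[OF assms] by (simp add: D_def)
  qed
  moreover have "\<exists>\<kappa>\<in>K. L b = \<kappa> *\<^sub>R b" if "b \<in> B" for b
  proof -
    have "\<exists>\<mu>\<in>K. b \<in> onb_of (D \<mu>)" using that unfolding B_def by blast
    then obtain \<mu> where \<mu>: "\<mu> \<in> K" "b \<in> onb_of (D \<mu>)" by blast
    then show ?thesis using BD(1)[of b \<mu>] by (auto simp: D_def)
  qed
  moreover have "card {b \<in> B. L b = \<kappa> *\<^sub>R b} = dim {v \<in> T. L v = \<kappa> *\<^sub>R v}" if "\<kappa> \<in> K" for \<kappa>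
  proof -
    have "{b \<in> B. L b = \<kappa> *\<^sub>R b} = onb_of (D \<kappa>)"
    proof
      show "{b \<in> B. L b = \<kappa> *\<^sub>R b} \<subseteq> onb_of (D \<kappa>)"
      proof
        fix b assume b: "b \<in> {b \<in> B. L b = \<kappa> *\<^sub>R b}"
        then obtain \<mu> where \<mu>: "b \<in> onb_of (D \<mu>)" by (auto simp: B_def)
        then have "\<mu> *\<^sub>R b = \<kappa> *\<^sub>R b" "b \<noteq> 0" using b BD[OF \<mu>] by (auto simp: D_def)
        then show "b \<in> onb_of (D \<kappa>)" using \<mu> by simp
      qed
      show "onb_of (D \<kappa>) \<subseteq> {b \<in> B. L b = \<kappa> *\<^sub>R b}"
      proof
        fix b assume b: "b \<in> onb_of (D \<kappa>)"
        then have "b \<in> B" using that by (auto simp: B_def)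
        then show "b \<in> {b \<in> B. L b = \<kappa> *\<^sub>R b}" using BD(1)[OF b] by (simp add: D_def)
      qed
    qed
    then show ?thesis using onb_card[OF D] by (simp add: D_def)
  qed
  ultimately show thesis using that by blast
qed

section \<open>Tangential calculus near a point of a hypersurface of the sphere\<close>

text \<open>Composition with a curve in \<open>N\<close> of velocity \<open>v\<close> gives a
  function of one real variable, whose derivative is unique.\<close>

lemma has_derivative_within_unique_tangent:
  assumes D: "(Y has_derivative D) (at q within N)" "(Y has_derivative D') (at q within N)"
    and v: "v \<in> tangent_space N q"
  shows "D v = D' v"
proof -
  obtain \<gamma> where \<gamma>: "\<And>t::real. \<gamma> t \<in> N" "\<gamma> 0 = q" "(\<gamma> has_vector_derivative v) (at 0)"
    using v unfolding tangent_space_def by blast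
  have d\<gamma>: "(\<gamma> has_derivative (\<lambda>t. t *\<^sub>R v)) (at 0)"
    using \<gamma>(3) by (simp add: has_vector_derivative_def)
  have "(Y \<circ> \<gamma> has_derivative E \<circ> (\<lambda>t. t *\<^sub>R v)) (at 0)"
    if "(Y has_derivative E) (at q within N)" for E
  proof (rule diff_chain_within[OF d\<gamma>])
    show "(Y has_derivative E) (at (\<gamma> 0) within range \<gamma>)"
      unfolding \<gamma>(2) by (rule has_derivative_subset[OF that]) (use \<gamma>(1) in auto)
  qed
  from has_derivative_unique[OF this[OF D(1)] this[OF D(2)]]
  have "(D \<circ> (\<lambda>t. t *\<^sub>R v)) 1 = (D' \<circ> (\<lambda>t. t *\<^sub>R v)) 1" by (rule fun_cong)
  then show ?thesis by simp
qed

lemma tderiv_eq: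
  assumes U: "open U" "smooth_on U F" and q: "q \<in> N" "q \<in> U"
    and eq: "\<And>x. x \<in> N \<Longrightarrow> x \<in> U \<Longrightarrow> F x = Y x" and v: "v \<in> tangent_space N q"
  shows "tderiv N Y q v = frechet_derivative F (at q) v"
proof -
  obtain d where d: "d > 0" "ball q d \<subseteq> U" using U q open_contains_ball by metis
  have D: "(Y has_derivative frechet_derivative F (at q)) (at q within N)"
  proof (rule has_derivative_transform_within[OF _ d(1) q(1)])
    show "(F has_derivative frechet_derivative F (at q)) (at q within N)"
      by (rule has_derivative_at_withinI[OF smooth_on_has_derivative[OF U(2) q(2)]])
    show "F x = Y x" if "x \<in> N" "dist x q < d" for x
      using that d eq by (auto simp: dist_commute)
  qed
  then have "(Y has_derivative frechet_derivative Y (at q within N)) (at q within N)"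
    using frechet_derivative_works differentiableI by blast
  then show ?thesis
    unfolding tderiv_def by (rule has_derivative_within_unique_tangent[OF _ D v])
qed

lemma frechet_derivative_eq_tangent:
  assumes "open U" "smooth_on U F" "smooth_on U H" "q \<in> N" "q \<in> U"
    "\<And>x. x \<in> N \<Longrightarrow> x \<in> U \<Longrightarrow> F x = H x" "v \<in> tangent_space N q"
  shows "frechet_derivative F (at q) v = frechet_derivative H (at q) v"
  using tderiv_eq[of U F q N H v] tderiv_eq[of U H q N H v] assms by metis

text \<open>The fields \<open>\<nu>\<close> and \<open>G\<close> live on an open set, so that
  ordinary derivatives exist, while the geometric conditions hold only on \<open>N\<close>. The
  defining function \<open>G\<close> with nonzero normal derivative is what yields the symmetry of
  the shape operator.\<close>

locale hypersurface_germ =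
  fixes N U :: "'a::euclidean_space set" and \<nu> :: "'a \<Rightarrow> 'a" and G :: "'a \<Rightarrow> real"
  assumes openU: "open U" and smooth_\<nu>: "smooth_on U \<nu>" and smooth_G: "smooth_on U G"
    and unit: "\<And>q. q \<in> N \<Longrightarrow> q \<in> U \<Longrightarrow> q \<bullet> q = 1" "\<And>q. q \<in> N \<Longrightarrow> q \<in> U \<Longrightarrow> \<nu> q \<bullet> \<nu> q = 1"
      "\<And>q. q \<in> N \<Longrightarrow> q \<in> U \<Longrightarrow> \<nu> q \<bullet> q = 0"
    and tangent: "\<And>q. q \<in> N \<Longrightarrow> q \<in> U \<Longrightarrow> tangent_space N q = {v. v \<bullet> q = 0 \<and> v \<bullet> \<nu> q = 0}"
    and G_zero: "\<And>q. q \<in> N \<Longrightarrow> q \<in> U \<Longrightarrow> G q = 0"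
    and G_normal: "\<And>q. q \<in> N \<Longrightarrow> q \<in> U \<Longrightarrow> frechet_derivative G (at q) (\<nu> q) \<noteq> 0"
begin

text \<open>On \<open>N\<close> this is the orthogonal projection to the tangent space; elsewhere it
  is only a smooth extension without the projection property.\<close>

definition P :: "'a \<Rightarrow> 'a \<Rightarrow> 'a" where
  "P x a = a - (a \<bullet> x) *\<^sub>R x - (a \<bullet> \<nu> x) *\<^sub>R \<nu> x"

text \<open>Directions are constant ambient vectors, projected at each point, so tensors become
  functions of constants. The price is that the fields \<open>P x a\<close> and \<open>P x b\<close>
  need not commute.\<close>

definition tdiff :: "('a \<Rightarrow> 'b::euclidean_space) \<Rightarrow> 'a \<Rightarrow> 'a \<Rightarrow> 'b" where
  "tdiff F a q = frechet_derivative F (at q) (P q a)"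

definition A :: "'a \<Rightarrow> 'a \<Rightarrow> 'a" where
  "A q a = - tdiff \<nu> a q"

text \<open>An ambient derivative, not a covariant one: for tangent arguments its tangential part is
  the covariant derivative of the shape operator, but it may have a normal part as well.\<close>

definition dA :: "'a \<Rightarrow> 'a \<Rightarrow> 'a \<Rightarrow> 'a" where
  "dA a q b = tdiff (\<lambda>x. A x b) a q"

abbreviation "T \<equiv> tangent_space N"

lemma smooth_intros_U:
  "smooth_on U (\<lambda>x. c)" "smooth_on U (\<lambda>x. x)"
  "smooth_on U F \<Longrightarrow> smooth_on U F' \<Longrightarrow> smooth_on U (\<lambda>x. F x + F' x)"
  "smooth_on U F \<Longrightarrow> smooth_on U F' \<Longrightarrow> smooth_on U (\<lambda>x. F x - F' x)"
  "smooth_on U F \<Longrightarrow> smooth_on U (\<lambda>x. - F x)"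
  "smooth_on U H \<Longrightarrow> smooth_on U H' \<Longrightarrow> smooth_on U (\<lambda>x. H x \<bullet> H' x)"
  "smooth_on U r \<Longrightarrow> smooth_on U F \<Longrightarrow> smooth_on U (\<lambda>x. r x *\<^sub>R F x)"
  by (auto intro: smooth_intros openU)

lemma linear_P: "linear (P x)"
  by (rule linearI) (simp_all add: P_def inner_add_left algebra_simps)

lemma smooth_P: "smooth_on U (\<lambda>x. P x a)"
  unfolding P_def by (intro smooth_intros_U smooth_\<nu>)

lemma smooth_tdiff: assumes "smooth_on U F" shows "smooth_on U (tdiff F a)"
  unfolding tdiff_def
  by (rule smooth_on_apply[OF openU linear_frechet[OF assms] smooth_on_frechet[OF assms] smooth_P])

lemma smooth_A: "smooth_on U (\<lambda>x. A x a)"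
  unfolding A_def by (intro smooth_intros_U smooth_tdiff smooth_\<nu>)

lemma smooth_dA: "smooth_on U (\<lambda>x. dA a x b)"
  unfolding dA_def by (intro smooth_tdiff smooth_A)

lemma linear_tdiff: assumes "smooth_on U F" "q \<in> U" shows "linear (\<lambda>a. tdiff F a q)"
  using linear_compose[OF linear_P[of q] linear_frechet[OF assms]]
  by (simp add: tdiff_def[abs_def] o_def)

lemma linear_A: "q \<in> U \<Longrightarrow> linear (A q)"
  unfolding A_def[abs_def] by (intro linear_compose_neg linear_tdiff smooth_\<nu>)

lemma linear_dA: "q \<in> U \<Longrightarrow> linear (dA a q)"
  unfolding dA_def[abs_def] tdiff_def
  by (rule linear_family_frechet[OF openU _ linear_A smooth_A])

text \<open>The direction \<open>P q a\<close> is tangent to \<open>N\<close>, so identities that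
  hold only on \<open>N\<close> may be differentiated by \<open>tdiff\<close>.\<close>

lemma tdiff_cong:
  assumes "smooth_on U F" "smooth_on U H" "q \<in> N" "q \<in> U"
    "\<And>x. x \<in> N \<Longrightarrow> x \<in> U \<Longrightarrow> F x = H x"
  shows "tdiff F a q = tdiff H a q"
  unfolding tdiff_def
proof (rule frechet_derivative_eq_tangent[OF openU assms])
  show "P q a \<in> T q"
    using unit[of q] assms(3,4)
    by (simp add: tangent P_def inner_diff_left inner_commute[of q "\<nu> q"])
qed

lemma tdiff_eqI:
  "q \<in> U \<Longrightarrow> (F has_derivative D) (at q) \<Longrightarrow> tdiff F a q = D (P q a)"
  unfolding tdiff_def by (metis frechet_derivative_at)

lemma tdiff_works: "smooth_on U F \<Longrightarrow> q \<in> U \<Longrightarrow> (F has_derivative frechet_derivative F (at q)) (at q)"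
  by (rule smooth_on_has_derivative)

lemma tdiff_const: "tdiff (\<lambda>x. c) a q = 0"
  by (simp add: tdiff_def)

lemma tdiff_id: "tdiff (\<lambda>x. x) a q = P q a"
  by (simp add: tdiff_def)

lemma tdiff_minus:
  "smooth_on U F \<Longrightarrow> q \<in> U \<Longrightarrow> tdiff (\<lambda>x. - F x) a q = - tdiff F a q"
  by (rule trans[OF tdiff_eqI[OF _ has_derivative_minus[OF tdiff_works]]]) (auto simp: tdiff_def)

lemma tdiff_add:
  "smooth_on U F \<Longrightarrow> smooth_on U H \<Longrightarrow> q \<in> U \<Longrightarrow>
    tdiff (\<lambda>x. F x + H x) a q = tdiff F a q + tdiff H a q"
  by (rule trans[OF tdiff_eqI[OF _ has_derivative_add[OF tdiff_works tdiff_works]]])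
    (auto simp: tdiff_def)

lemma tdiff_diff:
  "smooth_on U F \<Longrightarrow> smooth_on U H \<Longrightarrow> q \<in> U \<Longrightarrow>
    tdiff (\<lambda>x. F x - H x) a q = tdiff F a q - tdiff H a q"
  by (rule trans[OF tdiff_eqI[OF _ has_derivative_diff[OF tdiff_works tdiff_works]]])
    (auto simp: tdiff_def)

lemma tdiff_inner:
  "smooth_on U F \<Longrightarrow> smooth_on U H \<Longrightarrow> q \<in> U \<Longrightarrow>
    tdiff (\<lambda>x. F x \<bullet> H x) a q = F q \<bullet> tdiff H a q + tdiff F a q \<bullet> H q"
  by (rule trans[OF tdiff_eqI[OF _ has_derivative_inner[OF tdiff_works tdiff_works]]])
    (auto simp: tdiff_def)

lemma tdiff_scaleR:
  "smooth_on U F \<Longrightarrow> smooth_on U H \<Longrightarrow> q \<in> U \<Longrightarrow>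
    tdiff (\<lambda>x. F x *\<^sub>R H x) a q = F q *\<^sub>R tdiff H a q + tdiff F a q *\<^sub>R H q"
  by (rule trans[OF tdiff_eqI[OF _ has_derivative_scaleR[OF tdiff_works tdiff_works]]])
    (auto simp: tdiff_def)

lemma tdiff_apply:
  assumes "q \<in> U" "\<And>x. x \<in> U \<Longrightarrow> linear (\<Phi> x)" "\<And>v. smooth_on U (\<lambda>x. \<Phi> x v)" "smooth_on U w"
  shows "tdiff (\<lambda>x. \<Phi> x (w x)) a q = tdiff (\<lambda>x. \<Phi> x (w q)) a q + \<Phi> q (tdiff w a q)"
  unfolding tdiff_def by (rule frechet_apply[OF openU assms])

text \<open>Second derivatives in fixed directions commute; what remains is the derivative of
  \<open>F\<close> along the Lie bracket of the two projected fields.\<close>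

lemma tdiff_commute:
  assumes F: "smooth_on U F" and q: "q \<in> U"
  shows "tdiff (tdiff F b) a q - tdiff (tdiff F a) b q
    = frechet_derivative F (at q) (tdiff (\<lambda>x. P x b) a q - tdiff (\<lambda>x. P x a) b q)"
proof -
  let ?D = "frechet_derivative F (at q)"
  have "tdiff (tdiff F b) a q = frechet_derivative (\<lambda>x. frechet_derivative F (at x) (P q b)) (at q) (P q a)
      + ?D (tdiff (\<lambda>x. P x b) a q)" for a b
    unfolding tdiff_def[of "tdiff F b"] unfolding tdiff_def
    by (rule frechet_apply[OF openU q linear_frechet[OF F] smooth_on_frechet[OF F] smooth_P])
  then show ?thesis
    using frechet_derivative_symmetric[OF openU q F, of "P q a" "P q b"]
    by (simp add: linear_diff[OF linear_frechet[OF F q]])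
qed

lemma tdiff_P:
  assumes q: "q \<in> U"
  shows "tdiff (\<lambda>x. P x b) a q
    = (b \<bullet> A q a) *\<^sub>R \<nu> q + (b \<bullet> \<nu> q) *\<^sub>R A q a - (b \<bullet> P q a) *\<^sub>R q - (b \<bullet> q) *\<^sub>R P q a"
  unfolding P_def[of _ b]
  by (simp add: tdiff_diff tdiff_scaleR tdiff_inner tdiff_const tdiff_id smooth_intros_U smooth_\<nu> q
      A_def)

context
  fixes q assumes q: "q \<in> N" "q \<in> U"
begin

lemma P_orth: "P q a \<bullet> q = 0" "P q a \<bullet> \<nu> q = 0"
  using unit[OF q] by (simp_all add: P_def inner_diff_left inner_commute[of q "\<nu> q"])

lemma P_tangent: "P q a \<in> T q"
  by (simp add: tangent[OF q] P_orth)

lemma P_id: "a \<in> T q \<Longrightarrow> P q a = a"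
  by (simp add: tangent[OF q] P_def)

lemma subspace_T: "subspace (T q)"
  by (auto simp: tangent[OF q] subspace_def inner_add_left)

lemma A_orth: "A q a \<bullet> q = 0" "A q a \<bullet> \<nu> q = 0"
proof -
  have "tdiff (\<lambda>x. \<nu> x \<bullet> x) a q = tdiff (\<lambda>x. 0::real) a q"
    by (rule tdiff_cong) (auto intro!: smooth_intros_U smooth_\<nu> q unit)
  then show "A q a \<bullet> q = 0"
    by (simp add: tdiff_inner smooth_intros_U smooth_\<nu> q tdiff_const tdiff_id A_def
        inner_commute[of "\<nu> q" "P q a"] P_orth)
  have "tdiff (\<lambda>x. \<nu> x \<bullet> \<nu> x) a q = tdiff (\<lambda>x. 1::real) a q"
    by (rule tdiff_cong) (auto intro!: smooth_intros_U smooth_\<nu> q unit)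
  then show "A q a \<bullet> \<nu> q = 0"
    by (simp add: tdiff_inner smooth_intros_U smooth_\<nu> q tdiff_const A_def
        inner_commute[of "\<nu> q" "tdiff \<nu> a q"])
qed

lemma A_tangent: "A q a \<in> T q"
  by (simp add: tangent[OF q] A_orth)

lemma A_P: "A q (P q a) = A q a"
  unfolding A_def tdiff_def by (simp add: P_id P_tangent)

lemma P_inner: "P q a \<bullet> b = a \<bullet> P q b"
  by (simp add: P_def inner_diff_left inner_diff_right inner_commute)

text \<open>The coefficient of \<open>\<nu> q\<close> measures the asymmetry of \<open>A q\<close>.
  The other group is tangent to \<open>N\<close> and vanishes when \<open>a\<close> and
  \<open>b\<close> are tangent.\<close>

lemma bracket:
  "tdiff (\<lambda>x. P x b) a q - tdiff (\<lambda>x. P x a) b q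
    = (b \<bullet> A q a - a \<bullet> A q b) *\<^sub>R \<nu> q
      + (((b \<bullet> \<nu> q) *\<^sub>R A q a - (b \<bullet> q) *\<^sub>R P q a) - ((a \<bullet> \<nu> q) *\<^sub>R A q b - (a \<bullet> q) *\<^sub>R P q b))"
  using P_inner[of a b] by (simp add: tdiff_P q inner_commute[of b "P q a"] algebra_simps)

text \<open>\<open>G\<close> vanishes on \<open>N\<close>, hence so do its first and second
  tangential derivatives there. The bracket of two projected fields then has no component along
  \<open>\<nu> q\<close>, because \<open>G\<close> has nonzero derivative in that direction.\<close>

lemma A_sym: "A q a \<bullet> b = a \<bullet> A q b"
proof -
  let ?D = "frechet_derivative G (at q)"
  let ?t = "((b \<bullet> \<nu> q) *\<^sub>R A q a - (b \<bullet> q) *\<^sub>R P q a) - ((a \<bullet> \<nu> q) *\<^sub>R A q b - (a \<bullet> q) *\<^sub>R P q b)"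
  have z: "tdiff G c x = 0" if "x \<in> N" "x \<in> U" for x c
    using tdiff_cong[OF smooth_G smooth_intros_U(1)[of 0] that, of c] G_zero tdiff_const by metis
  have zz: "tdiff (tdiff G d) c q = 0" for c d
    using tdiff_cong[OF smooth_tdiff[OF smooth_G] smooth_intros_U(1)[of 0] q, of d c] z tdiff_const
    by metis
  have "?t \<in> T q"
    by (intro subspace_diff subspace_scale subspace_T A_tangent P_tangent)
  then have "?D ?t = 0"
    using frechet_derivative_eq_tangent[OF openU smooth_G smooth_intros_U(1)[of 0] q] G_zero
    by (metis frechet_derivative_const)
  moreover have "?D ((b \<bullet> A q a - a \<bullet> A q b) *\<^sub>R \<nu> q + ?t) = 0"
    using tdiff_commute[OF smooth_G q(2), of b a] unfolding bracket zz by simp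
  ultimately have "(b \<bullet> A q a - a \<bullet> A q b) * ?D (\<nu> q) = 0"
    by (simp add: linear_add linear_scale linear_frechet[OF smooth_G q(2)])
  then show ?thesis using G_normal[OF q] by (simp add: inner_commute)
qed

lemma Codazzi:
  "dA a q b - dA b q a
    = A q ((b \<bullet> \<nu> q) *\<^sub>R A q a - (b \<bullet> q) *\<^sub>R a - ((a \<bullet> \<nu> q) *\<^sub>R A q b - (a \<bullet> q) *\<^sub>R b))"
proof -
  let ?t = "((b \<bullet> \<nu> q) *\<^sub>R A q a - (b \<bullet> q) *\<^sub>R P q a) - ((a \<bullet> \<nu> q) *\<^sub>R A q b - (a \<bullet> q) *\<^sub>R P q b)"
  have t: "?t \<in> T q"
    by (intro subspace_diff subspace_scale subspace_T A_tangent P_tangent)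
  have "dA a q b - dA b q a = - (tdiff (tdiff \<nu> b) a q - tdiff (tdiff \<nu> a) b q)"
    unfolding dA_def A_def by (simp add: tdiff_minus smooth_tdiff smooth_\<nu> q)
  also have "\<dots> = - frechet_derivative \<nu> (at q) ?t"
    unfolding tdiff_commute[OF smooth_\<nu> q(2)] bracket
    using A_sym[of a b] by (simp add: inner_commute)
  also have "\<dots> = A q ?t"
    unfolding A_def[of q ?t] tdiff_def P_id[OF t] ..
  also have "\<dots> = A q ((b \<bullet> \<nu> q) *\<^sub>R A q a - (b \<bullet> q) *\<^sub>R a - ((a \<bullet> \<nu> q) *\<^sub>R A q b - (a \<bullet> q) *\<^sub>R b))"
    by (simp add: linear_diff linear_scale linear_A q A_P)
  finally show ?thesis .
qed

end

end

subsection \<open>The curvature tensor\<close>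

context hypersurface_germ
begin

context
  fixes q assumes q: "q \<in> N" "q \<in> U"
begin

lemma oproj_T: "oproj (T q) x = P q x"
proof (rule oprojI[OF subspace_T[OF q] P_tangent[OF q]])
  fix v assume "v \<in> T q"
  then show "(x - P q x) \<bullet> v = 0"
    by (simp add: tangent[OF q] P_def inner_add_left inner_commute[of q] inner_commute[of "\<nu> q"])
qed

lemma tangent_ext_eq: "tangent_ext N u q = P q u"
  by (simp add: tangent_ext_def oproj_T)

lemma tderiv_tdiff:
  assumes "smooth_on U F" "\<And>x. x \<in> N \<Longrightarrow> x \<in> U \<Longrightarrow> F x = Y x"
  shows "tderiv N Y q (P q a) = tdiff F a q"
  unfolding tdiff_def by (rule tderiv_eq[OF openU assms(1) q assms(2) P_tangent[OF q]])

lemma P_A: "P q (A q a) = A q a"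
  by (rule P_id[OF q A_tangent[OF q]])

lemma P_P: "P q (P q a) = P q a"
  by (rule P_id[OF q P_tangent[OF q]])

lemma P_normal: "P q q = 0" "P q (\<nu> q) = 0"
  using unit[OF q] by (simp_all add: P_def inner_commute[of q "\<nu> q"])

end

text \<open>A projected constant vector changes tangentially only through its normal components.
  Having this at every point of \<open>N\<close> in \<open>U\<close>, and not just where
  \<open>z\<close> is tangent, permits the second covariant derivative.\<close>

lemma cov_deriv_tangent_ext:
  assumes q: "q \<in> N" "q \<in> U"
  shows "cov_deriv N (tangent_ext N v) (tangent_ext N z) q
    = (z \<bullet> \<nu> q) *\<^sub>R A q v - (z \<bullet> q) *\<^sub>R P q v"
proof -
  have "tderiv N (tangent_ext N z) q (P q v) = tdiff (\<lambda>x. P x z) v q"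
    by (rule tderiv_tdiff[OF q smooth_P]) (simp add: tangent_ext_eq)
  then show ?thesis
    by (simp add: cov_deriv_def tangent_ext_eq q oproj_T tdiff_P linear_add linear_diff linear_scale
        linear_P P_A P_P P_normal)
qed

context
  fixes p assumes p: "p \<in> N" "p \<in> U"
begin

lemma bracket_tangent:
  assumes "a \<in> T p" "b \<in> T p"
  shows "tdiff (\<lambda>x. P x b) a p = tdiff (\<lambda>x. P x a) b p"
proof -
  have "tdiff (\<lambda>x. P x b) a p - tdiff (\<lambda>x. P x a) b p = 0"
    unfolding bracket[OF p] using assms A_sym[OF p, of a b] by (simp add: tangent[OF p] inner_commute)
  then show ?thesis by simp
qed

lemma cov_deriv2_tangent_ext:
  assumes "u \<in> T p" "v \<in> T p" "z \<in> T p"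
  shows "cov_deriv N (tangent_ext N u) (cov_deriv N (tangent_ext N v) (tangent_ext N z)) p
    = - ((z \<bullet> A p u) *\<^sub>R A p v) - (z \<bullet> u) *\<^sub>R v"
proof -
  let ?F = "\<lambda>x. (z \<bullet> \<nu> x) *\<^sub>R A x v - (z \<bullet> x) *\<^sub>R P x v"
  have "tderiv N (cov_deriv N (tangent_ext N v) (tangent_ext N z)) p (P p u) = tdiff ?F u p"
    by (rule tderiv_tdiff[OF p])
      (auto intro!: smooth_intros_U smooth_\<nu> smooth_A smooth_P simp: cov_deriv_tangent_ext)
  also have "\<dots> = - ((z \<bullet> A p u) *\<^sub>R A p v) - (z \<bullet> u) *\<^sub>R v"
    using assms
    by (simp add: tdiff_diff tdiff_scaleR tdiff_inner tdiff_const tdiff_id smooth_intros_U smooth_\<nu>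
        smooth_A smooth_P p P_id) (simp add: A_def tangent[OF p])
  finally show ?thesis
    using assms
    by (simp add: cov_deriv_def tangent_ext_eq p oproj_T linear_diff linear_neg linear_scale linear_P P_A P_id)
qed

text \<open>The Gauss equation: the projected extensions commute at \<open>p\<close>, so the bracket
  term drops out, and the terms free of \<open>A\<close> come from the position vector, which is the
  normal of the sphere.\<close>

lemma curvature_eq:
  assumes "u \<in> T p" "v \<in> T p" "z \<in> T p"
  shows "curvature N p u v w z = (v \<bullet> z) * (u \<bullet> w) - (u \<bullet> z) * (v \<bullet> w)
    + (A p v \<bullet> z) * (A p u \<bullet> w) - (A p u \<bullet> z) * (A p v \<bullet> w)"
proof -
  have td: "tderiv N (tangent_ext N b) p (P p a) = tdiff (\<lambda>x. P x b) a p" for a b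
    by (rule tderiv_tdiff[OF p smooth_P]) (simp add: tangent_ext_eq)
  have "lie_bracket N (tangent_ext N u) (tangent_ext N v) p = 0"
    using bracket_tangent[OF assms(1,2)] by (simp add: lie_bracket_def tangent_ext_eq p td)
  moreover have "tderiv N (tangent_ext N z) p 0 = 0"
    using td[of z 0] linear_0[OF linear_tdiff[OF smooth_P p(2)], of z] by (simp add: linear_0 linear_P)
  ultimately have "cov_deriv N (lie_bracket N (tangent_ext N u) (tangent_ext N v)) (tangent_ext N z) p = 0"
    by (simp add: cov_deriv_def oproj_T p linear_0 linear_P)
  then show ?thesis
    using assms
    by (simp add: curvature_def curv_op_def cov_deriv2_tangent_ext inner_diff_left inner_add_left
        inner_commute[of z])
qed

text \<open>In Euclidean space there are two orthonormal normals: \<open>\<nu> p\<close>, with the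
  form of \<open>A p\<close>, and the position vector, whose form is minus the metric. The squares
  add up.\<close>

lemma norm_second_ff:
  assumes "u \<in> T p" "v \<in> T p"
  shows "(norm (second_ff N p u v))\<^sup>2 = (A p u \<bullet> v)\<^sup>2 + (u \<bullet> v)\<^sup>2"
proof -
  have "tderiv N (tangent_ext N v) p (P p u) = tdiff (\<lambda>x. P x v) u p"
    by (rule tderiv_tdiff[OF p smooth_P]) (simp add: tangent_ext_eq)
  then have td: "tderiv N (tangent_ext N v) p u = (v \<bullet> A p u) *\<^sub>R \<nu> p - (v \<bullet> u) *\<^sub>R p"
    using assms by (simp add: tdiff_P p P_id) (simp add: tangent[OF p])
  have "second_ff N p u v = (v \<bullet> A p u) *\<^sub>R \<nu> p - (v \<bullet> u) *\<^sub>R p"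
    unfolding second_ff_def td by (simp add: oproj_T p linear_diff linear_scale linear_P P_normal)
  then show ?thesis
    unfolding power2_norm_eq_inner using unit[OF p]
    by (simp add: inner_diff_left inner_diff_right inner_commute[of p "\<nu> p"]
        inner_commute[of v] power2_eq_square)
qed

subsection \<open>Second derivatives of the shape operator\<close>

lemma dA_sym: "dA c p a \<bullet> b = a \<bullet> dA c p b"
proof -
  have "tdiff (\<lambda>x. A x a \<bullet> b) c p = tdiff (\<lambda>x. a \<bullet> A x b) c p"
    by (rule tdiff_cong) (auto intro!: smooth_intros_U smooth_A p A_sym)
  then show ?thesis
    by (simp add: tdiff_inner smooth_intros_U smooth_A p tdiff_const dA_def)
qed

lemma dA_commute: "a \<in> T p \<Longrightarrow> b \<in> T p \<Longrightarrow> dA a p b = dA b p a"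
  using Codazzi[OF p, of a b] by (simp add: tangent[OF p] linear_0 linear_A p)

lemma tdiff_commute_tangent:
  assumes "smooth_on U F" "a \<in> T p" "b \<in> T p"
  shows "tdiff (tdiff F b) a p = tdiff (tdiff F a) b p"
  using tdiff_commute[OF assms(1) p(2), of b a] bracket_tangent[OF assms(2,3)]
    linear_0[OF linear_frechet[OF assms(1) p(2)]] by simp

end

context
  fixes p assumes p: "p \<in> N" "p \<in> U"
begin

lemma ddA_sym: "tdiff (\<lambda>x. dA c x a) d p \<bullet> b = a \<bullet> tdiff (\<lambda>x. dA c x b) d p"
proof -
  have "tdiff (\<lambda>x. dA c x a \<bullet> b) d p = tdiff (\<lambda>x. a \<bullet> dA c x b) d p"
    by (rule tdiff_cong) (auto intro!: smooth_intros_U smooth_dA p dA_sym)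
  then show ?thesis
    by (simp add: tdiff_inner smooth_intros_U smooth_dA p tdiff_const)
qed

text \<open>Obtained by differentiating \<open>Codazzi\<close> along \<open>N\<close>. The argument
  \<open>?w\<close> of \<open>A\<close> vanishes at \<open>p\<close>, so only the derivative of
  \<open>?w\<close> contributes and no derivative of \<open>A\<close> appears.\<close>

lemma ddA_Codazzi:
  assumes "a \<in> T p" "b \<in> T p" "d \<in> T p"
  shows "tdiff (\<lambda>x. dA a x b) d p - tdiff (\<lambda>x. dA b x a) d p
    = A p ((a \<bullet> A p d) *\<^sub>R A p b + (a \<bullet> d) *\<^sub>R b - (b \<bullet> A p d) *\<^sub>R A p a - (b \<bullet> d) *\<^sub>R a)"
proof -
  let ?w = "\<lambda>x. ((b \<bullet> \<nu> x) *\<^sub>R A x a - (b \<bullet> x) *\<^sub>R a) - ((a \<bullet> \<nu> x) *\<^sub>R A x b - (a \<bullet> x) *\<^sub>R b)"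
  have sw: "smooth_on U ?w" by (intro smooth_intros_U smooth_\<nu> smooth_A)
  have w0: "?w p = 0" using assms by (simp add: tangent[OF p])
  have "tdiff (\<lambda>x. dA a x b) d p - tdiff (\<lambda>x. dA b x a) d p = tdiff (\<lambda>x. dA a x b - dA b x a) d p"
    by (simp add: tdiff_diff smooth_dA p)
  also have "\<dots> = tdiff (\<lambda>x. A x (?w x)) d p"
    by (rule tdiff_cong[OF _ smooth_on_apply[OF openU linear_A smooth_A sw] p])
      (auto intro: smooth_intros_U smooth_dA Codazzi)
  also have "\<dots> = tdiff (\<lambda>x. A x (?w p)) d p + A p (tdiff ?w d p)"
    by (rule tdiff_apply[OF p(2) linear_A smooth_A sw])
  also have "tdiff (\<lambda>x. A x (?w p)) d p = 0"
    using linear_0[OF linear_dA[OF p(2), of d]] unfolding w0 dA_def .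
  also have "tdiff ?w d p = (a \<bullet> A p d) *\<^sub>R A p b + (a \<bullet> d) *\<^sub>R b - (b \<bullet> A p d) *\<^sub>R A p a - (b \<bullet> d) *\<^sub>R a"
    using assms
    by (simp add: tdiff_diff tdiff_scaleR tdiff_inner tdiff_const tdiff_id smooth_intros_U smooth_\<nu>
        smooth_A p P_id) (simp add: A_def tangent[OF p])
  finally show ?thesis by simp
qed

text \<open>The Ricci identity for the second covariant derivative of the shape operator.\<close>

lemma ddA_exchange:
  assumes e: "e \<in> T p" "A p e = \<alpha> *\<^sub>R e" "e \<bullet> e = 1" and f: "f \<in> T p" "A p f = \<beta> *\<^sub>R f" "f \<bullet> f = 1"
    and ef: "e \<bullet> f = 0"
  shows "tdiff (\<lambda>x. dA f x e) f p \<bullet> e - tdiff (\<lambda>x. dA e x f) e p \<bullet> f = (\<alpha> - \<beta>) * (1 + \<alpha> * \<beta>)"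
proof -
  have fe: "f \<bullet> e = 0" using ef by (simp add: inner_commute)
  note lin = linear_add linear_diff linear_scale linear_A[OF p(2)]
  have 1: "tdiff (\<lambda>x. dA f x e) f p \<bullet> e - tdiff (\<lambda>x. dA e x f) f p \<bullet> e = \<beta> * \<alpha> * \<alpha> + \<alpha>"
    using arg_cong[OF ddA_Codazzi[OF f(1) e(1) f(1)], of "\<lambda>v. v \<bullet> e"]
    by (simp add: lin e f ef fe inner_diff_left inner_add_left)
  have 2: "tdiff (\<lambda>x. dA e x f) e p \<bullet> f - tdiff (\<lambda>x. dA f x e) e p \<bullet> f = \<alpha> * \<beta> * \<beta> + \<beta>"
    using arg_cong[OF ddA_Codazzi[OF e(1) f(1) e(1)], of "\<lambda>v. v \<bullet> f"]
    by (simp add: lin e f ef fe inner_diff_left inner_add_left)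
  \<comment> \<open>The ambient space is flat and the projected fields commute at \<open>p\<close>,
    so the two directions may be exchanged freely; the curvature term stems entirely from the two
    uses of \<open>ddA_Codazzi\<close>.\<close>
  have "tdiff (\<lambda>x. dA e x f) f p \<bullet> e = tdiff (\<lambda>x. dA f x f) e p \<bullet> e"
    using tdiff_commute_tangent[OF p smooth_A f(1) e(1), of f] by (simp add: dA_def[abs_def])
  also have "\<dots> = tdiff (\<lambda>x. dA f x e) e p \<bullet> f"
    by (subst ddA_sym) (simp add: inner_commute)
  finally show ?thesis using 1 2 by (simp add: algebra_simps)
qed

end

end

subsection \<open>Cartan's identity\<close>

context hypersurface_germ
begin

text \<open>A polynomial in \<open>A x\<close> with prescribed roots, applied to the tangential part
  of \<open>a\<close>. With all principal curvatures but one as roots it is, on \<open>N\<close>, a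
  multiple of the spectral projection for the remaining one; constant roots keep it smooth in
  \<open>x\<close>.\<close>

primrec annihilate :: "real list \<Rightarrow> 'a \<Rightarrow> 'a \<Rightarrow> 'a" where
  "annihilate [] x a = P x a"
| "annihilate (k # ks) x a = A x (annihilate ks x a) - k *\<^sub>R annihilate ks x a"

lemma linear_annihilate: "x \<in> U \<Longrightarrow> linear (annihilate ks x)"
proof (induction ks)
  case Nil
  then show ?case using linear_P by simp
next
  case (Cons k ks)
  then show ?case
    using linear_compose_sub[OF linear_compose[OF _ linear_A] linear_compose_scale_right]
    by (simp add: o_def)
qed

lemma smooth_annihilate: "smooth_on U (\<lambda>x. annihilate ks x a)"
proof (induction ks)
  case (Cons k ks)
  then show ?case
    by (auto intro!: smooth_intros_U smooth_on_apply[OF openU linear_A smooth_A])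
qed (simp add: smooth_P)

lemma annihilate_eigenvector:
  "q \<in> N \<Longrightarrow> q \<in> U \<Longrightarrow> v \<in> T q \<Longrightarrow> A q v = \<kappa> *\<^sub>R v \<Longrightarrow>
    annihilate ks q v = (\<Prod>k\<leftarrow>ks. \<kappa> - k) *\<^sub>R v"
  by (induction ks) (simp_all add: P_id linear_scale linear_A algebra_simps)

lemma annihilate_tangent:
  assumes "q \<in> N" "q \<in> U" shows "annihilate ks q a \<in> T q"
  using assms
  by (induction ks) (auto intro!: P_tangent A_tangent subspace_diff subspace_scale subspace_T)

lemma annihilate_P:
  assumes "q \<in> N" "q \<in> U" shows "annihilate ks q (P q a) = annihilate ks q a"
  using assms by (induction ks) (auto simp: P_P)

text \<open>One finite set \<open>K\<close> serves all points at once; this is how the constancy of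
  the principal curvatures enters the local analysis.\<close>

definition diagonalisable :: "real set \<Rightarrow> bool" where
  "diagonalisable K \<longleftrightarrow> finite K \<and>
    (\<forall>q\<in>N \<inter> U. T q \<subseteq> span (\<Union>\<kappa>\<in>K. {v \<in> T q. A q v = \<kappa> *\<^sub>R v}))"

text \<open>Constancy of the principal curvatures extends a principal vector to a smooth field
  of principal vectors.\<close>

lemma eigenfield:
  assumes K: "diagonalisable K" and p: "p \<in> N" "p \<in> U" and e: "e \<in> T p" "A p e = \<alpha> *\<^sub>R e"
  obtains w where "smooth_on U w" "w p = e"
    "\<And>q. q \<in> N \<Longrightarrow> q \<in> U \<Longrightarrow> w q \<in> T q \<and> A q (w q) = \<alpha> *\<^sub>R w q"
proof -
  have "finite (K - {\<alpha>})" using K by (simp add: diagonalisable_def)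
  then obtain ks where ks: "set ks = K - {\<alpha>}" using finite_list by blast
  define c where "c = (\<Prod>k\<leftarrow>ks. \<alpha> - k)"
  have "\<alpha> \<notin> set ks" unfolding ks by blast
  then have c: "c \<noteq> 0" unfolding c_def prod_list_zero_iff by auto
  \<comment> \<open>Lagrange interpolation: the polynomial takes the value 1 at
    \<open>\<alpha>\<close> and 0 at the other members of \<open>K\<close>.\<close>
  define w where "w x = (1 / c) *\<^sub>R annihilate ks x e" for x
  show thesis
  proof
    show "smooth_on U w"
      unfolding w_def by (intro smooth_intros_U smooth_annihilate)
    show "w p = e"
      using annihilate_eigenvector[OF p e] c by (simp add: w_def c_def)
    fix q assume q: "q \<in> N" "q \<in> U"
    have "A q (annihilate ks q v) = \<alpha> *\<^sub>R annihilate ks q v"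
      if v: "v \<in> (\<Union>\<kappa>\<in>K. {v \<in> T q. A q v = \<kappa> *\<^sub>R v})" for v
    proof -
      obtain \<kappa> where \<kappa>: "\<kappa> \<in> K" "v \<in> T q" "A q v = \<kappa> *\<^sub>R v" using v by blast
      have "\<kappa> = \<alpha> \<or> \<kappa> \<in> set ks" unfolding ks using \<kappa>(1) by blast
      moreover have "(\<Prod>k\<leftarrow>ks. \<kappa> - k) = 0" if "\<kappa> \<in> set ks"
        unfolding prod_list_zero_iff using that by force
      ultimately have "(\<Prod>k\<leftarrow>ks. \<kappa> - k) * \<kappa> = (\<Prod>k\<leftarrow>ks. \<kappa> - k) * \<alpha>"
        by auto
      then show ?thesis
        by (simp add: annihilate_eigenvector[OF q \<kappa>(2,3)] linear_scale linear_A q \<kappa>(3) mult.commute)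
    qed
    moreover have "linear (\<lambda>v. A q (annihilate ks q v))" "linear (\<lambda>v. \<alpha> *\<^sub>R annihilate ks q v)"
      using linear_compose[OF linear_annihilate[OF q(2), of ks] linear_A[OF q(2)]]
        linear_compose_scale_right[OF linear_annihilate[OF q(2), of ks]] by (simp_all add: o_def)
    moreover have "P q e \<in> span (\<Union>\<kappa>\<in>K. {v \<in> T q. A q v = \<kappa> *\<^sub>R v})"
      using K q P_tangent[OF q] unfolding diagonalisable_def by blast
    ultimately have "A q (annihilate ks q (P q e)) = \<alpha> *\<^sub>R annihilate ks q (P q e)"
      using linear_eq_on_span[of "\<lambda>v. A q (annihilate ks q v)" "\<lambda>v. \<alpha> *\<^sub>R annihilate ks q v"] by blast
    then show "w q \<in> T q \<and> A q (w q) = \<alpha> *\<^sub>R w q"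
      using annihilate_tangent[OF q] subspace_T[OF q]
      by (simp add: w_def annihilate_P q linear_scale linear_A subspace_scale)
  qed
qed

context
  fixes K p assumes K: "diagonalisable K" and p: "p \<in> N" "p \<in> U"
begin

text \<open>\<open>e'\<close> is the derivative of a principal field \<open>w\<close> through
  \<open>e\<close>. Differentiating \<open>A w = \<alpha> w\<close> once gives the first equation,
  twice and pairing with \<open>e\<close> the last one; the normal components follow from
  \<open>w x\<close> being orthogonal to \<open>x\<close> and \<open>\<nu> x\<close>.\<close>

lemma eigenfield_derivatives:
  assumes e: "e \<in> T p" "A p e = \<alpha> *\<^sub>R e" and f: "f \<in> T p"
  obtains e' where "dA f p e + A p e' = \<alpha> *\<^sub>R e'" "e' \<bullet> p = - (e \<bullet> f)" "e' \<bullet> \<nu> p = e \<bullet> A p f"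
    "tdiff (\<lambda>x. dA f x e) f p \<bullet> e = - 2 * (e' \<bullet> dA f p e)"
proof -
  obtain w where w: "smooth_on U w" "w p = e"
    and wN: "\<And>q. q \<in> N \<Longrightarrow> q \<in> U \<Longrightarrow> w q \<in> T q \<and> A q (w q) = \<alpha> *\<^sub>R w q"
    using eigenfield[OF K p e] by blast
  define w' where "w' = tdiff w f"
  have sw': "smooth_on U w'" unfolding w'_def by (rule smooth_tdiff[OF w(1)])
  have first: "dA f q (w q) + A q (w' q) = \<alpha> *\<^sub>R w' q" if q: "q \<in> N" "q \<in> U" for q
  proof -
    have "tdiff (\<lambda>x. A x (w x)) f q = tdiff (\<lambda>x. \<alpha> *\<^sub>R w x) f q"
      by (rule tdiff_cong[OF smooth_on_apply[OF openU linear_A smooth_A w(1)] _ q])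
        (auto intro!: smooth_intros_U w simp: wN)
    then show ?thesis
      using tdiff_apply[OF q(2) linear_A smooth_A w(1), of f]
      by (simp add: dA_def w'_def tdiff_scaleR smooth_intros_U w q tdiff_const)
  qed
  have "tdiff (\<lambda>x. dA f x (w x) + A x (w' x)) f p = tdiff (\<lambda>x. \<alpha> *\<^sub>R w' x) f p"
    by (rule tdiff_cong[OF _ _ p])
      (auto intro!: smooth_intros_U smooth_on_apply[OF openU linear_A smooth_A]
        smooth_on_apply[OF openU linear_dA smooth_dA] w sw' first)
  then have "tdiff (\<lambda>x. dA f x (w x)) f p + tdiff (\<lambda>x. A x (w' x)) f p = \<alpha> *\<^sub>R tdiff w' f p"
    by (simp add: tdiff_add smooth_on_apply[OF openU linear_A smooth_A]
        smooth_on_apply[OF openU linear_dA smooth_dA] tdiff_scaleR smooth_intros_U w sw' p tdiff_const)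
  then have "tdiff (\<lambda>x. dA f x e) f p + dA f p (w' p) + (dA f p (w' p) + A p (tdiff w' f p))
      = \<alpha> *\<^sub>R tdiff w' f p"
    using tdiff_apply[OF p(2) linear_dA smooth_dA w(1), of f f]
      tdiff_apply[OF p(2) linear_A smooth_A sw', of f] w(2)
    by (simp add: dA_def w'_def)
  then have "(tdiff (\<lambda>x. dA f x e) f p + dA f p (w' p) + (dA f p (w' p) + A p (tdiff w' f p))) \<bullet> e
      = (\<alpha> *\<^sub>R tdiff w' f p) \<bullet> e"
    by simp
  \<comment> \<open>Self-adjointness moves \<open>A p\<close> onto \<open>e\<close>, so the unknown
    second derivative of \<open>w\<close> cancels.\<close>
  moreover have "A p (tdiff w' f p) \<bullet> e = \<alpha> * (tdiff w' f p \<bullet> e)"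
    using A_sym[OF p, of "tdiff w' f p" e] e by simp
  moreover have "dA f p (w' p) \<bullet> e = w' p \<bullet> dA f p e" by (rule dA_sym[OF p])
  ultimately have second: "tdiff (\<lambda>x. dA f x e) f p \<bullet> e = - 2 * (w' p \<bullet> dA f p e)"
    by (simp add: inner_add_left)
  have "tdiff (\<lambda>x. w x \<bullet> x) f p = tdiff (\<lambda>x. 0::real) f p"
    by (rule tdiff_cong[OF _ _ p]) (use wN tangent in \<open>auto intro!: smooth_intros_U w\<close>)
  then have 1: "w' p \<bullet> p = - (e \<bullet> f)"
    by (simp add: tdiff_inner smooth_intros_U w p tdiff_const tdiff_id w'_def P_id f)
  have "tdiff (\<lambda>x. w x \<bullet> \<nu> x) f p = tdiff (\<lambda>x. 0::real) f p"
    by (rule tdiff_cong[OF _ _ p]) (use wN tangent in \<open>auto intro!: smooth_intros_U w smooth_\<nu>\<close>)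
  then have 2: "w' p \<bullet> \<nu> p = e \<bullet> A p f"
    by (simp add: tdiff_inner smooth_intros_U smooth_\<nu> w p tdiff_const w'_def A_def)
  show thesis
    using that[of "w' p"] first[OF p] second 1 2 w(2) by simp
qed

text \<open>Pairing the first-order equation with \<open>g\<close> cancels both terms that contain
  \<open>e'\<close>.\<close>

lemma dA_eigen_orth:
  assumes e: "e \<in> T p" "A p e = \<alpha> *\<^sub>R e" and f: "f \<in> T p" and g: "A p g = \<alpha> *\<^sub>R g"
  shows "dA f p e \<bullet> g = 0"
proof -
  obtain e' where e': "dA f p e + A p e' = \<alpha> *\<^sub>R e'"
    using eigenfield_derivatives[OF e f] by blast
  have "A p e' \<bullet> g = \<alpha> * (e' \<bullet> g)" using A_sym[OF p, of e' g] g by simp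
  then show ?thesis using arg_cong[OF e', of "\<lambda>v. v \<bullet> g"] by (simp add: inner_add_left)
qed

text \<open>Second-order perturbation theory for a constant eigenvalue. Orthogonality of
  \<open>e\<close> and \<open>f\<close> makes \<open>e'\<close> tangent, so it can be expanded in
  \<open>B\<close>; the first-order equation gives its components outside the
  \<open>\<alpha>\<close>-eigenspace. Inside, \<open>dA f p e\<close> has no component, in
  accordance with division by zero giving 0.\<close>

lemma second_variation:
  assumes B: "onb (T p) B" "\<And>b. b \<in> B \<Longrightarrow> A p b = \<kappa> b *\<^sub>R b"
    and e: "e \<in> T p" "A p e = \<alpha> *\<^sub>R e" and f: "f \<in> T p" "A p f = \<beta> *\<^sub>R f" and ef: "e \<bullet> f = 0"
  shows "tdiff (\<lambda>x. dA f x e) f p \<bullet> e = - 2 * (\<Sum>g\<in>B. (dA f p e \<bullet> g)\<^sup>2 / (\<alpha> - \<kappa> g))"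
proof -
  obtain e' where e': "dA f p e + A p e' = \<alpha> *\<^sub>R e'" "e' \<bullet> p = 0" "e' \<bullet> \<nu> p = 0"
    "tdiff (\<lambda>x. dA f x e) f p \<bullet> e = - 2 * (e' \<bullet> dA f p e)"
    using eigenfield_derivatives[OF e f(1)] ef f(2) by auto
  have e'T: "e' \<in> T p" using e'(2,3) by (simp add: tangent[OF p])
  have "(e' \<bullet> g) * (dA f p e \<bullet> g) = (dA f p e \<bullet> g)\<^sup>2 / (\<alpha> - \<kappa> g)" if g: "g \<in> B" for g
  proof (cases "\<kappa> g = \<alpha>")
    case True
    then show ?thesis using dA_eigen_orth[OF e f(1), of g] B(2)[OF g] by simp
  next
    case False
    have "A p e' \<bullet> g = \<kappa> g * (e' \<bullet> g)" using A_sym[OF p, of e' g] B(2)[OF g] by simp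
    then have "dA f p e \<bullet> g = (\<alpha> - \<kappa> g) * (e' \<bullet> g)"
      using arg_cong[OF e'(1), of "\<lambda>v. v \<bullet> g"] by (simp add: inner_add_left algebra_simps)
    then show ?thesis using False by (simp add: power2_eq_square)
  qed
  then show ?thesis
    unfolding e'(4) using onb_parseval[OF B(1) e'T, of "dA f p e"] by simp
qed

text \<open>Terms with \<open>\<kappa> f = \<kappa> e\<close> vanish because \<open>x / 0 = 0\<close>.\<close>

lemma Cartan_identity:
  assumes B: "onb (T p) B" "\<And>b. b \<in> B \<Longrightarrow> A p b = \<kappa> b *\<^sub>R b" and e: "e \<in> B"
  shows "(\<Sum>f\<in>B. (1 + \<kappa> e * \<kappa> f) / (\<kappa> e - \<kappa> f)) = 0"
proof -
  have BT: "b \<in> T p" if "b \<in> B" for b using onb_subset[OF B(1)] that by blast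
  \<comment> \<open>The derivative of the shape operator with one slot fixed at \<open>e\<close>. It
    is symmetric in all three slots and vanishes as soon as two of them carry the same
    curvature.\<close>
  define t where "t f g = dA f p e \<bullet> g" for f g
  have t_sym: "t f g = t g f" if "f \<in> B" "g \<in> B" for f g
    using dA_commute[OF p BT[OF that(1)] BT[OF e]] dA_commute[OF p BT[OF that(2)] BT[OF e]]
      dA_sym[OF p, of e f g]
    by (simp add: t_def inner_commute)
  have t0: "t f g = 0" if "f \<in> B" "g \<in> B" "\<kappa> g = \<kappa> e" for f g
    unfolding t_def using dA_eigen_orth[OF BT[OF e] B(2)[OF e] BT[OF that(1)], of g] B(2) that by simp
  have t1: "t f g = 0" if "f \<in> B" "g \<in> B" "\<kappa> g = \<kappa> f" for f g
    unfolding t_def dA_commute[OF p BT[OF that(1)] BT[OF e]]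
    using dA_eigen_orth[OF BT[OF that(1)] B(2)[OF that(1)] BT[OF e], of g] B(2) that by simp
  \<comment> \<open>The difference of the two second variations, divided by
    \<open>(\<kappa> e - \<kappa> f)\<^sup>2\<close>. It is antisymmetric in \<open>f\<close> and
    \<open>g\<close>, so its double sum vanishes.\<close>
  define s where "s f g = 2 * (t f g)\<^sup>2 / ((\<kappa> e - \<kappa> f) * (\<kappa> e - \<kappa> g) * (\<kappa> f - \<kappa> g))" for f g
  have "(1 + \<kappa> e * \<kappa> f) / (\<kappa> e - \<kappa> f) = (\<Sum>g\<in>B. s f g)" if f: "f \<in> B" for f
  proof (cases "\<kappa> f = \<kappa> e")
    case True
    then show ?thesis by (simp add: s_def)
  next
    case False
    have ef: "e \<bullet> f = 0" using onb_inner[OF B(1) e f] False by auto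
    have fe: "f \<bullet> e = 0" using ef by (simp add: inner_commute)
    have n: "e \<bullet> e = 1" "f \<bullet> f = 1" using onb_inner[OF B(1)] e f by auto
    have 1: "tdiff (\<lambda>x. dA f x e) f p \<bullet> e = - 2 * (\<Sum>g\<in>B. (t f g)\<^sup>2 / (\<kappa> e - \<kappa> g))"
      using second_variation[OF B BT[OF e] B(2)[OF e] BT[OF f] B(2)[OF f] ef] by (simp add: t_def)
    have 2: "tdiff (\<lambda>x. dA e x f) e p \<bullet> f = - 2 * (\<Sum>g\<in>B. (t f g)\<^sup>2 / (\<kappa> f - \<kappa> g))"
      using second_variation[OF B BT[OF f] B(2)[OF f] BT[OF e] B(2)[OF e] fe]
        dA_commute[OF p BT[OF e] BT[OF f]] by (simp add: t_def)
    have "(\<kappa> e - \<kappa> f) * (1 + \<kappa> e * \<kappa> f)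
      = - 2 * (\<Sum>g\<in>B. (t f g)\<^sup>2 / (\<kappa> e - \<kappa> g)) + 2 * (\<Sum>g\<in>B. (t f g)\<^sup>2 / (\<kappa> f - \<kappa> g))"
      using ddA_exchange[OF p BT[OF e] B(2)[OF e] n(1) BT[OF f] B(2)[OF f] n(2) ef] 1 2 by simp
    also have "\<dots> = (\<Sum>g\<in>B. (\<kappa> e - \<kappa> f)\<^sup>2 * s f g)"
      unfolding sum_distrib_left sum.distrib[symmetric]
    proof (rule sum.cong[OF refl])
      fix g assume g: "g \<in> B"
      show "- 2 * ((t f g)\<^sup>2 / (\<kappa> e - \<kappa> g)) + 2 * ((t f g)\<^sup>2 / (\<kappa> f - \<kappa> g)) = (\<kappa> e - \<kappa> f)\<^sup>2 * s f g"
      proof (cases "\<kappa> g = \<kappa> e \<or> \<kappa> g = \<kappa> f")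
        case True
        then have "t f g = 0" using t0[OF f g] t1[OF f g] by blast
        then show ?thesis by (simp add: s_def)
      next
        case False
        then have "\<kappa> e - \<kappa> g \<noteq> 0" "\<kappa> f - \<kappa> g \<noteq> 0" "\<kappa> e - \<kappa> f \<noteq> 0"
          using \<open>\<kappa> f \<noteq> \<kappa> e\<close> by auto
        then show ?thesis by (simp add: s_def divide_simps) (simp add: algebra_simps power2_eq_square)
      qed
    qed
    finally have "(\<kappa> e - \<kappa> f) * (1 + \<kappa> e * \<kappa> f) = (\<kappa> e - \<kappa> f)\<^sup>2 * (\<Sum>g\<in>B. s f g)"
      by (simp add: sum_distrib_left)
    then show ?thesis using False by (simp add: power2_eq_square divide_simps)
  qed
  then have "(\<Sum>f\<in>B. (1 + \<kappa> e * \<kappa> f) / (\<kappa> e - \<kappa> f)) = (\<Sum>f\<in>B. \<Sum>g\<in>B. s f g)"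
    by (rule sum.cong[OF refl])
  moreover have "(\<Sum>f\<in>B. \<Sum>g\<in>B. s f g) = - (\<Sum>f\<in>B. \<Sum>g\<in>B. s f g)"
  proof -
    have "s f g = - s g f" if "f \<in> B" "g \<in> B" for f g
    proof -
      have "(\<kappa> e - \<kappa> f) * (\<kappa> e - \<kappa> g) * (\<kappa> f - \<kappa> g) = - ((\<kappa> e - \<kappa> g) * (\<kappa> e - \<kappa> f) * (\<kappa> g - \<kappa> f))"
        by (simp add: algebra_simps)
      then show ?thesis unfolding s_def t_sym[OF that] by (simp only: divide_minus_right)
    qed
    then have "(\<Sum>f\<in>B. \<Sum>g\<in>B. s f g) = (\<Sum>f\<in>B. \<Sum>g\<in>B. - s g f)"
      by (intro sum.cong refl)
    also have "\<dots> = - (\<Sum>g\<in>B. \<Sum>f\<in>B. s g f)" by (subst sum.swap) (simp add: sum_negf)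
    finally show ?thesis .
  qed
  ultimately show ?thesis by simp
qed

end

end

section \<open>Level hypersurfaces of the sphere\<close>

lemma tangent_space_mono:
  assumes "N \<subseteq> M" "v \<in> tangent_space N q" shows "v \<in> tangent_space M q"
proof -
  obtain \<gamma> where "\<forall>t. \<gamma> t \<in> N" "\<gamma> 0 = q" "(\<gamma> has_vector_derivative v) (at 0)"
    using assms(2) unfolding tangent_space_def by blast
  then have "(\<forall>t. \<gamma> t \<in> M) \<and> \<gamma> 0 = q \<and> (\<gamma> has_vector_derivative v) (at 0)"
    using assms(1) by blast
  then show ?thesis unfolding tangent_space_def by blast
qed

lemma tangent_space_sphere:
  fixes q :: "'a::euclidean_space"
  assumes q: "q \<bullet> q = 1"
  shows "tangent_space (sphere 0 1) q = {v. v \<bullet> q = 0}"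
proof (intro equalityI subsetI)
  fix v assume v: "v \<in> tangent_space (sphere 0 1) q"
  have "frechet_derivative (\<lambda>x. x \<bullet> x) (at q) v = frechet_derivative (\<lambda>x. 1::real) (at q) v"
    by (rule frechet_derivative_eq_tangent[of UNIV, OF _ _ _ _ _ _ v])
      (use q in \<open>auto intro!: smooth_intros simp: norm_eq_1\<close>)
  moreover have "frechet_derivative (\<lambda>x. x \<bullet> x) (at q) = (\<lambda>v. q \<bullet> v + v \<bullet> q)"
    by (rule frechet_derivative_at[symmetric]) (auto intro!: derivative_eq_intros)
  ultimately show "v \<in> {v. v \<bullet> q = 0}" by (simp add: inner_commute)
next
  fix v assume v: "v \<in> {v. v \<bullet> q = 0}"
  then have vq: "v \<bullet> q = 0" "q \<bullet> v = 0" by (auto simp: inner_commute)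
  show "v \<in> tangent_space (sphere 0 1) q"
  proof (cases "v = 0")
    case True
    have "((\<lambda>t::real. q) has_vector_derivative v) (at 0)" using True by simp
    then show ?thesis unfolding tangent_space_def using q by (auto simp: norm_eq_1)
  next
    case False
    define n where "n = norm v"
    have n: "n > 0" "v \<bullet> v = n\<^sup>2" using False by (simp_all add: n_def power2_norm_eq_inner)
    \<comment> \<open>The great circle through \<open>q\<close> with initial velocity
      \<open>v\<close>.\<close>
    define \<gamma> where "\<gamma> t = cos (t * n) *\<^sub>R q + (sin (t * n) / n) *\<^sub>R v" for t
    have "\<gamma> t \<bullet> \<gamma> t = (cos (t * n))\<^sup>2 + (sin (t * n))\<^sup>2" for t
      using n by (simp add: \<gamma>_def inner_add_left inner_add_right vq q power2_eq_square)
    then have "\<gamma> t \<in> sphere 0 1" for t by (simp add: norm_eq_1)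
    moreover have "\<gamma> 0 = q" by (simp add: \<gamma>_def)
    moreover have "(\<gamma> has_vector_derivative v) (at 0)"
      unfolding \<gamma>_def has_vector_derivative_def using n
      by (auto intro!: derivative_eq_intros simp: fun_eq_iff)
    ultimately show ?thesis unfolding tangent_space_def by blast
  qed
qed

text \<open>The inverse function theorem asks for a derivative that is continuous as an operator,
  whereas \<open>smooth_on\<close> speaks of one direction at a time.\<close>

lemma continuous_on_Blinfun_frechet:
  fixes F :: "'a::euclidean_space \<Rightarrow> 'b::euclidean_space"
  assumes "smooth_on U F"
  shows "continuous_on U (\<lambda>x. Blinfun (frechet_derivative F (at x)))"
proof (rule continuous_on_blinfun_componentwise)
  fix i :: 'a
  have "continuous_on U (\<lambda>x. frechet_derivative F (at x) i)"
    by (rule smooth_on_imp_continuous_on[OF smooth_on_frechet[OF assms]])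
  then show "continuous_on U (\<lambda>x. blinfun_apply (Blinfun (frechet_derivative F (at x))) i)"
    by (rule continuous_on_cong[THEN iffD1, rotated 2])
      (simp_all add: bounded_linear_Blinfun_apply[OF has_derivative_bounded_linear
          [OF smooth_on_has_derivative[OF assms]]])
qed

text \<open>The curve is the preimage of a straight line under a map with invertible derivative whose
  components along \<open>q\<close> and \<open>g\<close> are the two defining functions of the level set.\<close>

lemma level_set_tangent:
  fixes q g :: "'a::euclidean_space" and F :: "'a \<Rightarrow> real"
  assumes U: "open U" "smooth_on U F" "q \<in> U" and q: "q \<bullet> q = 1" "F q = c"
    and N: "\<And>x. x \<in> U \<Longrightarrow> x \<bullet> x = 1 \<Longrightarrow> F x = c \<Longrightarrow> x \<in> N"
    and g: "g \<bullet> q = 0" "g \<noteq> 0" "\<And>w. w \<bullet> q = 0 \<Longrightarrow> frechet_derivative F (at q) w = g \<bullet> w"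
    and v: "v \<bullet> q = 0" "v \<bullet> g = 0"
  shows "v \<in> tangent_space N q"
proof -
  let ?D = "frechet_derivative F (at q)"
  have gg: "g \<bullet> g \<noteq> 0" "q \<bullet> g = 0" "g \<bullet> v = 0" "q \<bullet> v = 0" using g v by (auto simp: inner_commute)
  have DF: "(F has_derivative ?D) (at q)" by (rule smooth_on_has_derivative[OF U(2,3)])
  have linD: "linear ?D" using DF has_derivative_linear by blast
  \<comment> \<open>Chosen so that the inner products of \<open>\<Psi> x\<close> with
    \<open>g\<close> and \<open>q\<close> are \<open>F x - c\<close> and
    \<open>1 + (x \<bullet> x - 1) / 2\<close>, while the remaining components are those of
    \<open>x\<close>.\<close>
  define \<Psi> where "\<Psi> x = x + ((F x - c - g \<bullet> (x - q)) / (g \<bullet> g)) *\<^sub>R g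
    + ((x \<bullet> x - 1) / 2 - q \<bullet> (x - q)) *\<^sub>R q" for x
  define \<kappa> where "\<kappa> = ?D q / (g \<bullet> g)"
  have sm: "smooth_on U \<Psi>"
    unfolding \<Psi>_def divide_inverse real_scaleR_def[symmetric]
    by (intro smooth_intros U)
  have "(\<Psi> has_derivative (\<lambda>w. w + ((?D w - g \<bullet> w) / (g \<bullet> g)) *\<^sub>R g)) (at q)"
  proof -
    have 1: "((\<lambda>x. F x - c - g \<bullet> (x - q)) has_derivative (\<lambda>w. ?D w - g \<bullet> w)) (at q)"
      by (auto intro!: derivative_eq_intros DF simp: fun_eq_iff)
    have 2: "((\<lambda>x. (x \<bullet> x - 1) / 2 - q \<bullet> (x - q)) has_derivative (\<lambda>w. 0)) (at q)"
      by (auto intro!: derivative_eq_intros simp: fun_eq_iff inner_commute)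
    show ?thesis
      unfolding \<Psi>_def
      using has_derivative_add[OF has_derivative_add[OF has_derivative_ident has_derivative_scaleR_left
            [OF bounded_linear.has_derivative[OF bounded_linear_divide 1]]] has_derivative_scaleR_left[OF 2]]
      by simp
  qed
  \<comment> \<open>\<open>F\<close> is only an extension and may have a derivative along
    \<open>q\<close>. It perturbs the identity by a map of square zero, since \<open>g\<close> is
    orthogonal to \<open>q\<close>; subtracting that map gives the inverse.\<close>
  moreover have "(?D w - g \<bullet> w) / (g \<bullet> g) = (w \<bullet> q) * \<kappa>" for w
  proof -
    have "?D w = ?D (w - (w \<bullet> q) *\<^sub>R q) + (w \<bullet> q) * ?D q"
      by (simp add: linear_diff[OF linD] linear_scale[OF linD])
    also have "?D (w - (w \<bullet> q) *\<^sub>R q) = g \<bullet> w"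
      by (subst g(3)) (simp_all add: inner_diff_left inner_diff_right q g)
    finally show ?thesis by (simp add: \<kappa>_def)
  qed
  ultimately have D\<Psi>: "frechet_derivative \<Psi> (at q) = (\<lambda>w. w + ((w \<bullet> q) * \<kappa>) *\<^sub>R g)"
    by (simp add: frechet_derivative_at[symmetric])
  let ?f' = "\<lambda>x. Blinfun (frechet_derivative \<Psi> (at x))"
  have app: "blinfun_apply (?f' x) = frechet_derivative \<Psi> (at x)" if "x \<in> U" for x
    by (rule bounded_linear_Blinfun_apply[OF has_derivative_bounded_linear
          [OF smooth_on_has_derivative[OF sm that]]])
  define invf where "invf = Blinfun (\<lambda>w. w - ((w \<bullet> q) * \<kappa>) *\<^sub>R g)"
  have invf: "blinfun_apply invf w = w - ((w \<bullet> q) * \<kappa>) *\<^sub>R g" for w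
    unfolding invf_def
    by (subst bounded_linear_Blinfun_apply) (auto intro!: bounded_linear_intros)
  have "invf o\<^sub>L ?f' q = id_blinfun"
    by (rule blinfun_eqI)
      (simp only: blinfun_apply_blinfun_compose invf app[OF U(3)], simp add: D\<Psi> inner_add_left g)
  then obtain U' V h h' where h: "open U'" "U' \<subseteq> U" "q \<in> U'" "open V" "\<Psi> q \<in> V"
    "homeomorphism U' V \<Psi> h" "\<And>y. y \<in> V \<Longrightarrow> (h has_derivative (h' y)) (at y)"
    "\<And>y. y \<in> V \<Longrightarrow> h' y = inv (blinfun_apply (?f' (h y)))"
    "\<And>y. y \<in> V \<Longrightarrow> bij (blinfun_apply (?f' (h y)))"
    using inverse_function_theorem[of U \<Psi> ?f' q invf] U smooth_on_has_derivative[OF sm] app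
      continuous_on_Blinfun_frechet[OF sm] by metis
  have \<Psi>q: "\<Psi> q = q" by (simp add: \<Psi>_def q)
  have hq: "h q = q" using h(3,6) \<Psi>q unfolding homeomorphism_def by metis
  have h'v: "h' q v = v"
  proof -
    have "blinfun_apply (?f' (h q)) v = v" by (simp only: hq app[OF U(3)], simp add: D\<Psi> v)
    then show ?thesis
      using h(8,9)[OF h(5)] unfolding \<Psi>q by (metis bij_inv_eq_iff)
  qed
  \<comment> \<open>\<open>tangent_space\<close> wants a curve defined for all times, so it rests at
    \<open>q\<close> whenever the line is outside \<open>V\<close>, which does not happen near
    0.\<close>
  define \<gamma> where "\<gamma> t = (if q + t *\<^sub>R v \<in> V then h (q + t *\<^sub>R v) else q)" for t
  have qV: "q \<in> V" using h(5) \<Psi>q by simp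
  have "\<gamma> t \<in> N" for t
  proof (cases "q + t *\<^sub>R v \<in> V")
    case True
    define y where "y = h (q + t *\<^sub>R v)"
    have y: "y \<in> U" "\<Psi> y = q + t *\<^sub>R v"
      using True h(2,6) unfolding homeomorphism_def y_def by auto
    have "\<Psi> y \<bullet> q = 1" "\<Psi> y \<bullet> g = 0" unfolding y(2) by (simp_all add: inner_add_left q gg v)
    moreover have "\<Psi> y \<bullet> q = 1 + (y \<bullet> y - 1) / 2"
      by (simp add: \<Psi>_def inner_add_left inner_diff_right q g inner_commute[of q y])
    moreover have "\<Psi> y \<bullet> g = F y - c"
      using gg by (simp add: \<Psi>_def inner_add_left inner_diff_right q g inner_commute[of g y])
    ultimately have "y \<in> N" using N[OF y(1)] by simp
    then show ?thesis using True by (simp add: \<gamma>_def y_def)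
  next
    case False
    then show ?thesis using N U(3) q by (simp add: \<gamma>_def)
  qed
  moreover have "\<gamma> 0 = q" by (simp add: \<gamma>_def hq)
  moreover have "(\<gamma> has_vector_derivative v) (at 0)"
  proof -
    have l: "((\<lambda>t. q + t *\<^sub>R v) has_derivative (\<lambda>t. t *\<^sub>R v)) (at 0)"
      by (auto intro!: derivative_eq_intros)
    have "(h has_derivative h' q) (at (q + 0 *\<^sub>R v))" using h(7)[OF qV] by simp
    from diff_chain_at[OF l this]
    have "((\<lambda>t. h (q + t *\<^sub>R v)) has_derivative (\<lambda>t. h' q (t *\<^sub>R v))) (at 0)"
      by (simp add: o_def)
    moreover have "h' q (t *\<^sub>R v) = t *\<^sub>R v" for t
      using linear_scale[OF has_derivative_linear[OF h(7)[OF qV]]] h'v by simp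
    ultimately have d: "((\<lambda>t. h (q + t *\<^sub>R v)) has_derivative (\<lambda>t. t *\<^sub>R v)) (at 0)" by simp
    have "open ((\<lambda>t. q + t *\<^sub>R v) -` V)"
      by (rule open_vimage[OF h(4)]) (intro continuous_intros)
    then show ?thesis
      unfolding has_vector_derivative_def
      by (rule has_derivative_transform_within_open[OF d]) (use qV in \<open>auto simp: \<gamma>_def\<close>)
  qed
  ultimately show ?thesis unfolding tangent_space_def by blast
qed

lemma tgrad_sphere:
  fixes q :: "'a::euclidean_space" and F f :: "'a \<Rightarrow> real"
  assumes U: "open U" "smooth_on U F" "q \<in> U" and q: "q \<bullet> q = 1"
    and eq: "\<And>x. x \<in> sphere 0 1 \<Longrightarrow> x \<in> U \<Longrightarrow> F x = f x"
  shows "tgrad (sphere 0 1) f q \<bullet> q = 0"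
    and "w \<bullet> q = 0 \<Longrightarrow> frechet_derivative F (at q) w = tgrad (sphere 0 1) f q \<bullet> w"
proof -
  let ?D = "frechet_derivative F (at q)"
  have linD: "linear ?D" using linear_frechet[OF U(2,3)] .
  have qS: "q \<in> sphere 0 1" using q by (simp add: norm_eq_1)
  note T = tangent_space_sphere[OF q]
  have td: "tderiv (sphere 0 1) f q v = ?D v" if "v \<bullet> q = 0" for v
    by (rule tderiv_eq[OF U(1,2) qS U(3) eq]) (use that T in auto)
  define g1 where "g1 = adjoint ?D 1"
  have g1: "g1 \<bullet> v = ?D v" for v
    unfolding g1_def using adjoint_works[OF linD, of v 1] by (simp add: inner_commute)
  define g where "g = g1 - (g1 \<bullet> q) *\<^sub>R q"
  have gq: "g \<bullet> q = 0" by (simp add: g_def inner_diff_left q)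
  have g: "g \<bullet> v = ?D v" if "v \<bullet> q = 0" for v
  proof -
    have "q \<bullet> v = 0" using that by (simp add: inner_commute)
    then show "g \<bullet> v = ?D v" by (simp add: g_def inner_diff_left g1)
  qed
  have "tgrad (sphere 0 1) f q = g"
    unfolding tgrad_def
  proof (rule the_equality)
    show "g \<in> tangent_space (sphere 0 1) q \<and>
      (\<forall>v\<in>tangent_space (sphere 0 1) q. g \<bullet> v = tderiv (sphere 0 1) f q v)"
      using gq g td by (simp add: T)
    fix k assume k: "k \<in> tangent_space (sphere 0 1) q \<and>
      (\<forall>v\<in>tangent_space (sphere 0 1) q. k \<bullet> v = tderiv (sphere 0 1) f q v)"
    have kg: "(k - g) \<bullet> q = 0" using k gq by (simp add: T inner_diff_left)
    then have "k \<bullet> (k - g) = ?D (k - g)" using k td[OF kg] by (simp add: T)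
    then have "(k - g) \<bullet> (k - g) = 0" using g[OF kg] by (simp add: inner_diff_left)
    then show "k = g" by simp
  qed
  then show "tgrad (sphere 0 1) f q \<bullet> q = 0"
    "w \<bullet> q = 0 \<Longrightarrow> frechet_derivative F (at q) w = tgrad (sphere 0 1) f q \<bullet> w"
    using gq g by simp_all
qed

lemma smooth_map_onE:
  assumes "smooth_map_on S f" "x \<in> S"
  obtains U F where "open U" "x \<in> U" "smooth_on U F" "\<And>y. y \<in> S \<Longrightarrow> y \<in> U \<Longrightarrow> F y = f y"
proof -
  have "\<exists>U F. open U \<and> x \<in> U \<and> (\<forall>k. Ck_on k U F) \<and> (\<forall>y\<in>S \<inter> U. F y = f y)"
    using assms unfolding smooth_map_on_def by (rule bspec)
  then show thesis using that unfolding smooth_on_def by (elim exE conjE) simp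
qed

lemma isoparametric_germ:
  fixes N :: "'a::euclidean_space set"
  assumes iso: "isoparametric_hypersurface N" and \<xi>: "unit_normal_field N \<xi>" and p: "p \<in> N"
  obtains U \<nu> G where "hypersurface_germ N U \<nu> G" "p \<in> U" "\<And>q. q \<in> N \<Longrightarrow> q \<in> U \<Longrightarrow> \<nu> q = \<xi> q"
proof -
  let ?S = "sphere 0 1 :: 'a set"
  obtain f :: "'a \<Rightarrow> real" and c where f: "smooth_map_on ?S f"
    and reg: "\<And>q. q \<in> ?S \<Longrightarrow> f q = c \<Longrightarrow> tgrad ?S f q \<noteq> 0" and N: "N = {q \<in> ?S. f q = c}"
    using iso unfolding isoparametric_hypersurface_def by blast
  obtain U1 F where F: "open U1" "p \<in> U1" "smooth_on U1 F" "\<And>y. y \<in> ?S \<Longrightarrow> y \<in> U1 \<Longrightarrow> F y = f y"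
    by (rule smooth_map_onE[OF f, of p]) (use p N in auto)
  have s\<xi>: "smooth_map_on N \<xi>" using \<xi> unfolding unit_normal_field_def by blast
  obtain U2 \<nu> where \<nu>: "open U2" "p \<in> U2" "smooth_on U2 \<nu>" "\<And>y. y \<in> N \<Longrightarrow> y \<in> U2 \<Longrightarrow> \<nu> y = \<xi> y"
    using smooth_map_onE[OF s\<xi> p] by metis
  define U where "U = U1 \<inter> U2"
  have U: "open U" "p \<in> U" "smooth_on U F" "smooth_on U \<nu>"
    using F \<nu> by (auto simp: U_def intro: smooth_on_subset)
  define G where "G x = F x - c" for x
  have "hypersurface_germ N U \<nu> G"
  proof
    show "open U" "smooth_on U \<nu>" by fact+
    show "smooth_on U G" unfolding G_def by (intro smooth_intros U)
    fix q assume q: "q \<in> N" "q \<in> U"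
    have qS: "q \<in> ?S" "f q = c" using q N by auto
    show qq: "q \<bullet> q = 1" using qS by (simp add: norm_eq_1)
    have \<nu>q: "\<nu> q = \<xi> q" using q \<nu>(4) by (simp add: U_def)
    show \<nu>1: "\<nu> q \<bullet> \<nu> q = 1" and \<nu>2: "\<nu> q \<bullet> q = 0"
      using \<xi> q(1) \<nu>q tangent_space_sphere[OF qq] unfolding unit_normal_field_def
      by (auto simp: norm_eq_1)
    have Fq: "F q = c" using F(4)[OF qS(1)] q(2) qS by (simp add: U_def)
    then show "G q = 0" by (simp add: G_def)
    define g where "g = tgrad ?S f q"
    have g: "g \<bullet> q = 0" "\<And>w. w \<bullet> q = 0 \<Longrightarrow> frechet_derivative F (at q) w = g \<bullet> w" "g \<noteq> 0"
      unfolding g_def using tgrad_sphere[OF U(1,3) q(2) qq, of f] F(4) reg[OF qS] by (auto simp: U_def)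
    have NU: "x \<in> N" if "x \<in> U" "x \<bullet> x = 1" "F x = c" for x
      using that F(4)[of x] N by (simp add: U_def norm_eq_1)
    have T: "tangent_space N q = {v. v \<bullet> q = 0 \<and> v \<bullet> g = 0}"
    proof (intro equalityI subsetI)
      fix v assume "v \<in> {v. v \<bullet> q = 0 \<and> v \<bullet> g = 0}"
      then have v: "v \<bullet> q = 0" "v \<bullet> g = 0" by simp_all
      show "v \<in> tangent_space N q"
        by (rule level_set_tangent[OF U(1,3) q(2) qq Fq NU g(1,3,2) v])
    next
      fix v assume v: "v \<in> tangent_space N q"
      have "N \<subseteq> ?S" unfolding N by blast
      from tangent_space_mono[OF this v] have "v \<in> tangent_space ?S q" .
      then have vq: "v \<bullet> q = 0" by (simp add: tangent_space_sphere[OF qq])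
      have "frechet_derivative F (at q) v = frechet_derivative (\<lambda>x. c) (at q) v"
        by (rule frechet_derivative_eq_tangent[OF U(1,3) smooth_on_const[OF U(1)] q _ v])
          (use F(4) N in \<open>auto simp: U_def\<close>)
      then show "v \<in> {v. v \<bullet> q = 0 \<and> v \<bullet> g = 0}" using g(2)[OF vq] vq by (simp add: inner_commute)
    qed
    define k where "k = (\<nu> q \<bullet> g) / (g \<bullet> g)"
    have gg: "g \<bullet> g \<noteq> 0" using g by simp
    \<comment> \<open>The part of \<open>\<nu> q\<close> orthogonal to the gradient is tangent to
      \<open>N\<close>, hence orthogonal to \<open>\<nu> q\<close> and so to itself.\<close>
    define w where "w = \<nu> q - k *\<^sub>R g"
    have w: "w \<bullet> q = 0" "w \<bullet> g = 0" using gg by (simp_all add: w_def inner_diff_left \<nu>2 g k_def)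
    then have "w \<in> tangent_space N q" by (simp add: T)
    then have "\<nu> q \<bullet> w = 0" using \<xi> q(1) \<nu>q unfolding unit_normal_field_def by simp
    moreover have "w \<bullet> w = w \<bullet> \<nu> q - k * (w \<bullet> g)" by (subst (2) w_def) (simp add: inner_diff_right)
    ultimately have "w \<bullet> w = 0" using w(2) by (simp add: inner_commute)
    then have \<nu>g: "\<nu> q = k *\<^sub>R g" by (simp add: w_def)
    then have k: "k \<noteq> 0" using \<nu>1 by auto
    show "tangent_space N q = {v. v \<bullet> q = 0 \<and> v \<bullet> \<nu> q = 0}"
      unfolding T \<nu>g using k by auto
    have "frechet_derivative G (at q) = frechet_derivative F (at q)"
      using has_derivative_diff[OF smooth_on_has_derivative[OF U(3) q(2)] has_derivative_const[of c]]
      unfolding G_def by (simp add: frechet_derivative_at[symmetric])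
    then have "frechet_derivative G (at q) (\<nu> q) = k * (g \<bullet> g)"
      using g(2)[OF \<nu>2] \<nu>g by simp
    then show "frechet_derivative G (at q) (\<nu> q) \<noteq> 0" using k gg by simp
  qed
  then show thesis using that U(2) \<nu>(4) by (auto simp: U_def)
qed

lemma (in hypersurface_germ) shape_operator_eq:
  assumes "\<And>q. q \<in> N \<Longrightarrow> q \<in> U \<Longrightarrow> \<nu> q = \<xi> q" and p: "p \<in> N" "p \<in> U" and v: "v \<in> T p"
  shows "shape_operator N \<xi> p v = A p v"
proof -
  have S: "tangent_space (sphere 0 1) p = {v. v \<bullet> p = 0}"
    by (rule tangent_space_sphere[OF unit(1)[OF p]])
  have "tderiv N \<xi> p v = - A p v"
    using tderiv_tdiff[OF p smooth_\<nu> assms(1), of v] by (simp add: P_id p v A_def)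
  moreover have "oproj {v. v \<bullet> p = 0} (- A p v) = - A p v"
    by (rule oproj_id) (auto simp: subspace_def inner_add_left A_orth p)
  ultimately show ?thesis by (simp add: shape_operator_def S)
qed

section \<open>The principal curvatures\<close>

text \<open>For \<open>u = cot s\<close> and \<open>v = cot t\<close> this is
  \<open>cot (t - s)\<close>. Division by zero makes \<open>cot_diff u u = 0\<close>, so the terms
  of equal curvature may stay in the sums.\<close>

definition cot_diff :: "real \<Rightarrow> real \<Rightarrow> real" where
  "cot_diff u v = (1 + u * v) / (u - v)"

lemma cot_diff_swap: "cot_diff v u = - cot_diff u v"
proof -
  have "v - u = - (u - v)" by simp
  then show ?thesis unfolding cot_diff_def by (simp only: divide_minus_right mult.commute)
qed

text \<open>The second part is the addition theorem of the cotangent in product form, valid also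
  when the cotangents add up to 0; the factorisation in the first part shows the sign of their
  sum.\<close>

lemma cot_diff_add:
  assumes "u \<noteq> v" "v \<noteq> w" "u \<noteq> w"
  shows "cot_diff u v + cot_diff v w = (u - w) * (1 + v * v) / ((u - v) * (v - w))"
    and "cot_diff u v * cot_diff v w - 1 = cot_diff u w * (cot_diff u v + cot_diff v w)"
proof -
  have nz: "u - v \<noteq> 0" "v - w \<noteq> 0" "u - w \<noteq> 0" using assms by auto
  have "cot_diff u v + cot_diff v w
      = ((1 + u * v) * (v - w) + (1 + v * w) * (u - v)) / ((u - v) * (v - w))"
    using nz by (simp add: cot_diff_def add_frac_eq)
  also have "(1 + u * v) * (v - w) + (1 + v * w) * (u - v) = (u - w) * (1 + v * v)"
    by (simp add: algebra_simps)
  finally show sum: "cot_diff u v + cot_diff v w = (u - w) * (1 + v * v) / ((u - v) * (v - w))" .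
  have "cot_diff u v * cot_diff v w - 1
      = ((1 + u * v) * (1 + v * w) - (u - v) * (v - w)) / ((u - v) * (v - w))"
    using nz by (simp add: cot_diff_def diff_divide_distrib)
  also have "(1 + u * v) * (1 + v * w) - (u - v) * (v - w) = (1 + u * w) * (1 + v * v)"
    by (simp add: algebra_simps)
  finally show "cot_diff u v * cot_diff v w - 1 = cot_diff u w * (cot_diff u v + cot_diff v w)"
    unfolding sum using nz by (simp add: cot_diff_def)
qed

text \<open>With \<open>a, b, c, d\<close> the cotangents of four angles of sum \<open>\<pi>\<close> and \<open>x\<close> the cotangent of the
  sum of the first two, this says that these two add up to a right angle.\<close>

lemma opposite_cotangents:
  fixes a b c d r x :: real
  assumes "a * b - 1 = x * (a + b)" "c * d - 1 = - x * (c + d)" "a + b > 0" "c + d > 0"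
    and "d - a = r * x" "c - b = r * x" "r > 0"
  shows "x = 0"
proof -
  have pos: "s > 0 \<and> t > 0" if "s * t > 1" "s + t > 0" for s t :: real
    using that by (smt (verit) mult_nonneg_nonpos mult_nonneg_nonpos2 mult_nonpos_nonpos)
  have less: "s' * t' < s * t" if "0 < s'" "s' < s" "0 < t'" "t' < t" for s t s' t' :: real
    using that by (intro mult_strict_mono) auto
  \<comment> \<open>A positive \<open>x\<close> gives \<open>a * b > 1 > c * d\<close>, yet the
    difference equations give \<open>d > a\<close> and \<open>c > b\<close>, hence
    \<open>c * d > a * b\<close>.\<close>
  have "\<not> x > 0"
  proof
    assume x: "x > 0"
    then have "a < d" "b < c" using assms(5,6,7) by (smt (verit) mult_pos_pos)+
    have "a * b > 1" using assms(1,3) x by (smt (verit) mult_pos_pos)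
    then have "d * c > a * b" using pos[of a b] assms(3) less[of a d b c] \<open>a < d\<close> \<open>b < c\<close> by auto
    moreover have "x * (c + d) > 0" using x assms(4) by simp
    ultimately show False using assms(2) \<open>a * b > 1\<close> by (simp add: mult.commute)
  qed
  moreover have "\<not> x < 0"
  proof
    assume x: "x < 0"
    then have "a > d" "b > c" using assms(5,6,7) by (smt (verit) mult_pos_neg)+
    have "x * (c + d) < 0" using x assms(4) by (simp add: mult_neg_pos)
    then have "c * d > 1" using assms(2) by simp
    then have "b * a > c * d" using pos[of c d] assms(4) less[of c b d a] \<open>a > d\<close> \<open>b > c\<close> by auto
    moreover have "x * (a + b) < 0" using x assms(3) by (simp add: mult_neg_pos)
    ultimately show False using assms(1) \<open>c * d > 1\<close> by (simp add: mult.commute)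
  qed
  ultimately show ?thesis by simp
qed

text \<open>Writing \<open>k\<^sub>i = cot \<theta>\<^sub>i\<close>, the conclusion says that consecutive \<open>\<theta>\<^sub>i\<close> differ by \<open>\<pi>/4\<close>.\<close>

lemma four_curvatures_quarter_turn:
  fixes k1 k2 k3 k4 m1 m2 :: real
  assumes ord: "k1 > k2" "k2 > k3" "k3 > k4" and m: "m1 > 0" "m2 > 0"
    and e1: "m2 * cot_diff k1 k2 + m1 * cot_diff k1 k3 + m2 * cot_diff k1 k4 = 0"
    and e2: "m1 * cot_diff k2 k1 + m1 * cot_diff k2 k3 + m2 * cot_diff k2 k4 = 0"
    and e3: "m1 * cot_diff k3 k1 + m2 * cot_diff k3 k2 + m2 * cot_diff k3 k4 = 0"
    and e4: "m1 * cot_diff k4 k1 + m2 * cot_diff k4 k2 + m1 * cot_diff k4 k3 = 0"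
  shows "k1 * k3 = -1" "k2 * k4 = -1" "1 + k1 * k2 = k1 - k2"
proof -
  \<comment> \<open>The cotangents of the four consecutive gaps between the angles modulo pi, which
    add up to pi; \<open>x\<close> and \<open>y\<close> belong to sums of two adjacent gaps.\<close>
  define a b c d where "a = cot_diff k1 k2" and "b = cot_diff k2 k3" and "c = cot_diff k3 k4"
    and "d = cot_diff k4 k1"
  define x y where "x = cot_diff k1 k3" and "y = cot_diff k2 k4"
  note defs = a_def b_def c_def d_def x_def y_def
  have sw: "cot_diff k2 k1 = - a" "cot_diff k3 k2 = - b" "cot_diff k4 k3 = - c"
    "cot_diff k1 k4 = - d" "cot_diff k3 k1 = - x" "cot_diff k4 k2 = - y"
    unfolding defs by (rule cot_diff_swap)+
  have sq: "1 + t * t > 0" for t :: real by (smt (verit) zero_le_square)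
  have pos: "a + b > 0" "b + c > 0" "c + d > 0" "d + a > 0"
    unfolding defs using ord sq
    by (auto simp: cot_diff_add zero_less_divide_iff zero_less_mult_iff mult_less_0_iff)
  have rel: "a * b - 1 = x * (a + b)" "b * c - 1 = y * (b + c)" "c * d - 1 = - x * (c + d)"
    "d * a - 1 = - y * (d + a)"
    using cot_diff_add(2)[of k1 k2 k3] cot_diff_add(2)[of k2 k3 k4] cot_diff_add(2)[of k3 k4 k1]
      cot_diff_add(2)[of k4 k1 k2] ord unfolding sw defs[symmetric] by auto
  have E1: "m2 * (d - a) = m1 * x" and E3: "m2 * (c - b) = m1 * x"
    and E2: "m1 * (a - b) = m2 * y" and E4: "m1 * (d - c) = m2 * y"
    using e1 e2 e3 e4 unfolding sw defs[symmetric] by (simp_all add: algebra_simps)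
  have x0: "x = 0"
  proof (rule opposite_cotangents[OF rel(1,3) pos(1,3)])
    show "d - a = m1 / m2 * x" "c - b = m1 / m2 * x" "m1 / m2 > 0"
      using E1 E3 m by (simp_all add: field_simps)
  qed
  have y0: "y = 0"
  proof (rule opposite_cotangents[OF rel(2,4) pos(2,4)])
    show "a - b = m2 / m1 * y" "d - c = m2 / m1 * y" "m2 / m1 > 0"
      using E2 E4 m by (simp_all add: field_simps)
  qed
  show "k1 * k3 = -1" "k2 * k4 = -1" using x0 y0 ord by (auto simp: x_def y_def cot_diff_def)
  \<comment> \<open>The first two gaps are equal and form a right angle, so each is a quarter of pi,
    with cotangent 1.\<close>
  have "a = b" using E2 y0 m by simp
  then have "a * a = 1" "a > 0" using rel(1) x0 pos(1) by simp_all
  then have "a = 1" by (metis less_asym' mult_minus_left neg_equal_iff_equal one_neq_neg_one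
        square_eq_1_iff zero_less_one neg_0_less_iff_less)
  then show "1 + k1 * k2 = k1 - k2" using ord by (simp add: a_def cot_diff_def)
qed

text \<open>With \<open>k = cot t\<close> the relation between \<open>k\<close> and \<open>l\<close>
  means \<open>l = cot (pi/4 - t)\<close>, so \<open>k - 1 / k\<close> is twice the cotangent of
  \<open>2t\<close> and \<open>l - 1 / l\<close> twice its tangent. Minimality says that the squared
  cotangent of \<open>2t\<close> is \<open>m2 / m1\<close>.\<close>

lemma minimal_quarter_turn:
  fixes k l m1 m2 :: real
  assumes k: "k > 1" "l > 1" "k * l = k + l + 1" and min: "m1 * (k - 1 / k) = m2 * (l - 1 / l)"
  shows "m1 * (k\<^sup>2 - 1)\<^sup>2 = 4 * m2 * k\<^sup>2"
proof -
  have l: "l * (k - 1) = k + 1" using k(3) by (simp add: algebra_simps)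
  then have l': "l = (k + 1) / (k - 1)" using k by (simp add: field_simps)
  have nz: "k \<noteq> 0" "k - 1 \<noteq> 0" "k + 1 \<noteq> 0" using k by auto
  have lk: "l - 1 / l = 4 * k / (k\<^sup>2 - 1)"
  proof -
    have "l - 1 / l = ((k + 1) * (k + 1) - (k - 1) * (k - 1)) / ((k - 1) * (k + 1))"
      unfolding l' using nz by (simp add: diff_frac_eq)
    also have "(k + 1) * (k + 1) - (k - 1) * (k - 1) = 4 * k" by (simp add: algebra_simps)
    also have "(k - 1) * (k + 1) = k\<^sup>2 - 1" by (simp add: algebra_simps power2_eq_square)
    finally show ?thesis .
  qed
  have kk: "k - 1 / k = (k\<^sup>2 - 1) / k" using nz by (simp add: field_simps power2_eq_square)
  have k2: "k\<^sup>2 - 1 \<noteq> 0" using k(1) by (smt (verit) one_less_power pos2)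
  have "m1 * ((k\<^sup>2 - 1) / k) = m2 * (4 * k / (k\<^sup>2 - 1))" using min unfolding lk kk .
  then have "m1 * ((k\<^sup>2 - 1) * (k\<^sup>2 - 1)) = m2 * (4 * k * k)"
    using nz k2 by (simp add: field_simps)
  then show ?thesis by (simp add: power2_eq_square mult_ac)
qed

text \<open>With \<open>s = k\<^sup>2 - 1\<close> and \<open>c = 4 * m2 / m1\<close> the equation
  becomes \<open>s = c + c / s\<close>. Hence \<open>s > c\<close>, therefore
  \<open>c / s < 1\<close> and \<open>s < c + 1\<close>, without extracting square roots.\<close>

lemma minimal_quarter_turn_bounds:
  fixes k m1 m2 :: real
  assumes k: "k > 1" and m: "m1 > 0" "m2 > 0" and eq: "m1 * (k\<^sup>2 - 1)\<^sup>2 = 4 * m2 * k\<^sup>2"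
  shows "m1 + 4 * m2 < m1 * k\<^sup>2" "m1 * k\<^sup>2 < 2 * m1 + 4 * m2"
proof -
  define s where "s = k\<^sup>2 - 1"
  have s: "s > 0" using k by (simp add: s_def one_less_power)
  have eq': "m1 * (s * s) = 4 * m2 * (s + 1)" using eq by (simp add: s_def power2_eq_square[of "k\<^sup>2 - 1"])
  then have e: "s * (m1 * s - 4 * m2) = 4 * m2" by (simp add: algebra_simps)
  then have "s * (m1 * s - 4 * m2) > 0" using m by simp
  then have 1: "m1 * s - 4 * m2 > 0" using s by (simp add: zero_less_mult_iff)
  show "m1 + 4 * m2 < m1 * k\<^sup>2" using 1 by (simp add: s_def algebra_simps)
  show "m1 * k\<^sup>2 < 2 * m1 + 4 * m2"
  proof (rule ccontr)
    assume "\<not> ?thesis"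
    then have ge: "m1 * s - 4 * m2 \<ge> m1" by (simp add: s_def algebra_simps)
    then have "s * m1 \<le> s * (m1 * s - 4 * m2)" using s by (intro mult_left_mono) auto
    then have "s * m1 \<le> 4 * m2" using e by simp
    then show False using ge m by (simp add: mult.commute)
  qed
qed

section \<open>The quadratic estimate behind the positivity of Delta\<close>

lemma mult_minus_square_le: "s * d - s\<^sup>2 \<le> d\<^sup>2 / 4" for s d :: real
proof -
  have "4 * (s * d - s\<^sup>2) \<le> d\<^sup>2"
    using zero_le_power2[of "2 * s - d"] by (simp add: algebra_simps power2_eq_square)
  then show ?thesis by simp
qed

text \<open>The left-hand side is affine in \<open>x\<close> and concave in \<open>y\<close>, with value \<open>4k\<^sup>2\<close> at \<open>x = y = k\<close>.
  This is its maximum if \<open>k \<ge> 2l\<close>; otherwise \<open>k\<close> is small.\<close>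

lemma ACS_upper_bound:
  fixes k l x y m1 m2 :: real
  assumes k: "l \<le> k" "l > 1" "k * l = k + l + 1" and m: "m1 \<ge> 4" "m2 \<ge> 4"
    and b: "m1 * k\<^sup>2 < 2 * m1 + 4 * m2"
    and x: "- l \<le> x" "x \<le> k" and y: "- l \<le> y" "y \<le> k"
  shows "2 * (k - l) * (x + y) + 4 * k * l + x * y - y\<^sup>2 < 4 * (m1 + m2) - 4"
proof -
  have k1: "k > 1" using k by simp
  have "m1 * k\<^sup>2 < m1 * (2 + m2)"
  proof -
    have "4 * m2 \<le> m1 * m2" using m by simp
    then show ?thesis using b by (simp add: algebra_simps)
  qed
  then have k2: "k\<^sup>2 < 2 + m2" using m by simp
  \<comment> \<open>An excess of up to 4 is affordable: \<open>k\<^sup>2 < 2 + m2\<close> and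
    \<open>m1 \<ge> 4\<close> give
    \<open>4 * k\<^sup>2 + 4 < 4 * m2 + 12 \<le> 4 * (m1 + m2) - 4\<close>.\<close>
  have goalI: ?thesis if "2 * (k - l) * (x + y) + 4 * k * l + x * y - y\<^sup>2 \<le> 4 * k\<^sup>2 + h" "h \<le> 4" for h
    by (rule le_less_trans[OF that(1)]) (use that(2) k2 m in \<open>simp add: distrib_left\<close>)
  \<comment> \<open>Since \<open>l * (k - 1) = k + 1\<close>, a large \<open>k\<close> forces
    \<open>l\<close> close to 1; so \<open>k < 2 * l\<close> bounds \<open>k\<close>.\<close>
  have small: "k\<^sup>2 \<le> 16" if "k < 2 * l"
  proof -
    have "k * (k - 1) < 2 * l * (k - 1)" using that k1 by simp
    also have "\<dots> = 2 * (k + 1)" using k(3) by (simp add: algebra_simps)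
    finally have "k * (k - 3) < 2" by (simp add: algebra_simps)
    have "k \<le> 4"
    proof (rule ccontr)
      assume "\<not> k \<le> 4"
      then have "4 * 1 \<le> k * (k - 3)" by (intro mult_mono) auto
      then show False using \<open>k * (k - 3) < 2\<close> by simp
    qed
    then show ?thesis using k1 power_mono[of k 4 2] by simp
  qed
  show ?thesis
  \<comment> \<open>This is the coefficient of \<open>x\<close>; its sign decides whether
    \<open>x = k\<close> or \<open>x = - l\<close> is the worst case.\<close>
  proof (cases "2 * (k - l) + y \<ge> 0")
    case True
    have "(2 * (k - l) + y) * x \<le> (2 * (k - l) + y) * k" using x True by (intro mult_left_mono)
    then have 1: "2 * (k - l) * (x + y) + 4 * k * l + x * y - y\<^sup>2
        \<le> 4 * k\<^sup>2 + ((k - y) * (2 * l - k) - (k - y)\<^sup>2)"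
      by (simp add: algebra_simps power2_eq_square)
    show ?thesis
    proof (cases "k < 2 * l")
      case True
      have "(k - y) * (2 * l - k) - (k - y)\<^sup>2 \<le> (2 * l - k)\<^sup>2 / 4"
        by (rule mult_minus_square_le)
      also have "\<dots> \<le> k\<^sup>2 / 4" using True k by (intro divide_right_mono power_mono) auto
      also have "\<dots> \<le> 4" using small[OF True] by simp
      finally show ?thesis by (rule goalI[OF 1])
    next
      case False
      have "(k - y) * (2 * l - k) \<le> 0" using False y by (intro mult_nonneg_nonpos) auto
      then show ?thesis by (intro goalI[OF 1]) (smt (verit) zero_le_power2)
    qed
  next
    case False
    then have kl: "k < 2 * l" using y k by simp
    have "(2 * (k - l) + y) * x \<le> (2 * (k - l) + y) * (- l)" using x False by (intro mult_left_mono_neg) auto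
    then have 1: "2 * (k - l) * (x + y) + 4 * k * l + x * y - y\<^sup>2
        \<le> 2 * k * l + 2 * l\<^sup>2 + ((- y) * (3 * l - 2 * k) - y\<^sup>2)"
      by (simp add: algebra_simps power2_eq_square)
    have "(- y) * (3 * l - 2 * k) - y\<^sup>2 \<le> (3 * l - 2 * k)\<^sup>2 / 4"
      using mult_minus_square_le[of "- y" "3 * l - 2 * k"] by simp
    also have "\<dots> \<le> k\<^sup>2 / 4"
      using False y k by (intro divide_right_mono power_mono) auto
    finally have 2: "(- y) * (3 * l - 2 * k) - y\<^sup>2 \<le> k\<^sup>2 / 4" .
    have "k * l \<le> k\<^sup>2"
      unfolding power2_eq_square by (rule mult_left_mono) (use k(1) k1 in simp_all)
    moreover have "l\<^sup>2 \<le> k\<^sup>2" by (rule power_mono) (use k(1,2) in simp_all)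
    ultimately have "2 * (k - l) * (x + y) + 4 * k * l + x * y - y\<^sup>2 \<le> 4 * k\<^sup>2 + k\<^sup>2 / 4"
      using order_trans[OF 1 add_left_mono[OF 2]] by simp
    then show ?thesis by (rule goalI) (use small[OF kl] in simp)
  qed
qed

text \<open>Reversing the unit normal exchanges \<open>k\<close> with \<open>l\<close> and
  \<open>m1\<close> with \<open>m2\<close> and changes the signs of \<open>x\<close> and
  \<open>y\<close>, leaving the expression unchanged; so the larger of \<open>k\<close> and
  \<open>l\<close> may take the role of \<open>k\<close>.\<close>

lemma ACS_upper_bound_symmetric:
  fixes k l x y m1 m2 :: real
  assumes k: "k > 1" "l > 1" "k * l = k + l + 1" and m: "m1 \<ge> 4" "m2 \<ge> 4"
    and b: "m1 * k\<^sup>2 < 2 * m1 + 4 * m2" "m2 * l\<^sup>2 < 2 * m2 + 4 * m1"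
    and x: "- l \<le> x" "x \<le> k" and y: "- l \<le> y" "y \<le> k"
  shows "2 * (k - l) * (x + y) + 4 * k * l + x * y - y\<^sup>2 < 4 * (m1 + m2) - 4"
proof (cases "l \<le> k")
  case True
  then show ?thesis using ACS_upper_bound[OF True k(2,3) m b(1) x y] by simp
next
  case False
  have "2 * (l - k) * (- x + - y) + 4 * l * k + (- x) * (- y) - (- y)\<^sup>2 < 4 * (m2 + m1) - 4"
    by (rule ACS_upper_bound[OF _ k(1) _ m(2,1) b(2)]) (use False k x y in \<open>auto simp: mult.commute\<close>)
  then show ?thesis by (simp add: algebra_simps)
qed

section \<open>The operator Delta of a minimal isoparametric hypersurface\<close>

context hypersurface_germ
begin

context
  fixes p B assumes p: "p \<in> N" "p \<in> U" and B: "onb (T p) B" and trace0: "(\<Sum>e\<in>B. A p e \<bullet> e) = 0"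
begin

lemma onb_trace_zero: "onb (T p) C \<Longrightarrow> (\<Sum>e\<in>C. A p e \<bullet> e) = 0"
  using onb_trace[OF B _ linear_A[OF p(2)], of C] trace0 by simp

lemma sum_curvature:
  assumes u: "u \<in> T p" and C: "onb (T p) C"
  shows "(\<Sum>e\<in>C. curvature N p e u e u) = (real (card B) - 1) * (u \<bullet> u) - A p u \<bullet> A p u"
proof -
  have "curvature N p e u e u
      = u \<bullet> u - (u \<bullet> e) * (u \<bullet> e) + (A p u \<bullet> u) * (A p e \<bullet> e) - (A p u \<bullet> e) * (A p u \<bullet> e)"
    if "e \<in> C" for e
    using that onb_subset[OF C] curvature_eq[OF p _ u u, of e e] A_sym[OF p, of e u] onb_inner[OF C that that]
    by (auto simp: inner_commute)
  then have "(\<Sum>e\<in>C. curvature N p e u e u) = real (card C) * (u \<bullet> u) - (\<Sum>e\<in>C. (u \<bullet> e) * (u \<bullet> e))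
      + (A p u \<bullet> u) * (\<Sum>e\<in>C. A p e \<bullet> e) - (\<Sum>e\<in>C. (A p u \<bullet> e) * (A p u \<bullet> e))"
    by (simp add: sum.distrib sum_subtractf sum_distrib_left)
  then show ?thesis
    using onb_card[OF B] onb_card[OF C]
    by (simp add: onb_trace_zero C onb_parseval[OF C] u A_tangent p left_diff_distrib)
qed

lemma ricci_eq: "u \<in> T p \<Longrightarrow> ricci N p u u = (real (card B) - 1) * (u \<bullet> u) - A p u \<bullet> A p u"
  unfolding ricci_def by (rule sum_curvature[OF _ onb_onb_of[OF subspace_T[OF p]]])

lemma ACS_Delta_eq:
  assumes X: "X \<in> T p" "norm X = 1" and v: "v \<in> T p" "norm v = 1" and Xv: "X \<bullet> v = 0"
  shows "ACS_Delta N p X v = 2 * real (card B) - 4 - 2 * (A p X \<bullet> A p X) - 2 * (A p v \<bullet> A p v)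
    - (A p X \<bullet> X) * (A p v \<bullet> v) + 2 * (A p X \<bullet> v)\<^sup>2 + (A p v \<bullet> v)\<^sup>2"
proof -
  let ?W = "{u \<in> T p. u \<bullet> v = 0}"
  have XX: "X \<bullet> X = 1" "v \<bullet> v = 1" "v \<bullet> X = 0" using X v Xv by (auto simp: norm_eq_1 inner_commute)
  have "subspace ?W"
    using subspace_T[OF p] by (auto simp: subspace_def inner_add_left)
  then have W: "onb ?W (onb_of ?W)" by (rule onb_onb_of)
  note ins = onb_insert[OF W subspace_T[OF p] v]
  have WT: "e \<in> T p" if "e \<in> onb_of ?W" for e using onb_subset[OF W] that by blast
  have split: "(\<Sum>e\<in>onb_of ?W. h e) = (\<Sum>e\<in>insert v (onb_of ?W). h e) - h v" for h :: "'a \<Rightarrow> real"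
    using ins(2) onb_finite[OF W] by simp
  have 1: "(\<Sum>e\<in>onb_of ?W. curvature N p e X e X) = (real (card B) - 1) - A p X \<bullet> A p X
      - (1 + (A p X \<bullet> X) * (A p v \<bullet> v) - (A p X \<bullet> v)\<^sup>2)"
    unfolding split sum_curvature[OF X(1) ins(1)] curvature_eq[OF p v(1) X(1) X(1)]
    using A_sym[OF p, of v X] by (simp add: XX Xv inner_commute power2_eq_square)
  have ff: "(\<Sum>e\<in>onb_of ?W. (norm (second_ff N p e u))\<^sup>2)
      = A p u \<bullet> A p u + u \<bullet> u - ((A p u \<bullet> v)\<^sup>2 + (u \<bullet> v)\<^sup>2)" if u: "u \<in> T p" for u
  proof -
    have "(norm (second_ff N p e u))\<^sup>2 = (A p u \<bullet> e) * (A p u \<bullet> e) + (u \<bullet> e) * (u \<bullet> e)"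
      if "e \<in> onb_of ?W" for e
      using norm_second_ff[OF p WT[OF that] u] A_sym[OF p, of e u]
      by (simp add: inner_commute power2_eq_square)
    then have "(\<Sum>e\<in>onb_of ?W. (norm (second_ff N p e u))\<^sup>2)
        = (\<Sum>e\<in>onb_of ?W. (A p u \<bullet> e) * (A p u \<bullet> e) + (u \<bullet> e) * (u \<bullet> e))"
      by (rule sum.cong[OF refl])
    then show ?thesis
      unfolding split sum.distrib onb_parseval[OF ins(1) A_tangent[OF p]] onb_parseval[OF ins(1) u]
      by (simp add: power2_eq_square)
  qed
  \<comment> \<open>The curvature sum and the Ricci curvature contribute \<open>card B - 1\<close>
    each; the plane of \<open>X\<close> and \<open>v\<close> costs 1, and the position vector part
    of the second fundamental form costs 1 for \<open>X\<close> and 0 for \<open>v\<close>.\<close>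
  have "ACS_Delta N p X v = (\<Sum>e\<in>onb_of ?W. curvature N p e X e X) + ricci N p v v
      - (\<Sum>e\<in>onb_of ?W. (norm (second_ff N p e X))\<^sup>2) - (\<Sum>e\<in>onb_of ?W. (norm (second_ff N p e v))\<^sup>2)"
    by (simp add: ACS_Delta_def Let_def X(2))
  then show ?thesis
    unfolding 1 ricci_eq[OF v(1)] ff[OF X(1)] ff[OF v(1)] by (simp add: XX Xv)
qed

text \<open>Adding \<open>\<nu> p\<close> and \<open>p\<close> completes the basis to one of the
  ambient space. Through its dimension the number of principal vectors is the same at all
  points.\<close>

lemma card_onb: "card B + 2 = DIM('a)"
proof -
  have B': "onb {u \<in> {v. v \<bullet> p = 0}. u \<bullet> \<nu> p = 0} B" using B by (simp add: tangent[OF p])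
  have Vp: "subspace {v. v \<bullet> p = 0}" by (auto simp: subspace_def inner_add_left)
  have \<nu>1: "\<nu> p \<in> {v. v \<bullet> p = 0}" "norm (\<nu> p) = 1" "norm p = 1"
    using unit[OF p] by (auto simp: norm_eq_1)
  note i1 = onb_insert[OF B' Vp \<nu>1(1,2)]
  have "onb {u \<in> UNIV. u \<bullet> p = 0} (insert (\<nu> p) B)" using i1(1) by simp
  note i2 = onb_insert[OF this subspace_UNIV UNIV_I \<nu>1(3)]
  have "card (insert p (insert (\<nu> p) B)) = DIM('a)" using onb_card[OF i2(1)] by simp
  then show ?thesis using i1(2) i2(2) onb_finite[OF B] by simp
qed

end

end

text \<open>The geometry at one point reduced to linear algebra: the local extensions and all
  derivatives are hidden, and \<open>S\<close> stands for the shape operator. Sums run over the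
  frame, so multiplicities enter by counting.\<close>

locale principal_frame =
  fixes N :: "'a::euclidean_space set" and \<xi> :: "'a \<Rightarrow> 'a" and p :: 'a and K :: "real set"
    and S :: "'a \<Rightarrow> 'a" and B :: "'a set" and \<kappa> :: "'a \<Rightarrow> real"
  assumes S_sym: "S u \<bullet> v = u \<bullet> S v" and S_tangent: "S u \<in> tangent_space N p"
    and frame: "onb (tangent_space N p) B" and card_frame: "card B + 2 = DIM('a)"
    and S_frame: "b \<in> B \<Longrightarrow> S b = \<kappa> b *\<^sub>R b" and curvatures: "\<kappa> ` B \<subseteq> K"
    and multiplicity: "k \<in> K \<Longrightarrow> card {b \<in> B. \<kappa> b = k} = dim (curvature_space N \<xi> p k)"
    and trace: "(\<Sum>b\<in>B. \<kappa> b) = 0"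
    and Cartan: "e \<in> B \<Longrightarrow> (\<Sum>f\<in>B. cot_diff (\<kappa> e) (\<kappa> f)) = 0"
    and Ricci: "u \<in> tangent_space N p \<Longrightarrow>
      ricci N p u u = (real (card B) - 1) * (u \<bullet> u) - S u \<bullet> S u"
    and Delta: "X \<in> tangent_space N p \<Longrightarrow> norm X = 1 \<Longrightarrow> v \<in> tangent_space N p \<Longrightarrow> norm v = 1 \<Longrightarrow>
      X \<bullet> v = 0 \<Longrightarrow> ACS_Delta N p X v = 2 * real (card B) - 4 - 2 * (S X \<bullet> S X) - 2 * (S v \<bullet> S v)
        - (S X \<bullet> X) * (S v \<bullet> v) + 2 * (S X \<bullet> v)\<^sup>2 + (S v \<bullet> v)\<^sup>2"

lemma isoparametric_principal_frame:
  fixes N :: "'a::euclidean_space set"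
  assumes N: "isoparametric_hypersurface N" "unit_normal_field N \<xi>" "minimal_hypersurface N \<xi>"
    and K: "finite K" "\<And>q. q \<in> N \<Longrightarrow> principal_curvatures N \<xi> q \<subseteq> K" and p: "p \<in> N"
  obtains S B \<kappa> where "principal_frame N \<xi> p K S B \<kappa>"
proof -
  obtain U \<nu> G where germ: "hypersurface_germ N U \<nu> G" and pU: "p \<in> U"
    and \<nu>\<xi>: "\<And>q. q \<in> N \<Longrightarrow> q \<in> U \<Longrightarrow> \<nu> q = \<xi> q"
    using isoparametric_germ[OF N(1,2) p] by metis
  interpret hypersurface_germ N U \<nu> G by (rule germ)
  note pp = p pU
  have cs: "curvature_space N \<xi> q k = {v \<in> T q. A q v = k *\<^sub>R v}" if "q \<in> N" "q \<in> U" for q k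
    unfolding curvature_space_def using shape_operator_eq[OF \<nu>\<xi> that] by (intro Collect_cong) (metis)
  have KK: "k \<in> K" if "q \<in> N" "q \<in> U" "v \<in> T q" "v \<noteq> 0" "A q v = k *\<^sub>R v" for q v k
  proof -
    have "v \<in> curvature_space N \<xi> q k" using that by (simp add: cs)
    then have "k \<in> principal_curvatures N \<xi> q" using that(4) unfolding principal_curvatures_def by blast
    then show ?thesis using K(2)[OF that(1)] by blast
  qed
  have AT: "A q ` T q \<subseteq> T q" if "q \<in> N" "q \<in> U" for q using A_tangent[OF that] by blast
  have diag: "diagonalisable K"
    unfolding diagonalisable_def
  proof (intro conjI ballI K(1))
    fix q assume "q \<in> N \<inter> U"
    then have q: "q \<in> N" "q \<in> U" by auto
    show "T q \<subseteq> span (\<Union>\<kappa>\<in>K. {v \<in> T q. A q v = \<kappa> *\<^sub>R v})"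
      using self_adjoint_span_eigenvectors[OF subspace_T[OF q] linear_A[OF q(2)] AT[OF q]
          A_sym[OF q] KK[OF q]] by simp
  qed
  have "\<exists>B. onb (T p) B \<and> (\<forall>b\<in>B. \<exists>\<kappa>\<in>K. A p b = \<kappa> *\<^sub>R b) \<and>
      (\<forall>\<kappa>\<in>K. card {b \<in> B. A p b = \<kappa> *\<^sub>R b} = dim {v \<in> T p. A p v = \<kappa> *\<^sub>R v})"
    by (rule self_adjoint_onb[OF subspace_T[OF pp] linear_A[OF pU] AT[OF pp] A_sym[OF pp]],
        erule (2) KK[OF pp], intro exI conjI ballI, assumption, simp, simp)
  then obtain B where B: "onb (T p) B" "\<And>b. b \<in> B \<Longrightarrow> \<exists>\<kappa>\<in>K. A p b = \<kappa> *\<^sub>R b"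
    "\<And>\<kappa>. \<kappa> \<in> K \<Longrightarrow> card {b \<in> B. A p b = \<kappa> *\<^sub>R b} = dim {v \<in> T p. A p v = \<kappa> *\<^sub>R v}"
    by blast
  define \<kappa> where "\<kappa> b = A p b \<bullet> b" for b
  have bb: "b \<bullet> b = 1" if "b \<in> B" for b using onb_inner[OF B(1) that that] by simp
  have \<kappa>: "A p b = \<kappa> b *\<^sub>R b" "\<kappa> b \<in> K" "A p b = k *\<^sub>R b \<longleftrightarrow> \<kappa> b = k" if "b \<in> B" for b k
  proof -
    obtain k' where k': "k' \<in> K" "A p b = k' *\<^sub>R b" using B(2) \<open>b \<in> B\<close> by blast
    have "\<kappa> b = k'" using bb[OF that] by (simp add: \<kappa>_def k'(2))
    then show "A p b = \<kappa> b *\<^sub>R b" "\<kappa> b \<in> K" "A p b = k *\<^sub>R b \<longleftrightarrow> \<kappa> b = k"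
      using k' bb[OF that] by auto
  qed
  have "trace_on (T p) (shape_operator N \<xi> p) = 0"
    using N(3) p unfolding minimal_hypersurface_def by blast
  moreover have "trace_on (T p) (shape_operator N \<xi> p) = (\<Sum>e\<in>onb_of (T p). A p e \<bullet> e)"
    unfolding trace_on_def
    using shape_operator_eq[OF \<nu>\<xi> pp] onb_subset[OF onb_onb_of[OF subspace_T[OF pp]]]
    by (intro sum.cong refl) (simp add: subset_iff)
  ultimately have tr: "(\<Sum>e\<in>B. A p e \<bullet> e) = 0"
    using onb_trace[OF B(1) onb_onb_of[OF subspace_T[OF pp]] linear_A[OF pU]] by simp
  show thesis
  proof (rule that, unfold_locales)
    show "A p u \<bullet> v = u \<bullet> A p v" for u v by (rule A_sym[OF pp])
    show "A p u \<in> T p" for u by (rule A_tangent[OF pp])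
    show "onb (T p) B" by fact
    show "card B + 2 = DIM('a)" by (rule card_onb[OF pp B(1) tr])
    show "A p b = \<kappa> b *\<^sub>R b" if "b \<in> B" for b by (rule \<kappa>(1)[OF that])
    show "\<kappa> ` B \<subseteq> K" using \<kappa>(2) by blast
    show "card {b \<in> B. \<kappa> b = k} = dim (curvature_space N \<xi> p k)" if "k \<in> K" for k
    proof -
      have "{b \<in> B. \<kappa> b = k} = {b \<in> B. A p b = k *\<^sub>R b}" using \<kappa>(3) by blast
      then show ?thesis using B(3)[OF that] by (simp add: cs pp)
    qed
    show "(\<Sum>b\<in>B. \<kappa> b) = 0" using tr by (simp add: \<kappa>_def)
    show "(\<Sum>f\<in>B. cot_diff (\<kappa> e) (\<kappa> f)) = 0" if "e \<in> B" for e
      unfolding cot_diff_def by (rule Cartan_identity[OF diag pp B(1) \<kappa>(1) that])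
    show "ricci N p u u = (real (card B) - 1) * (u \<bullet> u) - A p u \<bullet> A p u" if "u \<in> T p" for u
      by (rule ricci_eq[OF pp B(1) tr that])
    show "ACS_Delta N p X v = 2 * real (card B) - 4 - 2 * (A p X \<bullet> A p X) - 2 * (A p v \<bullet> A p v)
        - (A p X \<bullet> X) * (A p v \<bullet> v) + 2 * (A p X \<bullet> v)\<^sup>2 + (A p v \<bullet> v)\<^sup>2"
      if "X \<in> T p" "norm X = 1" "v \<in> T p" "norm v = 1" "X \<bullet> v = 0" for X v
      by (rule ACS_Delta_eq[OF pp B(1) tr that])
  qed
qed

text \<open>All curvatures lie between \<open>- l\<close> and \<open>k\<close>, so
  \<open>(k - S) (S + l)\<close> is a nonnegative operator; evaluating it on \<open>X\<close> bounds
  the norm of \<open>S X\<close> through the diagonal value \<open>S X \<bullet> X\<close>.\<close>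

lemma (in principal_frame) quadratic_bounds:
  assumes range: "\<And>t. t \<in> K \<Longrightarrow> - l \<le> t \<and> t \<le> k" and X: "X \<in> tangent_space N p" "norm X = 1"
  shows "S X \<bullet> S X \<le> (k - l) * (S X \<bullet> X) + k * l" "- l \<le> S X \<bullet> X" "S X \<bullet> X \<le> k"
proof -
  have rB: "- l \<le> \<kappa> b \<and> \<kappa> b \<le> k" if "b \<in> B" for b using curvatures that by (intro range) blast
  have Sb: "S X \<bullet> b = \<kappa> b * (X \<bullet> b)" if "b \<in> B" for b using S_sym[of X b] S_frame[OF that] by simp
  have 0: "(\<Sum>b\<in>B. (X \<bullet> b) * (X \<bullet> b)) = 1"
    using onb_parseval[OF frame X(1), of X] X(2) by (simp add: norm_eq_1)
  have "(\<Sum>b\<in>B. \<kappa> b * ((X \<bullet> b) * (X \<bullet> b))) = (\<Sum>b\<in>B. (S X \<bullet> b) * (X \<bullet> b))"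
    by (intro sum.cong refl) (simp add: Sb)
  then have 1: "(\<Sum>b\<in>B. \<kappa> b * ((X \<bullet> b) * (X \<bullet> b))) = S X \<bullet> X"
    using onb_parseval[OF frame S_tangent, of X X] by simp
  have "(\<Sum>b\<in>B. \<kappa> b * \<kappa> b * ((X \<bullet> b) * (X \<bullet> b))) = (\<Sum>b\<in>B. (S X \<bullet> b) * (S X \<bullet> b))"
    by (intro sum.cong refl) (simp add: Sb)
  then have 2: "(\<Sum>b\<in>B. \<kappa> b * \<kappa> b * ((X \<bullet> b) * (X \<bullet> b))) = S X \<bullet> S X"
    using onb_parseval[OF frame S_tangent, of X "S X"] by simp
  have "0 \<le> (\<Sum>b\<in>B. (k - \<kappa> b) * (\<kappa> b + l) * ((X \<bullet> b) * (X \<bullet> b)))"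
    by (intro sum_nonneg mult_nonneg_nonneg[OF mult_nonneg_nonneg zero_le_square]) (use rB in force)+
  also have "\<dots> = (k - l) * (\<Sum>b\<in>B. \<kappa> b * ((X \<bullet> b) * (X \<bullet> b))) + k * l * (\<Sum>b\<in>B. (X \<bullet> b) * (X \<bullet> b))
      - (\<Sum>b\<in>B. \<kappa> b * \<kappa> b * ((X \<bullet> b) * (X \<bullet> b)))"
    unfolding sum_distrib_left sum.distrib[symmetric] sum_subtractf[symmetric]
    by (intro sum.cong refl) (simp add: algebra_simps)
  finally show "S X \<bullet> S X \<le> (k - l) * (S X \<bullet> X) + k * l" unfolding 0 1 2 by simp
  have "0 \<le> (\<Sum>b\<in>B. (\<kappa> b + l) * ((X \<bullet> b) * (X \<bullet> b)))"
    by (intro sum_nonneg mult_nonneg_nonneg[OF _ zero_le_square]) (use rB in force)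
  also have "\<dots> = S X \<bullet> X + l"
    unfolding distrib_right sum.distrib 1 sum_distrib_left[symmetric] 0 by simp
  finally show "- l \<le> S X \<bullet> X" by simp
  have "0 \<le> (\<Sum>b\<in>B. (k - \<kappa> b) * ((X \<bullet> b) * (X \<bullet> b)))"
    by (intro sum_nonneg mult_nonneg_nonneg[OF _ zero_le_square]) (use rB in force)
  also have "\<dots> = k - S X \<bullet> X"
    unfolding left_diff_distrib sum_subtractf 1 sum_distrib_left[symmetric] 0 by simp
  finally show "S X \<bullet> X \<le> k" by simp
qed

lemma sum_four_values:
  fixes \<phi> :: "real \<Rightarrow> real"
  assumes "finite B" "\<kappa> ` B \<subseteq> {k1, k2, k3, k4}" "k1 > k2" "k2 > k3" "k3 > k4"
  shows "(\<Sum>b\<in>B. \<phi> (\<kappa> b)) = real (card {b \<in> B. \<kappa> b = k1}) * \<phi> k1 + real (card {b \<in> B. \<kappa> b = k2}) * \<phi> k2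
    + real (card {b \<in> B. \<kappa> b = k3}) * \<phi> k3 + real (card {b \<in> B. \<kappa> b = k4}) * \<phi> k4"
proof -
  have "(\<Sum>b\<in>B. \<phi> (\<kappa> b)) = (\<Sum>k\<in>{k1, k2, k3, k4}. \<Sum>b\<in>{b \<in> B. \<kappa> b = k}. \<phi> (\<kappa> b))"
    by (rule sum.group[symmetric]) (use assms in auto)
  also have "\<dots> = (\<Sum>k\<in>{k1, k2, k3, k4}. real (card {b \<in> B. \<kappa> b = k}) * \<phi> k)"
    by (intro sum.cong refl) simp
  finally show ?thesis using assms by simp
qed

section \<open>Values of the principal curvatures and the equivalence\<close>

theorem mainTheorem2:
  fixes N :: "'a::euclidean_space set" and \<xi> :: "'a \<Rightarrow> 'a" and n m1 m2 :: nat
  assumes "DIM('a) = n + 3"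
    and "isoparametric_hypersurface N"
    and "unit_normal_field N \<xi>"
    and "minimal_hypersurface N \<xi>"
    and "positive_ricci N"
    and "four_principal_curvatures N \<xi> m1 m2"
  shows "(\<forall>p\<in>N. \<forall>X\<in>tangent_space N p. \<forall>\<nu>\<in>tangent_space N p.
            norm X = 1 \<longrightarrow> norm \<nu> = 1 \<longrightarrow> X \<bullet> \<nu> = 0 \<longrightarrow> ACS_Delta N p X \<nu> > 0)
         \<longleftrightarrow> min m1 m2 \<ge> 4"
proof -
  obtain k1 k2 k3 k4 where ord: "k1 > k2" "k2 > k3" "k3 > k4"
    and pc: "\<And>p. p \<in> N \<Longrightarrow> principal_curvatures N \<xi> p = {k1, k2, k3, k4} \<and>
               dim (curvature_space N \<xi> p k1) = m1 \<and> dim (curvature_space N \<xi> p k2) = m2 \<and>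
               dim (curvature_space N \<xi> p k3) = m1 \<and> dim (curvature_space N \<xi> p k4) = m2"
    using assms(6) unfolding four_principal_curvatures_def by blast
  let ?K = "{k1, k2, k3, k4}"
  have finK: "finite ?K" by simp
  have pcK: "principal_curvatures N \<xi> q \<subseteq> ?K" if "q \<in> N" for q using pc[OF that] by simp
  obtain p0 where p0: "p0 \<in> N" using assms(2) unfolding isoparametric_hypersurface_def by blast
  obtain S B \<kappa> where "principal_frame N \<xi> p0 ?K S B \<kappa>"
    using isoparametric_principal_frame[OF assms(2-4) finK pcK p0] by blast
  then interpret F: principal_frame N \<xi> p0 ?K S B \<kappa> .
  note B = F.frame F.card_frame F.S_frame F.curvatures F.multiplicity F.trace F.Cartan
  have finB: "finite B" by (rule onb_finite[OF B(1)])
  have card: "card {b \<in> B. \<kappa> b = k1} = m1" "card {b \<in> B. \<kappa> b = k2} = m2"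
    "card {b \<in> B. \<kappa> b = k3} = m1" "card {b \<in> B. \<kappa> b = k4} = m2"
    using B(5) pc[OF p0] by auto
  have sums: "(\<Sum>b\<in>B. \<phi> (\<kappa> b)) = real m1 * \<phi> k1 + real m2 * \<phi> k2 + real m1 * \<phi> k3 + real m2 * \<phi> k4"
    for \<phi> :: "real \<Rightarrow> real"
    using sum_four_values[OF finB B(4) ord, of \<phi>] unfolding card .
  have pos: "dim (curvature_space N \<xi> p0 k) > 0" if "k \<in> ?K" for k
  proof -
    have "k \<in> principal_curvatures N \<xi> p0" using that pc[OF p0] by simp
    then obtain v where v: "v \<in> curvature_space N \<xi> p0 k" "v \<noteq> 0"
      unfolding principal_curvatures_def by blast
    then have "\<not> curvature_space N \<xi> p0 k \<subseteq> {0}" by blast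
    then show ?thesis using dim_eq_0 by blast
  qed
  have m: "m1 > 0" "m2 > 0" using pos[of k1] pos[of k2] pc[OF p0] by auto
  have cardB: "real (card B) = 2 * (real m1 + real m2)" using sums[of "\<lambda>_. 1"] by simp
  have dimN: "real (DIM('a) - 2) = 2 * (real m1 + real m2)" using cardB B(2) by simp
  have Cartan: "real m1 * cot_diff k k1 + real m2 * cot_diff k k2 + real m1 * cot_diff k k3
      + real m2 * cot_diff k k4 = 0" if "k \<in> ?K" for k
  proof -
    have "{b \<in> B. \<kappa> b = k} \<noteq> {}" using B(5)[OF that] pos[OF that]
      by (metis card.empty less_irrefl)
    then obtain e where "e \<in> B" "\<kappa> e = k" by blast
    then show ?thesis using B(7)[of e] sums[of "cot_diff k"] by simp
  qed
  have self: "cot_diff k k = 0" for k by (simp add: cot_diff_def)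
  have turn: "k1 * k3 = -1" "k2 * k4 = -1" "1 + k1 * k2 = k1 - k2"
    using four_curvatures_quarter_turn[OF ord, of "real m1" "real m2"] m
      Cartan[of k1] Cartan[of k2] Cartan[of k3] Cartan[of k4] by (simp_all add: self)
  \<comment> \<open>The largest principal curvature for the opposite normal; if
    \<open>k1 = cot t\<close>, then \<open>l = cot (pi/4 - t)\<close>.\<close>
  define l where "l = - k4"
  have k2l: "k2 * l = 1" using turn(2) by (simp add: l_def)
  have "k1 > 0" using turn(1) ord by (smt (verit) mult_nonneg_nonneg mult_nonpos_nonpos)
  have "k2 > 0" using turn(2) ord by (smt (verit) mult_nonneg_nonneg mult_nonpos_nonpos)
  have "k2 * (1 + k1) = k1 - 1" using turn(3) by (simp add: algebra_simps)
  then have k1: "k1 > 1" using \<open>k2 > 0\<close> \<open>k1 > 0\<close> by (smt (verit) mult_pos_pos)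
  have "l > 0" using k2l \<open>k2 > 0\<close> by (smt (verit) mult_nonneg_nonpos)
  have kl: "k1 * l = k1 + l + 1"
  proof -
    have "(1 + k1 * k2) * l = (k1 - k2) * l" using turn(3) by simp
    then have "l + k1 * (k2 * l) = k1 * l - k2 * l" by (simp add: algebra_simps)
    then show ?thesis using k2l by simp
  qed
  then have "l * (k1 - 1) = k1 + 1" by (simp add: algebra_simps)
  then have l1: "l > 1" using k1 by (smt (verit) mult_left_le_one_le mult_less_cancel_right2 mult_le_cancel_right1)
  have lk: "l * k1 = l + k1 + 1" using kl by (simp add: mult.commute)
  have "k3 = - (1 / k1)" using turn(1) k1 by (simp add: field_simps)
  moreover have "k2 = 1 / l" using k2l l1 by (simp add: field_simps)
  moreover have "k4 = - l" by (simp add: l_def)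
  ultimately have min: "real m1 * (k1 - 1 / k1) = real m2 * (l - 1 / l)"
    using sums[of "\<lambda>t. t"] B(6) by (simp add: algebra_simps)
  have b1: "real m1 + 4 * real m2 < real m1 * k1\<^sup>2" "real m1 * k1\<^sup>2 < 2 * real m1 + 4 * real m2"
    using minimal_quarter_turn_bounds[OF k1 _ _ minimal_quarter_turn[OF k1 l1 kl min]] m by simp_all
  have b2: "real m2 + 4 * real m1 < real m2 * l\<^sup>2" "real m2 * l\<^sup>2 < 2 * real m2 + 4 * real m1"
    using minimal_quarter_turn_bounds[OF l1 _ _ minimal_quarter_turn[OF l1 k1 lk min[symmetric]]] m by simp_all
  show ?thesis
  proof
    assume ACS: "\<forall>p\<in>N. \<forall>X\<in>tangent_space N p. \<forall>\<nu>\<in>tangent_space N p.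
      norm X = 1 \<longrightarrow> norm \<nu> = 1 \<longrightarrow> X \<bullet> \<nu> = 0 \<longrightarrow> ACS_Delta N p X \<nu> > 0"
    \<comment> \<open>Uniform in the pairs \<open>k1\<close>, \<open>m1\<close> and
      \<open>k4\<close>, \<open>m2\<close>, so that either multiplicity may be the smaller
      one.\<close>
    have key: "4 \<le> m" if k: "k \<in> ?K" and c: "card {b \<in> B. \<kappa> b = k} = m"
      and mm: "m \<le> m'" "m + m' = m1 + m2" and lower: "real m + 4 * real m' < real m * k\<^sup>2" for k m m'
    proof (rule ccontr)
      assume "\<not> 4 \<le> m"
      have "m > 0" using pos[OF k] B(5)[OF k] c by simp
      then have "{b \<in> B. \<kappa> b = k} \<noteq> {}" using c \<open>m > 0\<close> by (metis card.empty less_irrefl)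
      then obtain e where e: "e \<in> B" "\<kappa> e = k" by blast
      have eT: "e \<in> tangent_space N p0" and ee: "e \<bullet> e = 1"
        using onb_subset[OF B(1)] onb_inner[OF B(1) e(1) e(1)] e(1) by auto
      have Se: "S e = k *\<^sub>R e" using B(3)[OF e(1)] e(2) by simp
      have "e \<noteq> 0" using ee by auto
      then have "ricci N p0 e e > 0" using assms(5) p0 eT unfolding positive_ricci_def by blast
      then have R: "k\<^sup>2 < 2 * (real m + real m') - 1"
        using mm(2) unfolding F.Ricci[OF eT] cardB Se
        by (simp add: ee power2_eq_square flip: of_nat_add)
      \<comment> \<open>For \<open>m = 1\<close> the bounds would read
        \<open>1 + 4 * m' < k\<^sup>2 < 1 + 2 * m'\<close>.\<close>
      have "m \<noteq> 1" using R lower by auto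
      then have m23: "real m = 2 \<or> real m = 3" using \<open>m > 0\<close> \<open>\<not> 4 \<le> m\<close> by auto
      have "card {b \<in> B. \<kappa> b = k} \<noteq> card {e}" using \<open>m \<noteq> 1\<close> c by simp
      then have "{b \<in> B. \<kappa> b = k} \<noteq> {e}" by metis
      then obtain f where f: "f \<in> B" "\<kappa> f = k" "f \<noteq> e" using e by blast
      have fT: "f \<in> tangent_space N p0" and ff: "f \<bullet> f = 1" and ef: "e \<bullet> f = 0"
        using onb_subset[OF B(1)] onb_inner[OF B(1)] e f by auto
      have Sf: "S f = k *\<^sub>R f" using B(3)[OF f(1)] f(2) by simp
      have nn: "norm e = 1" "norm f = 1" using ee ff by (simp_all add: norm_eq_1)
      have "ACS_Delta N p0 e f > 0" using ACS p0 eT fT nn ef by blast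
      then have "4 * k\<^sup>2 < 4 * (real m + real m') - 4"
        using mm(2) unfolding F.Delta[OF eT nn(1) fT nn(2) ef] cardB Se Sf
        by (simp add: ee ff ef power2_eq_square flip: of_nat_add)
      \<comment> \<open>The lower bound gives \<open>4 * k\<^sup>2 > 4 + 16 * m' / m\<close>. For
        \<open>m = 2\<close> this exceeds \<open>4 + 4 * m'\<close>; for \<open>m = 3\<close> it
        exceeds \<open>8 + 4 * m'\<close> because \<open>m' \<ge> m = 3\<close>.\<close>
      moreover have "4 * (real m + real m') - 4 \<le> 4 * k\<^sup>2"
        using m23 lower mm(1) by auto
      ultimately show False by simp
    qed
    show "min m1 m2 \<ge> 4"
    proof (cases "m1 \<le> m2")
      case True
      then show ?thesis using key[OF _ card(1) True _ b1(1)] by simp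
    next
      case False
      have "real m2 + 4 * real m1 < real m2 * k4\<^sup>2" using b2(1) by (simp add: l_def)
      then show ?thesis using key[OF _ card(4), of m1] False by simp
    qed
  next
    assume "min m1 m2 \<ge> 4"
    then have m4: "real m1 \<ge> 4" "real m2 \<ge> 4" by simp_all
    have range: "- l \<le> t \<and> t \<le> k1" if "t \<in> ?K" for t using that ord by (auto simp: l_def)
    show "\<forall>p\<in>N. \<forall>X\<in>tangent_space N p. \<forall>\<nu>\<in>tangent_space N p.
      norm X = 1 \<longrightarrow> norm \<nu> = 1 \<longrightarrow> X \<bullet> \<nu> = 0 \<longrightarrow> ACS_Delta N p X \<nu> > 0"
    proof (intro ballI impI)
      fix p X v
      assume p: "p \<in> N" and X: "X \<in> tangent_space N p" "norm X = 1"
        and v: "v \<in> tangent_space N p" "norm v = 1" and Xv: "X \<bullet> v = 0"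
      obtain S' B' \<kappa>' where "principal_frame N \<xi> p ?K S' B' \<kappa>'"
        using isoparametric_principal_frame[OF assms(2-4) finK pcK p] by blast
      then interpret F': principal_frame N \<xi> p ?K S' B' \<kappa>' .
      note bX = F'.quadratic_bounds[OF range X] and bv = F'.quadratic_bounds[OF range v]
      \<comment> \<open>The multiplicities were counted at \<open>p0\<close>; the ambient dimension
        carries the total over to \<open>p\<close>.\<close>
      have "real (card B') = 2 * (real m1 + real m2)"
        using dimN unfolding F'.card_frame[symmetric] by simp
      moreover have "2 * (k1 - l) * (S' X \<bullet> X + S' v \<bullet> v)
          = 2 * ((k1 - l) * (S' X \<bullet> X)) + 2 * ((k1 - l) * (S' v \<bullet> v))"
        by (simp add: algebra_simps)
      \<comment> \<open>The mixed term with \<open>S' X \<bullet> v\<close> only helps. Replacing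
        the two squared norms by their affine bounds leaves the estimate at
        \<open>x = S' X \<bullet> X\<close> and \<open>y = S' v \<bullet> v\<close>.\<close>
      ultimately show "ACS_Delta N p X v > 0"
        using ACS_upper_bound_symmetric[OF k1 l1 kl m4 b1(2) b2(2) bX(2,3) bv(2,3)] bX(1) bv(1)
          zero_le_power2[of "S' X \<bullet> v"]
        unfolding F'.Delta[OF X v Xv] by linarith
    qed
  qed
qed

end
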